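(* In the setting of the context there exist constants $0<c\le C$, depending only on $\gamma_1,\gamma_2$, the initial triangulation $\mathcal T_0$ and $\varrho$, such that for all $\mathcal T\in\mathbb T$ and all $f\in L^2(\Omega)$ the following holds. Let $u\in H^1_0(\Omega)$ be the unique solution to $$\int_\Omega\phi(|\nabla u|)\nabla u\cdot\nabla v\,dx=\int_\Omega fv\,dx\quad\text{for all }v\in H^1_0(\Omega),$$ and $p:=\sigma(\nabla u)\in H(\operatorname{div},\Omega)$. Then every $(v_C,q_{RT})\in S^1_0(\mathcal T)\times RT_0(\mathcal T)$ satisfies $$c\,R\le\|p-q_{RT}\|_{H(\operatorname{div},\Omega)}^2+\|\nabla(u-v_C)\|_{L^2(\Omega)}^2\le C\,R,$$ $$R:=\|F-b(v_C,q_{RT};\cdot)\|_{Y_h^*}^2+\|(1-\Pi_0)f\|_{L^2(\Omega)}^2+\|(1-\Pi_0)q_{RT}\|_{L^2(\Omega)}^2 ,$$ where $Y_h:=P_1(\mathcal T)$ and $F(v):=\int_\Omega fv\,dx$.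
   Context: $\Omega\subset\mathbb R^n$ is a bounded Lipschitz domain with polyhedral boundary. $\mathcal T_0$ is a fixed initial regular (conforming) triangulation of $\Omega$ into $n$-simplices and, for a fixed $\varrho>0$, $\mathbb T$ is the set of regular triangulations $\mathcal T$ of $\Omega$ that are refinements of $\mathcal T_0$ with $h_T^n\le\varrho|T|$ for all $T\in\mathcal T$, where $h_T=\operatorname{diam}T$. Nonlinearity: $\phi:[0,\infty)\to\mathbb R$ is continuous, $\phi\in C^2(0,\infty)$, and with constants $0<\gamma_1\le\gamma_2$: $\gamma_1\le\phi(t)\le\gamma_2$ and $\gamma_1\le\phi(t)+t\phi'(t)\le\gamma_2$; $\sigma(A):=\phi(|A|)A$ for $A\in\mathbb R^n$, and $\sigma\in C^1(\mathbb R^n;\mathbb R^n)$. Spaces: $P_k(\mathcal T)$ = piecewise polynomials of degree $\le k$; $\Pi_0$ = $L^2$-orthogonal projection onto piecewise constants (componentwise); $S^1_0(\mathcal T)=P_1(\mathcal T)\cap H^1_0(\Omega)$; $RT_0(\mathcal T)=\{q\in H(\operatorname{div},\Omega): q|_T(x)=A_T+b_T(x-\mathrm{mid}(T)),\ A_T\in\mathbb R^n,\ b_T\in\mathbb R,\ T\in\mathcal T\}$ with $\mathrm{mid}(T)$ the barycenter; $\|q\|_{H(\operatorname{div},\Omega)}^2=\|q\|_{L^2}^2+\|\operatorname{div}q\|_{L^2}^2$. $H^1(\mathcal T)$ = piecewise $H^1$ functions, $\nabla_{NC}$ the piecewise gradient, with scalar product $a(v,w)=\int_\Omega(vw+\nabla_{NC}v\cdot\nabla_{NC}w)\,dx$;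 $\|G\|_{Y_h^*}=\sup\{G(v):v\in Y_h,\ a(v,v)\le1\}$. For $v_C\in S^1_0(\mathcal T)$, $q_{RT}\in RT_0(\mathcal T)$, $v\in H^1(\mathcal T)$: $b(v_C,q_{RT};v)=\int_\Omega\sigma(\nabla v_C)\cdot\nabla_{NC}v\,dx-\sum_{T\in\mathcal T}\int_{\partial T}(q_{RT}|_T\cdot\nu_T)\,v|_T\,ds$, with $\nu_T$ the outer unit normal of $T$. *)

theory Defs
  imports "HOL-Analysis.Analysis"
begin

section \<open>Classical differentiability\<close>

text \<open>\<open>k\<close>-fold continuous differentiability on an open set, by iterated partial derivatives.\<close>

primrec Ck_on :: "nat \<Rightarrow> 'a::euclidean_space set \<Rightarrow> ('a \<Rightarrow> 'b::real_normed_vector) \<Rightarrow> bool" where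
  "Ck_on 0 S f \<longleftrightarrow> continuous_on S f"
| "Ck_on (Suc k) S f \<longleftrightarrow>
     (\<forall>x\<in>S. f differentiable (at x)) \<and>
     (\<forall>i\<in>Basis. Ck_on k S (\<lambda>x. frechet_derivative f (at x) i))"

definition grad :: "('a::euclidean_space \<Rightarrow> real) \<Rightarrow> 'a \<Rightarrow> 'a" where
  "grad \<psi> x = (\<Sum>i\<in>Basis. frechet_derivative \<psi> (at x) i *\<^sub>R i)"

definition test_functions :: "'a::euclidean_space set \<Rightarrow> ('a \<Rightarrow> real) set" where
  "test_functions \<Omega> =
     {\<psi>. (\<forall>k. Ck_on k UNIV \<psi>) \<and> compact (closure {x. \<psi> x \<noteq> 0}) \<and> closure {x. \<psi> x \<noteq> 0} \<subseteq> \<Omega>}"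

section \<open>Lebesgue and Sobolev spaces\<close>

text \<open>
  Elements of \<open>L\<^sup>2\<close> are represented by functions. All notions below depend only on the values
  of these functions almost everywhere on the domain.
\<close>

definition L2 :: "'a::euclidean_space set \<Rightarrow> ('a \<Rightarrow> 'b::euclidean_space) set" where
  "L2 \<Omega> = {f. f \<in> borel_measurable (lebesgue_on \<Omega>) \<and>
              integrable (lebesgue_on \<Omega>) (\<lambda>x. (norm (f x))\<^sup>2)}"

definition L2norm :: "'a::euclidean_space set \<Rightarrow> ('a \<Rightarrow> 'b::euclidean_space) \<Rightarrow> real" where
  "L2norm \<Omega> f = sqrt (LINT x|lebesgue_on \<Omega>. (norm (f x))\<^sup>2)"

definition has_weak_grad ::
  "'a::euclidean_space set \<Rightarrow> ('a \<Rightarrow> real) \<Rightarrow> ('a \<Rightarrow> 'a) \<Rightarrow> bool" where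
  "has_weak_grad \<Omega> u g \<longleftrightarrow>
     (\<forall>\<psi>\<in>test_functions \<Omega>. \<forall>i\<in>Basis.
        (LINT x|lebesgue_on \<Omega>. u x * (grad \<psi> x \<bullet> i)) = - (LINT x|lebesgue_on \<Omega>. (g x \<bullet> i) * \<psi> x))"

definition H1 :: "'a::euclidean_space set \<Rightarrow> ('a \<Rightarrow> real) set" where
  "H1 \<Omega> = {u \<in> L2 \<Omega>. \<exists>g \<in> L2 \<Omega>. has_weak_grad \<Omega> u g}"

text \<open>For \<open>u\<close> in \<open>H1 \<Omega>\<close> with \<open>\<Omega>\<close> open, the chosen representative is unique up to null sets.\<close>

definition weak_grad :: "'a::euclidean_space set \<Rightarrow> ('a \<Rightarrow> real) \<Rightarrow> 'a \<Rightarrow> 'a" where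
  "weak_grad \<Omega> u = (SOME g. g \<in> L2 \<Omega> \<and> has_weak_grad \<Omega> u g)"

definition H10 :: "'a::euclidean_space set \<Rightarrow> ('a \<Rightarrow> real) set" where
  "H10 \<Omega> = {u \<in> H1 \<Omega>. \<exists>\<psi> :: nat \<Rightarrow> 'a \<Rightarrow> real. (\<forall>k. \<psi> k \<in> test_functions \<Omega>) \<and>
     (\<lambda>k. L2norm \<Omega> (\<lambda>x. u x - \<psi> k x)) \<longlonglongrightarrow> 0 \<and>
     (\<lambda>k. L2norm \<Omega> (\<lambda>x. weak_grad \<Omega> u x - grad (\<psi> k) x)) \<longlonglongrightarrow> 0}"

definition has_weak_div ::
  "'a::euclidean_space set \<Rightarrow> ('a \<Rightarrow> 'a) \<Rightarrow> ('a \<Rightarrow> real) \<Rightarrow> bool" where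
  "has_weak_div \<Omega> q d \<longleftrightarrow>
     (\<forall>\<psi>\<in>test_functions \<Omega>.
        (LINT x|lebesgue_on \<Omega>. q x \<bullet> grad \<psi> x) = - (LINT x|lebesgue_on \<Omega>. d x * \<psi> x))"

definition Hdiv :: "'a::euclidean_space set \<Rightarrow> ('a \<Rightarrow> 'a) set" where
  "Hdiv \<Omega> = {q \<in> L2 \<Omega>. \<exists>d \<in> L2 \<Omega>. has_weak_div \<Omega> q d}"

definition weak_div :: "'a::euclidean_space set \<Rightarrow> ('a \<Rightarrow> 'a) \<Rightarrow> 'a \<Rightarrow> real" where
  "weak_div \<Omega> q = (SOME d. d \<in> L2 \<Omega> \<and> has_weak_div \<Omega> q d)"

definition Hdiv_norm :: "'a::euclidean_space set \<Rightarrow> ('a \<Rightarrow> 'a) \<Rightarrow> real" where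
  "Hdiv_norm \<Omega> q = sqrt ((L2norm \<Omega> q)\<^sup>2 + (L2norm \<Omega> (weak_div \<Omega> q))\<^sup>2)"

section \<open>Domains and triangulations\<close>

text \<open>
  Near each boundary point, \<open>\<Omega>\<close> is the region above the graph, in direction \<open>e\<close>, of a Lipschitz
  function \<open>\<psi>\<close> on the hyperplane orthogonal to the unit vector \<open>e\<close>.
\<close>

definition bounded_lipschitz_domain :: "'a::euclidean_space set \<Rightarrow> bool" where
  "bounded_lipschitz_domain \<Omega> \<longleftrightarrow>
     open \<Omega> \<and> connected \<Omega> \<and> \<Omega> \<noteq> {} \<and> bounded \<Omega> \<and>
     (\<forall>z\<in>frontier \<Omega>. \<exists>U e L. \<exists>\<psi> :: 'a \<Rightarrow> real.
        open U \<and> z \<in> U \<and> norm e = 1 \<and> L-lipschitz_on {y. y \<bullet> e = 0} \<psi> \<and>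
        \<Omega> \<inter> U = {y \<in> U. \<psi> (y - (y \<bullet> e) *\<^sub>R e) < y \<bullet> e})"

definition polyhedral_boundary :: "'a::euclidean_space set \<Rightarrow> bool" where
  "polyhedral_boundary \<Omega> \<longleftrightarrow>
     (\<exists>\<F>. finite \<F> \<and> (\<forall>P\<in>\<F>. polytope P \<and> aff_dim P = int DIM('a) - 1) \<and> frontier \<Omega> = \<Union>\<F>)"

definition regular_triangulation :: "'a::euclidean_space set \<Rightarrow> 'a set set \<Rightarrow> bool" where
  "regular_triangulation \<Omega> \<T> \<longleftrightarrow>
     triangulation \<T> \<and> (\<forall>T\<in>\<T>. int DIM('a) simplex T) \<and> \<Union>\<T> = closure \<Omega>"

definition admissible_triangulations ::
  "'a::euclidean_space set \<Rightarrow> 'a set set \<Rightarrow> real \<Rightarrow> 'a set set set" where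
  "admissible_triangulations \<Omega> \<T>\<^sub>0 \<rho> =
     {\<T>. regular_triangulation \<Omega> \<T> \<and> (\<forall>T\<in>\<T>. \<exists>K\<in>\<T>\<^sub>0. T \<subseteq> K) \<and>
         (\<forall>T\<in>\<T>. diameter T ^ DIM('a) \<le> \<rho> * measure lebesgue T)}"

text \<open>The barycenter of a simplex is the mean of its vertices.\<close>

definition barycenter :: "'a::euclidean_space set \<Rightarrow> 'a" where
  "barycenter T = (\<Sum>z | z extreme_point_of T. z) /\<^sub>R real (card {z. z extreme_point_of T})"

section \<open>Finite element spaces\<close>

definition poly_deg_le :: "nat \<Rightarrow> ('a::euclidean_space \<Rightarrow> real) \<Rightarrow> bool" where
  "poly_deg_le k p \<longleftrightarrow>
     (\<exists>c :: ('a \<Rightarrow> nat) \<Rightarrow> real. \<forall>x.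
        p x = (\<Sum>\<alpha> | \<alpha> \<in> Basis \<rightarrow>\<^sub>E {..k} \<and> (\<Sum>i\<in>Basis. \<alpha> i) \<le> k. c \<alpha> * (\<Prod>i\<in>Basis. (x \<bullet> i) ^ \<alpha> i)))"

definition Pk :: "nat \<Rightarrow> 'a::euclidean_space set set \<Rightarrow> ('a \<Rightarrow> real) set" where
  "Pk k \<T> = {v. \<forall>T\<in>\<T>. \<exists>p. poly_deg_le k p \<and> (AE x in lebesgue_on T. v x = p x)}"

definition S10 :: "'a::euclidean_space set \<Rightarrow> 'a set set \<Rightarrow> ('a \<Rightarrow> real) set" where
  "S10 \<Omega> \<T> = Pk 1 \<T> \<inter> H10 \<Omega>"

definition RT0 :: "'a::euclidean_space set \<Rightarrow> 'a set set \<Rightarrow> ('a \<Rightarrow> 'a) set" where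
  "RT0 \<Omega> \<T> = {q \<in> Hdiv \<Omega>. \<forall>T\<in>\<T>. \<exists>A b. AE x in lebesgue_on T. q x = A + b *\<^sub>R (x - barycenter T)}"

text \<open>The \<open>L\<^sup>2\<close>-orthogonal projection onto the piecewise constants, and its componentwise version.\<close>

definition Pi0 :: "'a::euclidean_space set \<Rightarrow> 'a set set \<Rightarrow> ('a \<Rightarrow> real) \<Rightarrow> 'a \<Rightarrow> real" where
  "Pi0 \<Omega> \<T> f =
     (SOME g. g \<in> Pk 0 \<T> \<and> (\<forall>w\<in>Pk 0 \<T>. (LINT x|lebesgue_on \<Omega>. (f x - g x) * w x) = 0))"

definition Pi0_vec :: "'a::euclidean_space set \<Rightarrow> 'a set set \<Rightarrow> ('a \<Rightarrow> 'a) \<Rightarrow> 'a \<Rightarrow> 'a" where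
  "Pi0_vec \<Omega> \<T> q x = (\<Sum>i\<in>Basis. Pi0 \<Omega> \<T> (\<lambda>y. q y \<bullet> i) x *\<^sub>R i)"

definition grad_NC :: "'a::euclidean_space set set \<Rightarrow> ('a \<Rightarrow> real) \<Rightarrow> 'a \<Rightarrow> 'a" where
  "grad_NC \<T> v x = (\<Sum>T\<in>\<T>. indicator (interior T) x *\<^sub>R weak_grad (interior T) v x)"

definition a_form ::
  "'a::euclidean_space set \<Rightarrow> 'a set set \<Rightarrow> ('a \<Rightarrow> real) \<Rightarrow> ('a \<Rightarrow> real) \<Rightarrow> real" where
  "a_form \<Omega> \<T> v w = (LINT x|lebesgue_on \<Omega>. v x * w x + grad_NC \<T> v x \<bullet> grad_NC \<T> w x)"

text \<open>
  The supremum is taken in the reals. It is a genuine one for bounded linear \<open>G\<close>: the set contains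
  \<open>G 0 = 0\<close> and is bounded above.
\<close>

definition dual_norm ::
  "'a::euclidean_space set \<Rightarrow> 'a set set \<Rightarrow> ('a \<Rightarrow> real) set \<Rightarrow> (('a \<Rightarrow> real) \<Rightarrow> real) \<Rightarrow> real" where
  "dual_norm \<Omega> \<T> Y G = (SUP v\<in>{v \<in> Y. a_form \<Omega> \<T> v v \<le> 1}. G v)"

section \<open>Traces and boundary integrals\<close>

text \<open>
  The trace on \<open>\<partial>T\<close> of a Sobolev function on the simplex \<open>T\<close>, as a limit of means. By Lebesgue's
  differentiation theorem for traces, this limit exists at almost every boundary point and is the
  usual trace. If the function agrees a.e. on \<open>T\<close> with a continuous one, it is the value of the latter.
\<close>

definition bdry_trace :: "'a::euclidean_space set \<Rightarrow> ('a \<Rightarrow> 'b::euclidean_space) \<Rightarrow> 'a \<Rightarrow> 'b" where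
  "bdry_trace T v x = Lim (at_right 0)
     (\<lambda>r. (LINT y|lebesgue_on (ball x r \<inter> T). v y) /\<^sub>R measure lebesgue (ball x r \<inter> T))"

definition outer_normal :: "'a::euclidean_space set \<Rightarrow> 'a set \<Rightarrow> 'a" where
  "outer_normal T F =
     (THE \<nu>. norm \<nu> = 1 \<and> (\<exists>s. T \<subseteq> {x. \<nu> \<bullet> x \<le> s} \<and> F \<subseteq> {x. \<nu> \<bullet> x = s}))"

text \<open>
  The surface integral of \<open>g\<close> over a flat piece \<open>F\<close> of codimension one with unit normal \<open>\<nu>\<close>.
  In orthonormal coordinates with last axis \<open>\<nu>\<close> the domain of integration is \<open>F \<times> [0,1]\<close>, and
  \<open>closest_point (affine hull F)\<close> drops the last coordinate. By Fubini's theorem this is the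
  integral of \<open>g\<close> over \<open>F\<close> with respect to the Lebesgue measure of the hyperplane spanned by \<open>F\<close>.
\<close>

definition facet_integral ::
  "'a::euclidean_space \<Rightarrow> 'a set \<Rightarrow> ('a \<Rightarrow> real) \<Rightarrow> real" where
  "facet_integral \<nu> F g =
     (LINT y|lebesgue_on {x + t *\<^sub>R \<nu> |x t. x \<in> F \<and> 0 \<le> t \<and> t \<le> 1}. g (closest_point (affine hull F) y))"

text \<open>\<open>boundary_integral T g\<close> is the integral of \<open>g x (\<nu>\<^sub>T x)\<close> over \<open>\<partial>T\<close>.\<close>

definition boundary_integral :: "'a::euclidean_space set \<Rightarrow> ('a \<Rightarrow> 'a \<Rightarrow> real) \<Rightarrow> real" where
  "boundary_integral T g =
     (\<Sum>F | F facet_of T. facet_integral (outer_normal T F) F (\<lambda>x. g x (outer_normal T F)))"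

section \<open>The nonlinear problem\<close>

definition admissible_nonlinearity :: "real \<Rightarrow> real \<Rightarrow> (real \<Rightarrow> real) \<Rightarrow> bool" where
  "admissible_nonlinearity \<gamma>\<^sub>1 \<gamma>\<^sub>2 \<phi> \<longleftrightarrow>
     continuous_on {0..} \<phi> \<and> Ck_on 2 {0<..} \<phi> \<and>
     (\<forall>t\<ge>0. \<gamma>\<^sub>1 \<le> \<phi> t \<and> \<phi> t \<le> \<gamma>\<^sub>2) \<and>
     (\<forall>t>0. \<gamma>\<^sub>1 \<le> \<phi> t + t * deriv \<phi> t \<and> \<phi> t + t * deriv \<phi> t \<le> \<gamma>\<^sub>2)"

definition sigma_map :: "(real \<Rightarrow> real) \<Rightarrow> 'a::euclidean_space \<Rightarrow> 'a" where
  "sigma_map \<phi> A = \<phi> (norm A) *\<^sub>R A"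

definition weak_solution ::
  "'a::euclidean_space set \<Rightarrow> (real \<Rightarrow> real) \<Rightarrow> ('a \<Rightarrow> real) \<Rightarrow> ('a \<Rightarrow> real) \<Rightarrow> bool" where
  "weak_solution \<Omega> \<phi> f u \<longleftrightarrow> u \<in> H10 \<Omega> \<and>
     (\<forall>v\<in>H10 \<Omega>.
        (LINT x|lebesgue_on \<Omega>. (\<phi> (norm (weak_grad \<Omega> u x)) *\<^sub>R weak_grad \<Omega> u x) \<bullet> weak_grad \<Omega> v x) =
        (LINT x|lebesgue_on \<Omega>. f x * v x))"

definition b_form ::
  "'a::euclidean_space set \<Rightarrow> 'a set set \<Rightarrow> (real \<Rightarrow> real) \<Rightarrow> ('a \<Rightarrow> real) \<Rightarrow> ('a \<Rightarrow> 'a) \<Rightarrow> ('a \<Rightarrow> real) \<Rightarrow> real" where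
  "b_form \<Omega> \<T> \<phi> v\<^sub>C q v =
     (LINT x|lebesgue_on \<Omega>. sigma_map \<phi> (weak_grad \<Omega> v\<^sub>C x) \<bullet> grad_NC \<T> v x) -
     (\<Sum>T\<in>\<T>. boundary_integral T (\<lambda>x \<nu>. (bdry_trace T q x \<bullet> \<nu>) * bdry_trace T v x))"

definition residual_sq ::
  "'a::euclidean_space set \<Rightarrow> 'a set set \<Rightarrow> (real \<Rightarrow> real) \<Rightarrow> ('a \<Rightarrow> real) \<Rightarrow> ('a \<Rightarrow> real) \<Rightarrow> ('a \<Rightarrow> 'a) \<Rightarrow> real" where
  "residual_sq \<Omega> \<T> \<phi> f v\<^sub>C q =
     (dual_norm \<Omega> \<T> (Pk 1 \<T>) (\<lambda>v. (LINT x|lebesgue_on \<Omega>. f x * v x) - b_form \<Omega> \<T> \<phi> v\<^sub>C q v))\<^sup>2 +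
     (L2norm \<Omega> (\<lambda>x. f x - Pi0 \<Omega> \<T> f x))\<^sup>2 +
     (L2norm \<Omega> (\<lambda>x. q x - Pi0_vec \<Omega> \<T> q x))\<^sup>2"

end

theory Submission
  imports Defs
begin

text \<open>
  On each simplex the divergence theorem turns the residual into
  \<open>F(v) - b(v\<^sub>C, q; v) = \<integral> r v + \<integral> s \<bullet> \<nabla>\<^sub>N\<^sub>C v\<close> with \<open>r = f + div q\<close> and
  \<open>s = q - \<sigma> (\<nabla> v\<^sub>C)\<close>. As \<open>div p = - f\<close>, the term \<open>\<parallel>r\<parallel>\<close> is the divergence error, and
  the theorem compares the error with \<open>\<parallel>r\<parallel> + \<parallel>s\<parallel>\<close>. Since \<open>div q\<close> and \<open>\<sigma> (\<nabla> v\<^sub>C)\<close>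
  are piecewise constant, the residual and both oscillation terms are bounded by \<open>\<parallel>r\<parallel> + \<parallel>s\<parallel>\<close>, which
  is bounded by the error because \<open>\<sigma>\<close> is Lipschitz. Conversely, the piecewise constant test function
  \<open>\<Pi>\<^sub>0 r\<close> controls \<open>\<parallel>r\<parallel>\<close>, the piecewise linear one \<open>x \<mapsto> \<Pi>\<^sub>0 s \<bullet> x\<close> controls
  \<open>\<parallel>s\<parallel>\<close>, and strong monotonicity of \<open>\<sigma>\<close> with Friedrichs' inequality bounds the error by
  \<open>\<parallel>r\<parallel> + \<parallel>s\<parallel>\<close>.
\<close>

section \<open>The nonlinearity\<close>

text \<open>The boundary terms are the obstacle: traces are limits of means and surface integrals
  are integrals over prisms of height one, so a divergence theorem has to be won from volume
  integrals. It is needed for the product of an affine field and an affine function on a simplex,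
  where traces are point values. There every constant vector is a combination of the radial fields
  \<open>x - z\<close> about the vertices \<open>z\<close>, with coefficients from the barycentric
  coordinates. A radial field about \<open>z\<close> leaves the simplex only through the facet
  opposite to \<open>z\<close>, and in the cone with apex \<open>z\<close> its flux reduces to the
  fundamental theorem of calculus along rays. Functions in \<open>Pk 1 \<T>\<close> may jump across
  facets, so value and gradient of a test function can be prescribed on each simplex separately. The
  geometry enters the constants through a bound \<open>M\<close> for \<open>norm x\<close> on the
  domain: it controls a function \<open>x \<mapsto> g \<bullet> x\<close> by the norm of
  \<open>g\<close>, and it gives the constant \<open>2 * M\<close> in Friedrichs'
  inequality.\<close>

lemma admissible_nonlinearity_flux:
  assumes adm: "admissible_nonlinearity \<gamma>\<^sub>1 \<gamma>\<^sub>2 \<phi>" and a: "0 \<le> a" and ab: "a \<le> b"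
  shows "\<gamma>\<^sub>1 * (b - a) \<le> b * \<phi> b - a * \<phi> a" and "b * \<phi> b - a * \<phi> a \<le> \<gamma>\<^sub>2 * (b - a)"
proof -
  have cont: "continuous_on {0..} \<phi>" and diff: "\<And>t. t > 0 \<Longrightarrow> \<phi> differentiable (at t)"
    and bnd: "\<And>t. t > 0 \<Longrightarrow> \<gamma>\<^sub>1 \<le> \<phi> t + t * deriv \<phi> t \<and> \<phi> t + t * deriv \<phi> t \<le> \<gamma>\<^sub>2"
    using adm by (auto simp: admissible_nonlinearity_def numeral_2_eq_2)
  have "\<gamma>\<^sub>1 * (b - a) \<le> b * \<phi> b - a * \<phi> a \<and> b * \<phi> b - a * \<phi> a \<le> \<gamma>\<^sub>2 * (b - a)"
  proof (cases "a = b")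
    case False
    then have "a < b" using ab by simp
    moreover have "continuous_on {a..b} (\<lambda>t. t * \<phi> t)"
      using a by (intro continuous_intros continuous_on_subset[OF cont]) auto
    \<comment> \<open>The map \<open>t * \<phi> t\<close> is the radial profile of
      \<open>sigma_map \<phi>\<close>, and the structural bounds are bounds on its derivative; the
      mean value theorem turns them into bounds on differences. Points \<open>t > a\<close> suffice
      for it, which matters for \<open>a = 0\<close>, where \<open>\<phi>\<close> is only
      continuous.\<close>
    moreover have der: "((\<lambda>t. t * \<phi> t) has_derivative (\<lambda>h. (\<phi> t + t * deriv \<phi> t) * h)) (at t)" if "a < t" for t
    proof -
      have "(\<phi> has_real_derivative deriv \<phi> t) (at t)"
        using diff[of t] that a by (simp add: DERIV_deriv_iff_real_differentiable)
      then have "((\<lambda>t. t * \<phi> t) has_real_derivative (\<phi> t + t * deriv \<phi> t)) (at t)"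
        by (auto intro!: derivative_eq_intros)
      then show ?thesis by (simp add: has_field_derivative_def)
    qed
    ultimately obtain \<xi> where "a < \<xi>" "\<xi> < b"
      "b * \<phi> b - a * \<phi> a = (\<phi> \<xi> + \<xi> * deriv \<phi> \<xi>) * (b - a)"
      using mvt[of a b "\<lambda>t. t * \<phi> t" "\<lambda>t h. (\<phi> t + t * deriv \<phi> t) * h"] by auto
    moreover have "\<gamma>\<^sub>1 \<le> \<phi> \<xi> + \<xi> * deriv \<phi> \<xi>" "\<phi> \<xi> + \<xi> * deriv \<phi> \<xi> \<le> \<gamma>\<^sub>2"
      using bnd[of \<xi>] a \<open>a < \<xi>\<close> by auto
    ultimately show ?thesis
      using \<open>a < b\<close> by (simp add: mult_right_mono)
  qed simp
  then show "\<gamma>\<^sub>1 * (b - a) \<le> b * \<phi> b - a * \<phi> a" "b * \<phi> b - a * \<phi> a \<le> \<gamma>\<^sub>2 * (b - a)" by auto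
qed

text \<open>Separates radial from angular contributions. The first summand involves only norms, the
  second the nonnegative Cauchy-Schwarz defect \<open>norm A * norm B - A \<bullet> B\<close>. For
  \<open>r = \<phi> (norm A)\<close> and \<open>s = \<phi> (norm B)\<close> the profile controls the
  former and the bounds on \<open>\<phi>\<close> the latter. \<open>norm_diff_scaled\<close> is the
  matching split of the norm.\<close>

lemma inner_diff_scaled:
  fixes A B :: "'a::real_inner"
  shows "(r *\<^sub>R A - s *\<^sub>R B) \<bullet> (A - B) =
    (norm A * r - norm B * s) * (norm A - norm B) + (r + s) * (norm A * norm B - A \<bullet> B)"
  by (simp add: inner_diff_left inner_diff_right inner_commute algebra_simps
      power2_norm_eq_inner[symmetric] power2_eq_square)

lemma norm_diff_scaled:
  fixes A B :: "'a::real_inner"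
  shows "(norm (r *\<^sub>R A - s *\<^sub>R B))\<^sup>2 =
    (norm A * r - norm B * s)\<^sup>2 + 2 * r * s * (norm A * norm B - A \<bullet> B)"
proof -
  have "(norm (r *\<^sub>R A - s *\<^sub>R B))\<^sup>2 = r * r * (A \<bullet> A) - 2 * r * s * (A \<bullet> B) + s * s * (B \<bullet> B)"
    by (simp add: power2_norm_eq_inner inner_diff_left inner_diff_right inner_commute algebra_simps)
  then show ?thesis
    by (simp add: power2_norm_eq_inner[symmetric] power2_eq_square algebra_simps)
qed

context
  fixes \<gamma>\<^sub>1 \<gamma>\<^sub>2 :: real and \<phi> :: "real \<Rightarrow> real"
  assumes adm: "admissible_nonlinearity \<gamma>\<^sub>1 \<gamma>\<^sub>2 \<phi>" and pos: "0 < \<gamma>\<^sub>1"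
begin

lemma nonlinearity_bounds:
  assumes "t \<ge> 0" shows "\<gamma>\<^sub>1 \<le> \<phi> t" "\<phi> t \<le> \<gamma>\<^sub>2" "0 < \<phi> t"
  using adm pos assms less_le_trans by (auto simp: admissible_nonlinearity_def)

text \<open>Compare both parts of the split with \<open>norm (A - B)\<close> squared, which is the
  squared radial difference plus twice the defect: the profile supplies the factor
  \<open>\<gamma>\<^sub>1\<close> for one part, and
  \<open>\<phi> (norm A) + \<phi> (norm B) \<ge> 2 * \<gamma>\<^sub>1\<close> for the other.\<close>

lemma sigma_map_strongly_monotone:
  "\<gamma>\<^sub>1 * (norm (A - B))\<^sup>2 \<le> (sigma_map \<phi> A - sigma_map \<phi> B) \<bullet> (A - B)"
proof -
  let ?a = "norm A" and ?b = "norm B"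
  have 1: "\<gamma>\<^sub>1 * (?a - ?b)\<^sup>2 \<le> (?a * \<phi> ?a - ?b * \<phi> ?b) * (?a - ?b)"
  proof (cases "?b \<le> ?a")
    case True
    have "\<gamma>\<^sub>1 * (?a - ?b) * (?a - ?b) \<le> (?a * \<phi> ?a - ?b * \<phi> ?b) * (?a - ?b)"
      using admissible_nonlinearity_flux(1)[OF adm _ True] True by (intro mult_right_mono) auto
    then show ?thesis by (simp add: power2_eq_square mult.assoc)
  next
    case False
    then have "\<gamma>\<^sub>1 * (?b - ?a) * (?b - ?a) \<le> (?b * \<phi> ?b - ?a * \<phi> ?a) * (?b - ?a)"
      using admissible_nonlinearity_flux(1)[OF adm, of ?a ?b] by (intro mult_right_mono) auto
    then show ?thesis by (simp add: power2_eq_square algebra_simps)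
  qed
  have "2 * \<gamma>\<^sub>1 * (?a * ?b - A \<bullet> B) \<le> (\<phi> ?a + \<phi> ?b) * (?a * ?b - A \<bullet> B)"
    using nonlinearity_bounds(1)[of ?a] nonlinearity_bounds(1)[of ?b] norm_cauchy_schwarz[of A B]
    by (intro mult_right_mono) auto
  moreover have "(norm (A - B))\<^sup>2 = (?a - ?b)\<^sup>2 + 2 * (?a * ?b - A \<bullet> B)"
    using norm_diff_scaled[of 1 A 1 B] by simp
  moreover have "(sigma_map \<phi> A - sigma_map \<phi> B) \<bullet> (A - B) =
      (?a * \<phi> ?a - ?b * \<phi> ?b) * (?a - ?b) + (\<phi> ?a + \<phi> ?b) * (?a * ?b - A \<bullet> B)"
    unfolding sigma_map_def by (rule inner_diff_scaled)
  ultimately show ?thesis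
    using 1 by (simp only: distrib_left)
qed

text \<open>The comparison is made for squared norms, where both parts of the split carry the square
  of \<open>\<gamma>\<^sub>2\<close>. Hence the Lipschitz constant is
  \<open>\<gamma>\<^sub>2\<close> itself, without the loss of a triangle inequality.\<close>

lemma sigma_map_lipschitz:
  "norm (sigma_map \<phi> A - sigma_map \<phi> B) \<le> \<gamma>\<^sub>2 * norm (A - B)"
proof -
  let ?a = "norm A" and ?b = "norm B"
  have g2: "0 < \<gamma>\<^sub>2" using nonlinearity_bounds[of 0] by simp
  have "\<bar>?a * \<phi> ?a - ?b * \<phi> ?b\<bar> \<le> \<gamma>\<^sub>2 * \<bar>?a - ?b\<bar>"
  proof (cases "?b \<le> ?a")
    case True
    have "0 \<le> \<gamma>\<^sub>1 * (?a - ?b)" using True pos by simp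
    then show ?thesis
      using admissible_nonlinearity_flux[OF adm _ True] True by simp
  next
    case False
    then have "0 \<le> \<gamma>\<^sub>1 * (?b - ?a)" using pos by simp
    then show ?thesis
      using admissible_nonlinearity_flux[OF adm, of ?a ?b] False by simp
  qed
  then have 1: "(?a * \<phi> ?a - ?b * \<phi> ?b)\<^sup>2 \<le> (\<gamma>\<^sub>2 * (?a - ?b))\<^sup>2"
    using g2 by (metis abs_le_square_iff abs_mult abs_of_pos)
  have "\<phi> ?a * \<phi> ?b \<le> \<gamma>\<^sub>2 * \<gamma>\<^sub>2"
    using nonlinearity_bounds[of ?a] nonlinearity_bounds[of ?b] g2 by (intro mult_mono) auto
  then have "(\<phi> ?a * \<phi> ?b) * (2 * (?a * ?b - A \<bullet> B)) \<le> (\<gamma>\<^sub>2 * \<gamma>\<^sub>2) * (2 * (?a * ?b - A \<bullet> B))"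
    using norm_cauchy_schwarz[of A B] by (intro mult_right_mono) auto
  moreover have "(norm (sigma_map \<phi> A - sigma_map \<phi> B))\<^sup>2 =
      (?a * \<phi> ?a - ?b * \<phi> ?b)\<^sup>2 + (\<phi> ?a * \<phi> ?b) * (2 * (?a * ?b - A \<bullet> B))"
    unfolding sigma_map_def norm_diff_scaled by simp
  moreover have "(\<gamma>\<^sub>2 * norm (A - B))\<^sup>2 = (\<gamma>\<^sub>2 * (?a - ?b))\<^sup>2 + (\<gamma>\<^sub>2 * \<gamma>\<^sub>2) * (2 * (?a * ?b - A \<bullet> B))"
    using norm_diff_scaled[of 1 A 1 B]
    by (simp add: power_mult_distrib distrib_left power2_eq_square[of \<gamma>\<^sub>2])
  ultimately have "(norm (sigma_map \<phi> A - sigma_map \<phi> B))\<^sup>2 \<le> (\<gamma>\<^sub>2 * norm (A - B))\<^sup>2"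
    using 1 by linarith
  then show ?thesis using g2 by (simp add: power2_le_iff_abs_le)
qed

lemma continuous_sigma_map: "continuous_on S (sigma_map \<phi> :: 'b::euclidean_space \<Rightarrow> 'b)"
proof -
  have "0 < \<gamma>\<^sub>2" using nonlinearity_bounds[of 0] by simp
  then have "\<gamma>\<^sub>2-lipschitz_on UNIV (sigma_map \<phi> :: 'b \<Rightarrow> 'b)"
    using sigma_map_lipschitz by (auto intro!: lipschitz_onI simp: dist_norm)
  then show ?thesis
    using lipschitz_on_continuous_on continuous_on_subset by blast
qed

end

section \<open>Smooth functions\<close>

text \<open>\<open>Ck_on (Suc k)\<close> speaks about derivatives only, while the product rule
  multiplies them by undifferentiated factors, whose regularity of order \<open>k\<close> must be
  recovered.\<close>

lemma Ck_on_mono_Suc: "Ck_on (Suc k) UNIV f \<Longrightarrow> Ck_on k UNIV f"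
proof (induction k arbitrary: f)
  case 0
  then show ?case
    by (auto simp: continuous_on_eq_continuous_at differentiable_imp_continuous_within)
qed (use Ck_on.simps(2) in blast)

lemma Ck_on_const: "Ck_on k UNIV (\<lambda>x::'a::euclidean_space. c)"
  by (induction k arbitrary: c) auto

lemma Ck_on_add:
  assumes "Ck_on k UNIV f" "Ck_on k UNIV g"
  shows "Ck_on k UNIV (\<lambda>x::'a::euclidean_space. f x + g x)"
  using assms
proof (induction k arbitrary: f g)
  case (Suc k)
  then have "frechet_derivative (\<lambda>x. f x + g x) (at x) i
      = frechet_derivative f (at x) i + frechet_derivative g (at x) i" for x i
    by (subst frechet_derivative_at[symmetric])
       (auto simp: frechet_derivative_works intro!: derivative_eq_intros)
  with Suc show ?case by simp
qed (simp add: continuous_on_add)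

lemma Ck_on_mult:
  fixes f g :: "'a::euclidean_space \<Rightarrow> real"
  assumes "Ck_on k UNIV f" "Ck_on k UNIV g"
  shows "Ck_on k UNIV (\<lambda>x. f x * g x)"
  using assms
proof (induction k arbitrary: f g)
  case (Suc k)
  then have "frechet_derivative (\<lambda>x. f x * g x) (at x) i
      = f x * frechet_derivative g (at x) i + frechet_derivative f (at x) i * g x" for x i
    by (subst frechet_derivative_at[symmetric])
       (auto simp: frechet_derivative_works intro!: derivative_eq_intros)
  moreover have "Ck_on k UNIV f" "Ck_on k UNIV g" using Suc.prems Ck_on_mono_Suc by auto
  ultimately show ?case using Suc by (auto intro!: Ck_on_add)
qed (simp add: continuous_on_mult)

lemma Ck_on_prod:
  fixes f :: "'i \<Rightarrow> 'a::euclidean_space \<Rightarrow> real"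
  assumes "\<And>i. i \<in> I \<Longrightarrow> Ck_on k UNIV (f i)"
  shows "Ck_on k UNIV (\<lambda>x. \<Prod>i\<in>I. f i x)"
  using assms by (induction I rule: infinite_finite_induct) (auto intro!: Ck_on_mult Ck_on_const)

text \<open>This class of functions is closed under differentiation.\<close>

definition flat_exp :: "real poly \<Rightarrow> real \<Rightarrow> real" where
  "flat_exp p t = (if 0 < t then poly p (1 / t) * exp (- (1 / t)) else 0)"

lemma poly_exp_tendsto_0: "((\<lambda>x::real. poly p x * exp (- x)) \<longlongrightarrow> 0) at_top"
proof -
  have "((\<lambda>x. coeff p i * (x ^ i / exp x)) \<longlongrightarrow> coeff p i * 0) at_top" for i
    by (intro tendsto_intros tendsto_power_div_exp_0)
  then have "((\<lambda>x. \<Sum>i\<le>degree p. coeff p i * (x ^ i / exp x)) \<longlongrightarrow> (\<Sum>i\<le>degree p. 0)) at_top"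
    by (intro tendsto_sum) auto
  then show ?thesis
    by (simp add: poly_altdef sum_distrib_right exp_minus field_simps sum_divide_distrib)
qed

text \<open>For \<open>t > 0\<close> the chain rule produces a factor \<open>1 / t^2\<close>,
  absorbed by the polynomial \<open>[:0, 0, 1:]\<close>. At the origin the right difference quotient
  is \<open>x * poly p x * exp (- x)\<close> at \<open>x = 1 / h\<close>, which tends to 0, and the
  left one vanishes.\<close>

lemma DERIV_flat_exp:
  "(flat_exp p has_real_derivative flat_exp ([:0, 0, 1:] * (p - pderiv p)) t) (at t)"
proof -
  consider "t > 0" | "t < 0" | "t = 0" by linarith
  then show ?thesis
  proof cases
    case 1
    have "((\<lambda>t. poly p (1 / t) * exp (- (1 / t))) has_real_derivative
        flat_exp ([:0, 0, 1:] * (p - pderiv p)) t) (at t)"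
      using 1 by (auto intro!: derivative_eq_intros DERIV_chain2[OF poly_DERIV]
          simp: flat_exp_def field_simps power2_eq_square)
    then show ?thesis
      by (rule iffD2[OF DERIV_cong_ev[OF refl _ refl], rotated])
         (use 1 eventually_nhds_in_open[of "{0<..}" t] in
           \<open>auto simp: flat_exp_def elim!: eventually_mono\<close>)
  next
    case 2
    have "((\<lambda>t. 0) has_real_derivative flat_exp ([:0, 0, 1:] * (p - pderiv p)) t) (at t)"
      using 2 by (auto simp: flat_exp_def)
    then show ?thesis
      by (rule iffD2[OF DERIV_cong_ev[OF refl _ refl], rotated])
         (use 2 eventually_nhds_in_open[of "{..<0}" t] in
           \<open>auto simp: flat_exp_def elim!: eventually_mono\<close>)
  next
    case 3
    have "((\<lambda>h. flat_exp p h / h) \<longlongrightarrow> 0) (at 0)"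
    proof (rule filterlim_split_at)
      have "\<forall>\<^sub>F h in at_left 0. 0 = flat_exp p h / h"
        by (auto simp: flat_exp_def eventually_at_filter)
      then show "((\<lambda>h. flat_exp p h / h) \<longlongrightarrow> 0) (at_left 0)"
        by (rule Lim_transform_eventually[OF tendsto_const])
      have "((\<lambda>h. poly ([:0, 1:] * p) (1 / h) * exp (- (1 / h))) \<longlongrightarrow> 0) (at_right 0)"
        using filterlim_compose[OF poly_exp_tendsto_0 filterlim_inverse_at_top_right, of "[:0, 1:] * p"]
        by (simp add: inverse_eq_divide)
      moreover have "\<forall>\<^sub>F h in at_right 0.
          poly ([:0, 1:] * p) (1 / h) * exp (- (1 / h)) = flat_exp p h / h"
        using eventually_at_right_less[of 0]
        by eventually_elim (simp add: flat_exp_def)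
      ultimately show "((\<lambda>h. flat_exp p h / h) \<longlongrightarrow> 0) (at_right 0)"
        by (rule Lim_transform_eventually)
    qed
    then show ?thesis using 3 by (simp add: DERIV_def flat_exp_def)
  qed
qed

lemma Ck_on_flat_exp: "Ck_on k UNIV (\<lambda>x::'a::euclidean_space. flat_exp p (c * (x \<bullet> i) + d))"
proof (induction k arbitrary: p)
  have D: "((\<lambda>x. flat_exp p (c * (x \<bullet> i) + d)) has_derivative
      (\<lambda>h. flat_exp ([:0, 0, 1:] * (p - pderiv p)) (c * (x \<bullet> i) + d) * (c * (h \<bullet> i)))) (at x)"
    for p and x :: 'a
  proof -
    have "((\<lambda>x. c * (x \<bullet> i) + d) has_derivative (\<lambda>h. c * (h \<bullet> i))) (at x)"
      by (auto intro!: derivative_eq_intros)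
    from has_derivative_compose[OF this DERIV_flat_exp[unfolded has_field_derivative_def]]
    show ?thesis .
  qed
  {
    case 0
    show ?case
      using D by (auto simp: continuous_on_eq_continuous_at intro!: has_derivative_continuous)
  next
    case (Suc k)
    then show ?case
      using D by (auto simp: frechet_derivative_at[OF D, symmetric] differentiable_def
          intro!: Ck_on_mult Ck_on_const)
  }
qed

text \<open>A product of functions \<open>exp (- 1 / t)\<close>, one for each of the two faces in
  every coordinate direction. The factor \<open>Suc k\<close> steepens them, so that the limit in
  \<open>k\<close> is the indicator of the open box; being positive also for \<open>k = 0\<close>,
  it keeps every member zero off the box. The arguments are written in the affine form for which
  smoothness is shown above.\<close>

definition box_bump :: "'a::euclidean_space \<Rightarrow> 'a \<Rightarrow> nat \<Rightarrow> 'a \<Rightarrow> real" where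
  "box_bump a b k x = (\<Prod>i\<in>Basis. flat_exp 1 (real (Suc k) * (x \<bullet> i) + - real (Suc k) * (a \<bullet> i)) *
     flat_exp 1 (- real (Suc k) * (x \<bullet> i) + real (Suc k) * (b \<bullet> i)))"

lemma flat_exp_1_bounds: "0 \<le> flat_exp 1 t" "flat_exp 1 t \<le> 1"
  by (auto simp: flat_exp_def)

lemma box_bump_bounds: "0 \<le> box_bump a b k x" "box_bump a b k x \<le> 1"
  unfolding box_bump_def
  by (auto intro!: prod_nonneg prod_le_1 mult_nonneg_nonneg mult_le_one flat_exp_1_bounds)

lemma box_bump_eq_0: "x \<notin> box a b \<Longrightarrow> box_bump a b k x = 0"
proof -
  assume "x \<notin> box a b"
  then obtain i where i: "i \<in> Basis" "x \<bullet> i \<le> a \<bullet> i \<or> b \<bullet> i \<le> x \<bullet> i"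
    by (auto simp: mem_box not_less)
  then have "flat_exp 1 (real (Suc k) * (x \<bullet> i) + - real (Suc k) * (a \<bullet> i)) = 0 \<or>
     flat_exp 1 (- real (Suc k) * (x \<bullet> i) + real (Suc k) * (b \<bullet> i)) = 0"
    by (auto simp: flat_exp_def simp del: of_nat_Suc
        dest: mult_left_mono[of _ _ "real (Suc k)"])
  with i show ?thesis by (force simp: box_bump_def prod_zero_iff)
qed

lemma flat_exp_scaled_tendsto: "0 < t \<Longrightarrow> (\<lambda>k. flat_exp 1 (real (Suc k) * t)) \<longlonglongrightarrow> 1"
proof -
  assume "0 < t"
  have "(\<lambda>k. exp (- (1 / t * (1 / real (Suc k))))) \<longlonglongrightarrow> exp (- (1 / t * 0))"
    by (intro tendsto_intros) (use LIMSEQ_inverse_real_of_nat in \<open>simp add: inverse_eq_divide\<close>)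
  with \<open>0 < t\<close> show ?thesis by (simp add: flat_exp_def mult.commute)
qed

lemma box_bump_tendsto: "(\<lambda>k. box_bump a b k x) \<longlonglongrightarrow> indicator (box a b) x"
proof (cases "x \<in> box a b")
  case True
  have "(\<lambda>k. \<Prod>i\<in>Basis. flat_exp 1 (real (Suc k) * (x \<bullet> i - a \<bullet> i)) * flat_exp 1 (real (Suc k) * (b \<bullet> i - x \<bullet> i)))
     \<longlonglongrightarrow> (\<Prod>i\<in>(Basis::'a set). 1 * 1)"
    using True by (intro tendsto_prod tendsto_mult flat_exp_scaled_tendsto) (auto simp: mem_box)
  then show ?thesis using True by (simp add: box_bump_def algebra_simps del: of_nat_Suc)
qed (simp add: box_bump_eq_0)

lemma box_bump_test_function:
  assumes "cbox a b \<subseteq> \<Omega>"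
  shows "box_bump a b k \<in> test_functions \<Omega>"
proof -
  have "{x. box_bump a b k x \<noteq> 0} \<subseteq> cbox a b"
    using box_bump_eq_0 box_subset_cbox by blast
  then have "closure {x. box_bump a b k x \<noteq> 0} \<subseteq> cbox a b"
    by (rule closure_minimal) (rule closed_cbox)
  then have "compact (closure {x. box_bump a b k x \<noteq> 0})"
    by (meson bounded_cbox bounded_subset closed_closure compact_eq_bounded_closed)
  moreover have "Ck_on m UNIV (box_bump a b k)" for m
    unfolding box_bump_def by (intro Ck_on_prod Ck_on_mult Ck_on_flat_exp)
  ultimately show ?thesis
    using \<open>closure _ \<subseteq> _\<close> assms by (auto simp: test_functions_def)
qed

section \<open>The fundamental lemma of the calculus of variations\<close>

lemma Int_stable_boxes: "Int_stable (range (\<lambda>(a, b). box a b :: 'a::euclidean_space set))"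
  by (auto simp: Int_stable_def box_Int_box)

text \<open>A Dynkin system argument: boxes are stable under intersection and generate the Borel
  sets, and the sets with vanishing integral are closed under countable disjoint unions. Closure
  under complements needs the total integral to vanish, which follows by exhausting the space with
  boxes.\<close>

lemma AE_zero_of_box_integrals:
  fixes h :: "'a::euclidean_space \<Rightarrow> real"
  assumes int: "integrable lborel h"
    and box: "\<And>a b. (LINT x|lborel. indicator (box a b) x *\<^sub>R h x) = 0"
  shows "AE x in lborel. h x = 0"
proof (rule sigma_finite_measure.density_zero[OF sigma_finite_lborel int])
  have total: "integral\<^sup>L lborel h = 0"
  proof -
    have "(\<lambda>n. LINT x|lborel. indicator (box (- real n *\<^sub>R One) (real n *\<^sub>R One)) x *\<^sub>R h x) \<longlonglongrightarrow> integral\<^sup>L lborel h"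
    proof (rule integral_dominated_convergence[where w="\<lambda>x. norm (h x)"])
      show "AE x in lborel. (\<lambda>n. indicator (box (- real n *\<^sub>R One) (real n *\<^sub>R One)) x *\<^sub>R h x) \<longlonglongrightarrow> h x"
      proof (rule AE_I2)
        fix x :: 'a
        obtain N :: nat where N: "norm x < real N" using reals_Archimedean2 by blast
        have "x \<in> box (- real n *\<^sub>R One) (real n *\<^sub>R One)" if "n \<ge> N" for n
        proof -
          have "\<bar>x \<bullet> i\<bar> < real n" if "i \<in> Basis" for i
            using N \<open>n \<ge> N\<close> Basis_le_norm[OF that, of x] by linarith
          then show ?thesis by (auto simp: mem_box abs_less_iff minus_less_iff)
        qed
        then have "\<forall>\<^sub>F n in sequentially. h x = indicator (box (- real n *\<^sub>R One) (real n *\<^sub>R One)) x *\<^sub>R h x"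
          by (intro eventually_sequentiallyI[of N]) simp
        then show "(\<lambda>n. indicator (box (- real n *\<^sub>R One) (real n *\<^sub>R One)) x *\<^sub>R h x) \<longlonglongrightarrow> h x"
          by (rule Lim_transform_eventually[OF tendsto_const])
      qed
    qed (use int in \<open>auto intro!: borel_measurable_scaleR simp: indicator_def\<close>)
    then have "(\<lambda>n::nat. 0) \<longlonglongrightarrow> integral\<^sup>L lborel h" by (simp only: box)
    then show ?thesis by (simp add: LIMSEQ_const_iff)
  qed
  fix A :: "'a set" assume "A \<in> sets lborel"
  then have "A \<in> sigma_sets UNIV (range (\<lambda>(a, b). box a b))"
    by (simp add: borel_eq_box)
  with Int_stable_boxes have "Int_stable (range (\<lambda>(a, b). box a b :: 'a set))"
    "range (\<lambda>(a, b). box a b :: 'a set) \<subseteq> Pow UNIV" "A \<in> sigma_sets UNIV (range (\<lambda>(a, b). box a b))"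
    by auto
  then show "set_lebesgue_integral lborel A h = 0"
  proof (induction rule: sigma_sets_induct_disjoint)
    case (basic A)
    then show ?case using box by (auto simp: set_lebesgue_integral_def)
  next
    case empty
    then show ?case by (simp add: set_lebesgue_integral_def)
  next
    case (compl A)
    then have "A \<in> sets lborel" by (simp add: borel_eq_box)
    then have "(LINT x|lborel. h x - indicator A x *\<^sub>R h x) = integral\<^sup>L lborel h - 0"
      using compl by (subst Bochner_Integration.integral_diff) (auto simp: set_lebesgue_integral_def int intro!: integrable_mult_indicator simp del: real_scaleR_def)
    moreover have "(\<lambda>x. indicator (UNIV - A) x *\<^sub>R h x) = (\<lambda>x. h x - indicator A x *\<^sub>R h x)"
      by (auto simp: indicator_def)
    ultimately show ?case by (simp add: set_lebesgue_integral_def total)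
  next
    case (union A)
    then have *: "A i \<in> sets lborel" for i by (auto simp: borel_eq_box)
    then have "set_integrable lborel (\<Union>i. A i) h"
      unfolding set_integrable_def by (intro integrable_mult_indicator int) auto
    then have "set_lebesgue_integral lborel (\<Union>i. A i) h = (\<Sum>i. set_lebesgue_integral lborel (A i) h)"
      using union * by (intro lebesgue_integral_countable_add) (auto simp: disjoint_family_on_def)
    then show ?case using union by simp
  qed
qed

section \<open>Restriction of Lebesgue measure to subsets, and the fundamental lemma\<close>

lemma integral_lebesgue_on_subset:
  fixes f :: "'a::euclidean_space \<Rightarrow> 'b::euclidean_space"
  assumes "S \<subseteq> T" "S \<in> sets lebesgue" "T \<in> sets lebesgue" "\<And>x. x \<in> T \<Longrightarrow> x \<notin> S \<Longrightarrow> f x = 0"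
  shows "integral\<^sup>L (lebesgue_on T) f = integral\<^sup>L (lebesgue_on S) f"
proof -
  have "integral\<^sup>L (lebesgue_on T) f = integral\<^sup>L (lebesgue_on T) (\<lambda>x. if x \<in> S then f x else 0)"
    using assms by (intro Bochner_Integration.integral_cong) auto
  then show ?thesis using integral_restrict[of S T f] assms by simp
qed

lemma AE_lebesgue_on_subset:
  assumes "AE x in lebesgue_on T. P x" "S \<subseteq> T" "S \<in> sets lebesgue" "T \<in> sets lebesgue"
  shows "AE x in lebesgue_on S. P x"
  using assms by (auto simp: AE_restrict_space_iff elim!: eventually_mono)

lemma integrable_lebesgue_on_subset:
  fixes f :: "'a::euclidean_space \<Rightarrow> 'b::euclidean_space"
  assumes "integrable (lebesgue_on T) f" "S \<subseteq> T" "S \<in> sets lebesgue" "T \<in> sets lebesgue"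
  shows "integrable (lebesgue_on S) f"
proof -
  have "integrable lebesgue (\<lambda>x. indicator S x *\<^sub>R (indicator T x *\<^sub>R f x))"
    using assms(1,4) by - (rule integrable_mult_indicator[OF assms(3)], simp add: integrable_restrict_space)
  moreover have "(\<lambda>x. indicator S x *\<^sub>R (indicator T x *\<^sub>R f x)) = (\<lambda>x. indicator S x *\<^sub>R f x)"
    using assms(2) by (auto simp: fun_eq_iff split: split_indicator)
  ultimately show ?thesis using assms(3) by (simp add: integrable_restrict_space)
qed

text \<open>The bumps converge to the indicator of a box and \<open>h\<close> itself dominates, so
  the integral of \<open>h\<close> over every box whose closure lies in the domain is zero. This
  determines \<open>h\<close> on each closed box inside the domain, and countably many of these
  cover it.\<close>

lemma fundamental_lemma:
  fixes \<Omega> :: "'a::euclidean_space set"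
  assumes op: "open \<Omega>" and int: "integrable (lebesgue_on \<Omega>) h"
    and test: "\<And>\<psi>. \<psi> \<in> test_functions \<Omega> \<Longrightarrow> (LINT x|lebesgue_on \<Omega>. h x * \<psi> x) = 0"
  shows "AE x in lebesgue_on \<Omega>. h x = (0::real)"
proof -
  have [simp]: "\<Omega> \<in> sets lebesgue" using op by auto
  have meas: "h \<in> borel_measurable (lebesgue_on \<Omega>)" using int by auto
  have box0: "(LINT x|lebesgue_on \<Omega>. indicator (box a b) x * h x) = 0" if ab: "cbox a b \<subseteq> \<Omega>" for a b
  proof -
    have "(\<lambda>k. LINT x|lebesgue_on \<Omega>. h x * box_bump a b k x) \<longlonglongrightarrow> (LINT x|lebesgue_on \<Omega>. h x * indicator (box a b) x)"
    proof (rule integral_dominated_convergence[where w="\<lambda>x. norm (h x)"])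
      show "(\<lambda>x. h x * box_bump a b k x) \<in> borel_measurable (lebesgue_on \<Omega>)" for k
      proof -
        have "continuous_on UNIV (box_bump a b k)"
          using box_bump_test_function[of a b UNIV k] by (auto simp: test_functions_def dest: spec[of _ "0::nat"])
        then have "box_bump a b k \<in> borel_measurable (lebesgue_on \<Omega>)"
          by (simp add: continuous_imp_measurable_on_sets_lebesgue continuous_on_subset)
        then show ?thesis using meas by simp
      qed
      show "AE x in lebesgue_on \<Omega>. norm (h x * box_bump a b k x) \<le> norm (h x)" for k
        using box_bump_bounds[of a b k] by (intro AE_I2) (simp add: abs_mult mult_left_le)
      show "(\<lambda>x. h x * indicator (box a b) x) \<in> borel_measurable (lebesgue_on \<Omega>)"
        using meas by (intro borel_measurable_times borel_measurable_indicator)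
          (use ab box_subset_cbox[of a b] in \<open>auto simp: sets_restrict_space_iff\<close>)
      show "AE x in lebesgue_on \<Omega>. (\<lambda>k. h x * box_bump a b k x) \<longlonglongrightarrow> h x * indicator (box a b) x"
        by (intro AE_I2 tendsto_mult tendsto_const box_bump_tendsto)
    qed (use int in auto)
    moreover have "(LINT x|lebesgue_on \<Omega>. h x * box_bump a b k x) = 0" for k
      using test box_bump_test_function[OF ab] by blast
    ultimately show ?thesis by (simp add: LIMSEQ_const_iff mult.commute)
  qed
  \<comment> \<open>The lemma on boxes speaks about \<open>lborel\<close>, while \<open>h\<close> is
    merely Lebesgue measurable: \<open>h\<close> is extended by zero and replaced by a Borel
    representative \<open>H'\<close>.\<close>
  define H where "H = (\<lambda>x. indicator \<Omega> x * h x)"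
  have "integrable lebesgue H"
    using int by (simp add: H_def integrable_restrict_space)
  then obtain H' where H': "H' \<in> borel_measurable lborel" "AE x in lborel. H x = H' x"
    using completion_ex_borel_measurable_real[of H lborel] by auto
  from H'(2) have AE': "AE x in lebesgue. H x = H' x" by (rule AE_completion)
  have "H' \<in> borel_measurable lebesgue" using H'(1) by (rule measurable_completion)
  with \<open>integrable lebesgue H\<close> AE' have "integrable lebesgue H'"
    using integrable_cong_AE[of H lebesgue H'] by auto
  then have intH': "integrable lborel H'"
    using H'(1) by (simp add: integrable_completion)
  have local: "AE x in lebesgue. x \<in> cbox c d \<longrightarrow> H x = 0" if cd: "cbox c d \<subseteq> \<Omega>" for c d
  proof -
    have "AE x in lborel. indicator (box c d) x *\<^sub>R H' x = 0"
    proof (rule AE_zero_of_box_integrals)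
      show "integrable lborel (\<lambda>x. indicator (box c d) x *\<^sub>R H' x)"
        by (intro integrable_mult_indicator intH') auto
      fix a b :: 'a
      obtain l u where lu: "box a b \<inter> box c d = box l u" by (simp add: box_Int_box)
      \<comment> \<open>All boxes have to be tested, not only those inside the domain. After
        multiplication by the indicator of \<open>box c d\<close> the tested box becomes an
        intersection, which is empty or has its closure in \<open>cbox c d\<close>.\<close>
      have "cbox l u \<subseteq> \<Omega> \<or> box l u = {}"
      proof (cases "box l u = {}")
        case False
        then have "cbox l u = closure (box l u)" by (simp add: closure_box)
        also have "\<dots> \<subseteq> cbox c d"
          by (rule closure_minimal) (use lu box_subset_cbox in blast, rule closed_cbox)
        finally show ?thesis using cd by blast
      qed simp
      then have "(LINT x|lebesgue_on \<Omega>. indicator (box l u) x * h x) = 0"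
        using box0 by auto
      moreover have "(LINT x|lebesgue_on \<Omega>. indicator (box l u) x * h x) = (LINT x|lebesgue. indicator (box l u) x * H x)"
        by (simp add: integral_restrict_space H_def mult.left_commute)
      moreover have "\<dots> = (LINT x|lebesgue. indicator (box l u) x * H' x)"
      proof (rule integral_cong_AE)
        show "(\<lambda>x. indicator (box l u) x * H x) \<in> borel_measurable lebesgue"
          using \<open>integrable lebesgue H\<close> by (intro borel_measurable_times borel_measurable_indicator) auto
        show "(\<lambda>x. indicator (box l u) x * H' x) \<in> borel_measurable lebesgue"
          using \<open>integrable lebesgue H'\<close> by (intro borel_measurable_times borel_measurable_indicator) auto
        show "AE x in lebesgue. indicator (box l u) x * H x = indicator (box l u) x * H' x"
          using AE' by eventually_elim simp
      qed
      moreover have "(\<lambda>x. indicator (box l u) x * H' x) = (\<lambda>x. indicator (box a b) x *\<^sub>R indicator (box c d) x *\<^sub>R H' x)"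
        using lu[symmetric] by (auto simp: indicator_def)
      moreover have "(\<lambda>x. indicator (box l u) x * H' x) \<in> borel_measurable lborel"
        using H'(1) by (intro borel_measurable_times borel_measurable_indicator) auto
      ultimately show "(LINT x|lborel. indicator (box a b) x *\<^sub>R indicator (box c d) x *\<^sub>R H' x) = 0"
        using integral_completion[of "\<lambda>x. indicator (box l u) x * H' x" lborel] by simp
    qed
    then have "AE x in lebesgue. indicator (box c d) x *\<^sub>R H' x = 0" by (rule AE_completion)
    \<comment> \<open>The cover below consists of closed boxes, whereas the argument so far reaches
      open ones; their faces are null sets.\<close>
    moreover have "AE x in lebesgue. x \<notin> cbox c d - box c d"
      using negligible_frontier_interval[of c d] by (intro AE_not_in) (simp add: negligible_iff_null_sets)
    ultimately show ?thesis using AE'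
      by eventually_elim (auto split: split_indicator_asm)
  qed
  obtain \<D> where \<D>: "countable \<D>" "\<D> \<subseteq> Pow \<Omega>" "\<And>X. X \<in> \<D> \<Longrightarrow> \<exists>a b. X = cbox a b" "\<Union>\<D> = \<Omega>"
    using open_countable_Union_open_cbox[OF op] by metis
  have "AE x in lebesgue. \<forall>X\<in>\<D>. x \<in> X \<longrightarrow> H x = 0"
    unfolding AE_ball_countable[OF \<D>(1)] using \<D>(2,3) local by fast
  then have "AE x in lebesgue. x \<in> \<Omega> \<longrightarrow> h x = 0"
  proof eventually_elim
    case (elim x)
    then show ?case using \<D>(4) by (cases "x \<in> \<Omega>") (auto simp: H_def)
  qed
  then show ?thesis by (simp add: AE_restrict_space_iff)
qed

section \<open>Integration by parts against test functions\<close>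

lemma integral_translation:
  fixes f :: "'a::euclidean_space \<Rightarrow> 'b::euclidean_space"
  assumes "f \<in> borel_measurable borel"
  shows "(LINT x|lborel. f (x + c)) = (LINT x|lborel. f x)"
  using integral_distr[of "(+) c" lborel borel f] assms by (simp add: lborel_distr_plus add.commute)

text \<open>By translation invariance \<open>\<psi> (x + e) - \<psi> x\<close> integrates to zero.
  It is also the integral of \<open>D (x + t *\<^sub>R e) \<bullet> e\<close> over \<open>t\<close>
  in [0,1], and after exchanging the integrals a second translation shows that each \<open>t\<close>
  contributes the same value. No coordinates are needed, and \<open>e\<close> is an arbitrary
  vector.\<close>

lemma integral_directional_derivative_zero:
  fixes \<psi> :: "'a::euclidean_space \<Rightarrow> real"
  assumes der: "\<And>x. (\<psi> has_derivative (\<lambda>h. D x \<bullet> h)) (at x)" and cont: "continuous_on UNIV D"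
    and K: "compact K" and zero: "\<And>x. x \<notin> K \<Longrightarrow> \<psi> x = 0 \<and> D x = 0"
  shows "(LINT x|lborel. D x \<bullet> e) = 0"
proof -
  have cont\<psi>: "continuous_on UNIV \<psi>"
    using has_derivative_continuous[OF der] by (simp add: continuous_on_eq_continuous_at)
  have [measurable]: "\<psi> \<in> borel_measurable borel" "D \<in> borel_measurable borel"
    using cont cont\<psi> by (auto intro: borel_measurable_continuous_onI)
  \<comment> \<open>The set of pairs \<open>(x, t)\<close> with \<open>t\<close> in [0,1] for which
    \<open>x + t *\<^sub>R e\<close> meets the support. It is compact, which supplies the joint
    integrability required by Fubini.\<close>
  define S where "S = (\<lambda>(y, t). (y - t *\<^sub>R e, t)) ` (K \<times> {0..1::real})"
  have "compact S"
    unfolding S_def using K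
    by (intro compact_continuous_image compact_Times) (auto simp: split_def intro!: continuous_intros)
  then have "integrable lborel (\<lambda>z::'a\<times>real. indicator S z *\<^sub>R (D (fst z + snd z *\<^sub>R e) \<bullet> e))"
    by (rule borel_integrable_compact) (auto intro!: continuous_intros continuous_on_compose2[OF cont])
  moreover have "indicator S z *\<^sub>R (D (fst z + snd z *\<^sub>R e) \<bullet> e) = indicator {0..1} (snd z) *\<^sub>R (D (fst z + snd z *\<^sub>R e) \<bullet> e)"
    for z :: "'a \<times> real"
  proof (cases "z \<in> S")
    case True
    then show ?thesis by (auto simp: S_def indicator_def)
  next
    case False
    have "(snd z \<in> {0..1}) \<Longrightarrow> fst z + snd z *\<^sub>R e \<notin> K"
    proof
      assume "snd z \<in> {0..1}" "fst z + snd z *\<^sub>R e \<in> K"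
      then have "z \<in> S" unfolding S_def
        by (intro image_eqI[of _ _ "(fst z + snd z *\<^sub>R e, snd z)"]) auto
      with False show False by simp
    qed
    then show ?thesis using False zero by (auto simp: indicator_def)
  qed
  ultimately have int: "integrable (lborel \<Otimes>\<^sub>M lborel) (\<lambda>(x, t). indicator {0..1::real} t *\<^sub>R (D (x + t *\<^sub>R e) \<bullet> e))"
    by (simp only: lborel_prod split_def)
  have inner: "(LINT t|lborel. indicator {0..1::real} t *\<^sub>R (D (x + t *\<^sub>R e) \<bullet> e)) = \<psi> (x + e) - \<psi> x" for x
  proof -
    have "((\<lambda>t. \<psi> (x + t *\<^sub>R e)) has_real_derivative (D (x + t *\<^sub>R e) \<bullet> e)) (at t)" for t
    proof -
      have "((\<lambda>t. x + t *\<^sub>R e) has_derivative (\<lambda>h. h *\<^sub>R e)) (at t)"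
        by (auto intro!: derivative_eq_intros)
      from has_derivative_compose[OF this der]
      show ?thesis
        unfolding has_field_derivative_def by (rule has_derivative_eq_rhs) (simp add: fun_eq_iff)
    qed
    then have vec: "((\<lambda>t. \<psi> (x + t *\<^sub>R e)) has_vector_derivative (D (x + t *\<^sub>R e) \<bullet> e)) (at t within {0..1})" for t
      by (simp add: has_real_derivative_iff_has_vector_derivative has_vector_derivative_at_within)
    have "continuous_on {0..1} (\<lambda>t. D (x + t *\<^sub>R e) \<bullet> e)"
      by (intro continuous_intros continuous_on_compose2[OF cont]) auto
    from integral_FTC_Icc[OF _ vec this]
    have "(LINT t|lborel. indicator {0..1} t *\<^sub>R (D (x + t *\<^sub>R e) \<bullet> e)) = \<psi> (x + 1 *\<^sub>R e) - \<psi> (x + 0 *\<^sub>R e)"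
      by simp
    then show ?thesis by simp
  qed
  have int\<psi>: "integrable lborel \<psi>"
  proof -
    have "(\<lambda>x. indicator K x *\<^sub>R \<psi> x) = \<psi>"
      using zero by (auto simp: fun_eq_iff split: split_indicator)
    then show ?thesis using borel_integrable_compact[OF K, of \<psi>] cont\<psi> continuous_on_subset by auto
  qed
  then have "integrable lborel (\<lambda>x. \<psi> (x + e))"
    using integrable_distr[of "(+) e" lborel borel \<psi>] by (simp add: lborel_distr_plus add.commute)
  then have "0 = (LINT x|lborel. \<psi> (x + e) - \<psi> x)"
    using int\<psi> by (simp add: integral_translation)
  also have "\<dots> = (LINT x|lborel. LINT t|lborel. indicator {0..1::real} t *\<^sub>R (D (x + t *\<^sub>R e) \<bullet> e))"
    by (simp only: inner)
  also have "\<dots> = (LINT t|lborel. LINT x|lborel. indicator {0..1::real} t *\<^sub>R (D (x + t *\<^sub>R e) \<bullet> e))"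
    using lborel_pair.Fubini_integral[OF int] by simp
  also have "\<dots> = (LINT t|lborel. indicator {0..1::real} t *\<^sub>R (LINT x|lborel. D x \<bullet> e))"
    using integral_translation[of "\<lambda>x. D x \<bullet> e"] by simp
  also have "\<dots> = (LINT x|lborel. D x \<bullet> e)" by simp
  finally show ?thesis by simp
qed

lemma test_function_props:
  fixes \<Omega> :: "'a::euclidean_space set"
  assumes \<psi>: "\<psi> \<in> test_functions \<Omega>"
  obtains K where "compact K" "K \<subseteq> \<Omega>" "\<And>x. (\<psi> has_derivative (\<lambda>h. grad \<psi> x \<bullet> h)) (at x)"
    "continuous_on UNIV \<psi>" "continuous_on UNIV (grad \<psi>)" "\<And>x. x \<notin> K \<Longrightarrow> \<psi> x = 0 \<and> grad \<psi> x = 0"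
proof
  let ?K = "closure {x. \<psi> x \<noteq> 0}"
  show "compact ?K" "?K \<subseteq> \<Omega>" using \<psi> by (auto simp: test_functions_def)
  have Ck: "Ck_on k UNIV \<psi>" for k using \<psi> by (auto simp: test_functions_def)
  from Ck[of 0] show "continuous_on UNIV \<psi>" by simp
  from Ck[of "Suc 0"] have diff: "\<psi> differentiable (at x)"
    and cont: "i \<in> Basis \<Longrightarrow> continuous_on UNIV (\<lambda>x. frechet_derivative \<psi> (at x) i)" for x i
    by auto
  show "continuous_on UNIV (grad \<psi>)"
    unfolding grad_def by (intro continuous_intros cont)
  show der: "(\<psi> has_derivative (\<lambda>h. grad \<psi> x \<bullet> h)) (at x)" for x
  proof -
    have D: "(\<psi> has_derivative frechet_derivative \<psi> (at x)) (at x)"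
      using diff by (simp add: frechet_derivative_works)
    have "frechet_derivative \<psi> (at x) = (\<lambda>h. grad \<psi> x \<bullet> h)"
    proof
      fix h
      interpret linear "frechet_derivative \<psi> (at x)"
        using D has_derivative_linear by blast
      have "frechet_derivative \<psi> (at x) h = frechet_derivative \<psi> (at x) (\<Sum>i\<in>Basis. (h \<bullet> i) *\<^sub>R i)"
        by (simp add: euclidean_representation)
      also have "\<dots> = (\<Sum>i\<in>Basis. (h \<bullet> i) * frechet_derivative \<psi> (at x) i)"
        by (simp add: sum scale)
      also have "\<dots> = grad \<psi> x \<bullet> h"
        by (simp add: grad_def inner_sum_left inner_commute[of h] mult.commute)
      finally show "frechet_derivative \<psi> (at x) h = grad \<psi> x \<bullet> h" .
    qed
    with D show ?thesis by simp
  qed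
  fix x assume x: "x \<notin> ?K"
  have "((\<lambda>_. 0) has_derivative (\<lambda>h. 0)) (at x)" by simp
  then have "(\<psi> has_derivative (\<lambda>h. 0)) (at x)"
    by (rule has_derivative_transform_within_open[of _ _ _ _ "- ?K"])
      (use x closure_subset[of "{x. \<psi> x \<noteq> 0}"] in auto)
  then have "(\<lambda>h. grad \<psi> x \<bullet> h) = (\<lambda>h. 0)"
    using der has_derivative_unique by blast
  then have "grad \<psi> x \<bullet> grad \<psi> x = 0" by metis
  then show "\<psi> x = 0 \<and> grad \<psi> x = 0"
    using x closure_subset[of "{x. \<psi> x \<noteq> 0}"] by auto
qed

lemma continuous_compact_support:
  fixes f :: "'a::euclidean_space \<Rightarrow> 'b::euclidean_space"
  assumes "continuous_on UNIV f" "compact K" "K \<subseteq> \<Omega>" "\<And>x. x \<notin> K \<Longrightarrow> f x = 0" "\<Omega> \<in> sets lebesgue"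
  shows "integrable (lebesgue_on \<Omega>) f" "integral\<^sup>L (lebesgue_on \<Omega>) f = integral\<^sup>L lborel f"
    "integrable lborel f"
proof -
  have "(\<lambda>x. indicator K x *\<^sub>R f x) = f" and ind: "(\<lambda>x. indicator \<Omega> x *\<^sub>R f x) = f"
    using assms(3,4) by (auto simp: fun_eq_iff split: split_indicator)
  then show int: "integrable lborel f"
    using borel_integrable_compact[OF assms(2) continuous_on_subset[OF assms(1)]] by simp
  have "f \<in> borel_measurable lborel" using assms(1) by (auto intro: borel_measurable_continuous_onI)
  with int ind assms(5) show "integrable (lebesgue_on \<Omega>) f" "integral\<^sup>L (lebesgue_on \<Omega>) f = integral\<^sup>L lborel f"
    by (simp_all add: integrable_restrict_space integral_restrict_space integrable_completion integral_completion
        del: real_scaleR_def)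
qed

lemma continuous_of_derivative:
  "(\<And>x. (g has_derivative (\<lambda>h. D x \<bullet> h)) (at x)) \<Longrightarrow> continuous_on S g"
  using has_derivative_continuous continuous_at_imp_continuous_on by blast

text \<open>The product of \<open>g\<close> and \<open>\<psi>\<close> inherits the compact support
  of \<open>\<psi>\<close>, so its directional derivative integrates to zero. Regularity of
  \<open>g\<close> on the whole space is natural here, as \<open>g\<close> will be affine or itself
  a test function.\<close>

lemma integration_by_parts:
  fixes \<Omega> :: "'a::euclidean_space set"
  assumes \<psi>: "\<psi> \<in> test_functions \<Omega>" and \<Omega>: "\<Omega> \<in> sets lebesgue"
    and g: "\<And>x. (g has_derivative (\<lambda>h. D x \<bullet> h)) (at x)" and D: "continuous_on UNIV D"
  shows "(LINT x|lebesgue_on \<Omega>. g x * (grad \<psi> x \<bullet> e)) = - (LINT x|lebesgue_on \<Omega>. (D x \<bullet> e) * \<psi> x)"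
    "integrable (lebesgue_on \<Omega>) (\<lambda>x. g x * (grad \<psi> x \<bullet> e))"
proof -
  obtain K where K: "compact K" "K \<subseteq> \<Omega>" "\<And>x. (\<psi> has_derivative (\<lambda>h. grad \<psi> x \<bullet> h)) (at x)"
    "continuous_on UNIV \<psi>" "continuous_on UNIV (grad \<psi>)" "\<And>x. x \<notin> K \<Longrightarrow> \<psi> x = 0 \<and> grad \<psi> x = 0"
    using test_function_props[OF \<psi>] by metis
  have cg: "continuous_on UNIV g" using g by (rule continuous_of_derivative)
  have c1: "continuous_on UNIV (\<lambda>x. g x * (grad \<psi> x \<bullet> e))" "continuous_on UNIV (\<lambda>x. (D x \<bullet> e) * \<psi> x)"
    using cg K D by (auto intro!: continuous_intros)
  have zero: "\<And>x. x \<notin> K \<Longrightarrow> g x * (grad \<psi> x \<bullet> e) = 0" "\<And>x. x \<notin> K \<Longrightarrow> (D x \<bullet> e) * \<psi> x = 0"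
    using K(6) by auto
  note s1 = continuous_compact_support[OF c1(1) K(1,2) zero(1) \<Omega>]
    and s2 = continuous_compact_support[OF c1(2) K(1,2) zero(2) \<Omega>]
  show "integrable (lebesgue_on \<Omega>) (\<lambda>x. g x * (grad \<psi> x \<bullet> e))" by (rule s1(1))
  have "(LINT x|lborel. (g x *\<^sub>R grad \<psi> x + \<psi> x *\<^sub>R D x) \<bullet> e) = 0"
  proof (rule integral_directional_derivative_zero[where \<psi>="\<lambda>x. g x * \<psi> x" and K=K])
    show "((\<lambda>x. g x * \<psi> x) has_derivative (\<lambda>h. (g x *\<^sub>R grad \<psi> x + \<psi> x *\<^sub>R D x) \<bullet> h)) (at x)" for x
      by (rule has_derivative_eq_rhs[OF has_derivative_mult[OF g K(3)]])
        (simp add: fun_eq_iff inner_add_left algebra_simps)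
  qed (use K cg D in \<open>auto intro!: continuous_intros\<close>)
  then have "(LINT x|lborel. g x * (grad \<psi> x \<bullet> e) + (D x \<bullet> e) * \<psi> x) = 0"
    by (simp add: inner_add_left mult.commute)
  then have "(LINT x|lborel. g x * (grad \<psi> x \<bullet> e)) + (LINT x|lborel. (D x \<bullet> e) * \<psi> x) = 0"
    using s1(3) s2(3) by simp
  then show "(LINT x|lebesgue_on \<Omega>. g x * (grad \<psi> x \<bullet> e)) = - (LINT x|lebesgue_on \<Omega>. (D x \<bullet> e) * \<psi> x)"
    using s1(2) s2(2) by simp
qed

section \<open>Square integrable functions\<close>

lemma L2_measurable: "f \<in> L2 \<Omega> \<Longrightarrow> f \<in> borel_measurable (lebesgue_on \<Omega>)"
  and L2_integrable_sq: "f \<in> L2 \<Omega> \<Longrightarrow> integrable (lebesgue_on \<Omega>) (\<lambda>x. (norm (f x))\<^sup>2)"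
  by (auto simp: L2_def)

lemma L2_inner_integrable:
  fixes f g :: "'a::euclidean_space \<Rightarrow> 'b::euclidean_space"
  assumes "f \<in> L2 \<Omega>" "g \<in> L2 \<Omega>"
  shows "integrable (lebesgue_on \<Omega>) (\<lambda>x. f x \<bullet> g x)"
proof (rule Bochner_Integration.integrable_bound[of _ "\<lambda>x. (norm (f x))\<^sup>2 + (norm (g x))\<^sup>2"])
  show "integrable (lebesgue_on \<Omega>) (\<lambda>x. (norm (f x))\<^sup>2 + (norm (g x))\<^sup>2)"
    using assms by (simp add: L2_integrable_sq)
  show "(\<lambda>x. f x \<bullet> g x) \<in> borel_measurable (lebesgue_on \<Omega>)"
    using assms L2_measurable by (intro borel_measurable_inner) auto
  have "\<bar>f x \<bullet> g x\<bar> \<le> (norm (f x))\<^sup>2 + (norm (g x))\<^sup>2" for x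
  proof -
    have "\<bar>f x \<bullet> g x\<bar> \<le> norm (f x) * norm (g x)" by (rule Cauchy_Schwarz_ineq2)
    moreover have "0 \<le> (norm (f x) - norm (g x))\<^sup>2" by simp
    ultimately show ?thesis
      using sum_squares_bound[of "norm (f x)" "norm (g x)"] by (simp add: mult.assoc)
  qed
  then show "AE x in lebesgue_on \<Omega>. norm (f x \<bullet> g x) \<le> norm ((norm (f x))\<^sup>2 + (norm (g x))\<^sup>2)"
    by (intro AE_I2) (simp add: abs_of_nonneg)
qed

lemma L2_mult_integrable:
  fixes f g :: "'a::euclidean_space \<Rightarrow> real"
  shows "f \<in> L2 \<Omega> \<Longrightarrow> g \<in> L2 \<Omega> \<Longrightarrow> integrable (lebesgue_on \<Omega>) (\<lambda>x. f x * g x)"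
  using L2_inner_integrable[of f \<Omega> g] by simp

text \<open>A pointwise bound gives membership and norm estimate together. The two ranges may
  differ, so that a scalar function can be compared with a vector field.\<close>

lemma L2_dominated:
  fixes f :: "'a::euclidean_space \<Rightarrow> 'b::euclidean_space" and g :: "'a \<Rightarrow> 'c::euclidean_space"
  assumes "g \<in> L2 \<Omega>" "f \<in> borel_measurable (lebesgue_on \<Omega>)" "\<And>x. x \<in> \<Omega> \<Longrightarrow> norm (f x) \<le> c * norm (g x)" "0 \<le> c"
  shows "f \<in> L2 \<Omega>" "L2norm \<Omega> f \<le> c * L2norm \<Omega> g"
proof -
  have sq: "(norm (f x))\<^sup>2 \<le> c\<^sup>2 * (norm (g x))\<^sup>2" if "x \<in> \<Omega>" for x
    using power_mono[OF assms(3)[OF that], of 2] by (simp add: power_mult_distrib)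
  have int: "integrable (lebesgue_on \<Omega>) (\<lambda>x. c\<^sup>2 * (norm (g x))\<^sup>2)"
    using L2_integrable_sq[OF assms(1)] by simp
  then have "integrable (lebesgue_on \<Omega>) (\<lambda>x. (norm (f x))\<^sup>2)"
    by (rule Bochner_Integration.integrable_bound) (use assms(2) sq in \<open>auto intro!: AE_I2\<close>)
  with assms(2) show "f \<in> L2 \<Omega>" by (simp add: L2_def)
  have "(LINT x|lebesgue_on \<Omega>. (norm (f x))\<^sup>2) \<le> (LINT x|lebesgue_on \<Omega>. c\<^sup>2 * (norm (g x))\<^sup>2)"
    by (rule integral_mono) (use \<open>integrable _ (\<lambda>x. (norm (f x))\<^sup>2)\<close> int sq in auto)
  then have "L2norm \<Omega> f \<le> sqrt (c\<^sup>2 * (LINT x|lebesgue_on \<Omega>. (norm (g x))\<^sup>2))"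
    unfolding L2norm_def by simp
  also have "\<dots> = c * L2norm \<Omega> g" using assms(4) by (simp add: L2norm_def real_sqrt_mult)
  finally show "L2norm \<Omega> f \<le> c * L2norm \<Omega> g" .
qed

lemma L2norm_nonneg [simp]: "0 \<le> L2norm \<Omega> f"
  by (simp add: L2norm_def)

lemma L2norm_sq: "(L2norm \<Omega> f)\<^sup>2 = (LINT x|lebesgue_on \<Omega>. (norm (f x))\<^sup>2)"
  by (simp add: L2norm_def)

lemma L2_scaleR:
  fixes f :: "'a::euclidean_space \<Rightarrow> 'b::euclidean_space"
  shows "f \<in> L2 \<Omega> \<Longrightarrow> (\<lambda>x. c *\<^sub>R f x) \<in> L2 \<Omega>"
  by (rule L2_dominated(1)[of f _ _ "\<bar>c\<bar>"]) (use L2_measurable in \<open>auto intro!: borel_measurable_scaleR\<close>)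

lemma L2_add:
  fixes f g :: "'a::euclidean_space \<Rightarrow> 'b::euclidean_space"
  assumes "f \<in> L2 \<Omega>" "g \<in> L2 \<Omega>" shows "(\<lambda>x. f x + g x) \<in> L2 \<Omega>"
proof -
  have "(norm (f x + g x))\<^sup>2 = (norm (f x))\<^sup>2 + 2 * (f x \<bullet> g x) + (norm (g x))\<^sup>2" for x
    by (simp add: power2_norm_eq_inner inner_add_left inner_add_right inner_commute)
  then show ?thesis
    using assms L2_inner_integrable[OF assms] by (auto simp: L2_def)
qed

lemma L2_diff:
  fixes f g :: "'a::euclidean_space \<Rightarrow> 'b::euclidean_space"
  assumes "f \<in> L2 \<Omega>" "g \<in> L2 \<Omega>" shows "(\<lambda>x. f x - g x) \<in> L2 \<Omega>"
  using L2_add[OF assms(1) L2_scaleR[OF assms(2), of "-1"]] by simp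

lemma L2_uminus:
  fixes f :: "'a::euclidean_space \<Rightarrow> 'b::euclidean_space"
  assumes "f \<in> L2 \<Omega>" shows "(\<lambda>x. - f x) \<in> L2 \<Omega>"
  using L2_scaleR[OF assms(1), of "-1"] by simp

lemma L2_component:
  fixes f :: "'a::euclidean_space \<Rightarrow> 'b::euclidean_space"
  assumes "f \<in> L2 \<Omega>" shows "(\<lambda>x. f x \<bullet> i) \<in> L2 \<Omega>"
proof (rule L2_dominated(1)[OF assms])
  show "norm (f x \<bullet> i) \<le> norm i * norm (f x)" for x
    using Cauchy_Schwarz_ineq2[of "f x" i] by (simp add: mult.commute)
qed (use L2_measurable[OF assms] in \<open>auto intro!: borel_measurable_inner\<close>)

lemma L2_bounded:
  fixes f :: "'a::euclidean_space \<Rightarrow> 'b::euclidean_space"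
  assumes "bounded \<Omega>" "\<Omega> \<in> sets lebesgue" "f \<in> borel_measurable (lebesgue_on \<Omega>)" "\<And>x. x \<in> \<Omega> \<Longrightarrow> norm (f x) \<le> M"
  shows "f \<in> L2 \<Omega>"
proof -
  have "emeasure lebesgue \<Omega> < \<infinity>"
    using bounded_set_imp_lmeasurable[OF assms(1,2)] by (metis fmeasurableD2 infinity_ennreal_def less_top)
  then interpret finite_measure "lebesgue_on \<Omega>"
    using assms(2) by (intro finite_measureI) (simp add: emeasure_restrict_space less_top)
  have "(\<lambda>x. 1::real) \<in> L2 \<Omega>" by (simp add: L2_def)
  then show ?thesis
    by (rule L2_dominated(1)[of _ _ _ "\<bar>M\<bar>"]) (use assms in \<open>auto intro: order_trans[OF _ abs_ge_self]\<close>)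
qed

lemma L2_const: "bounded \<Omega> \<Longrightarrow> \<Omega> \<in> sets lebesgue \<Longrightarrow> (\<lambda>x. c::'b::euclidean_space) \<in> L2 (\<Omega>::'a::euclidean_space set)"
  by (rule L2_bounded[where M="norm c"]) auto

lemma L2_integrable:
  fixes f :: "'a::euclidean_space \<Rightarrow> real"
  assumes "bounded \<Omega>" "\<Omega> \<in> sets lebesgue" "f \<in> L2 \<Omega>"
  shows "integrable (lebesgue_on \<Omega>) f"
  using L2_mult_integrable[OF assms(3) L2_const[OF assms(1,2), of 1]] by simp

lemma L2_continuous:
  fixes f :: "'a::euclidean_space \<Rightarrow> 'b::euclidean_space"
  assumes "continuous_on UNIV f" "bounded \<Omega>" "\<Omega> \<in> sets lebesgue"
  shows "f \<in> L2 \<Omega>"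
proof -
  have "compact (f ` closure \<Omega>)"
    using assms by (intro compact_continuous_image) (auto intro: continuous_on_subset)
  then obtain M where "\<And>x. x \<in> closure \<Omega> \<Longrightarrow> norm (f x) \<le> M"
    by (meson bounded_iff compact_imp_bounded imageI)
  then show ?thesis
    using assms closure_subset[of \<Omega>]
    by (intro L2_bounded[where M=M] continuous_imp_measurable_on_sets_lebesgue)
      (auto intro: continuous_on_subset)
qed

lemma L2_subset:
  fixes f :: "'a::euclidean_space \<Rightarrow> 'b::euclidean_space"
  assumes "f \<in> L2 T" "S \<subseteq> T" "S \<in> sets lebesgue" "T \<in> sets lebesgue"
  shows "f \<in> L2 S"
proof -
  have "f \<in> borel_measurable (lebesgue_on S)"
    using measurable_restrict_mono[of f lebesgue T borel S] L2_measurable[OF assms(1)] assms(2) by simp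
  then show ?thesis
    using integrable_lebesgue_on_subset[OF L2_integrable_sq[OF assms(1)] assms(2-4)] by (simp add: L2_def)
qed

text \<open>A nonnegative quadratic has nonpositive discriminant. The case \<open>b = 0\<close> is
  genuine: \<open>L2norm\<close> is only a seminorm on functions, so a function of norm zero need
  not vanish.\<close>

lemma discriminant_bound:
  fixes a b c :: real
  assumes quad: "\<And>t. 0 \<le> a - 2 * t * c + t\<^sup>2 * b" and "0 \<le> b"
  shows "c\<^sup>2 \<le> a * b"
proof (cases "b = 0")
  case True
  have "c = 0"
  proof (rule ccontr)
    assume "c \<noteq> 0"
    \<comment> \<open>For \<open>b = 0\<close> the quadratic is affine in \<open>t\<close>, and this
      choice of \<open>t\<close> gives it the value -1.\<close>
    then show False using quad[of "(a + 1) / (2 * c)"] True by (simp add: field_simps)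
  qed
  then show ?thesis using True by simp
next
  case False
  then have "0 < b" using assms(2) by simp
  then show ?thesis
    using mult_right_mono[OF quad[of "c / b"], of b] by (simp add: field_simps power2_eq_square)
qed

lemma L2_Cauchy_Schwarz:
  fixes f g :: "'a::euclidean_space \<Rightarrow> 'b::euclidean_space"
  assumes f: "f \<in> L2 \<Omega>" and g: "g \<in> L2 \<Omega>"
  shows "\<bar>LINT x|lebesgue_on \<Omega>. f x \<bullet> g x\<bar> \<le> L2norm \<Omega> f * L2norm \<Omega> g"
proof -
  let ?I = "LINT x|lebesgue_on \<Omega>. f x \<bullet> g x"
  let ?a = "(L2norm \<Omega> f)\<^sup>2" and ?b = "(L2norm \<Omega> g)\<^sup>2"
  have quad: "0 \<le> ?a - 2 * t * ?I + t\<^sup>2 * ?b" for t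
  proof -
    have "(norm (f x - t *\<^sub>R g x))\<^sup>2 = (norm (f x))\<^sup>2 - 2 * t * (f x \<bullet> g x) + t\<^sup>2 * (norm (g x))\<^sup>2" for x
      by (simp only: power2_norm_eq_inner)
        (simp add: inner_diff_left inner_diff_right inner_commute power2_eq_square)
    then have "(LINT x|lebesgue_on \<Omega>. (norm (f x - t *\<^sub>R g x))\<^sup>2) = ?a - 2 * t * ?I + t\<^sup>2 * ?b"
      using L2_integrable_sq[OF f] L2_integrable_sq[OF g] L2_inner_integrable[OF f g]
      by (simp add: L2norm_sq)
    moreover have "0 \<le> (LINT x|lebesgue_on \<Omega>. (norm (f x - t *\<^sub>R g x))\<^sup>2)" by simp
    ultimately show ?thesis by linarith
  qed
  have "?I\<^sup>2 \<le> ?a * ?b"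
    by (rule discriminant_bound[OF quad]) simp
  then have "?I\<^sup>2 \<le> (L2norm \<Omega> f * L2norm \<Omega> g)\<^sup>2" by (simp add: power_mult_distrib)
  then show ?thesis by (simp add: power2_le_iff_abs_le)
qed

lemma L2norm_triangle:
  fixes f g :: "'a::euclidean_space \<Rightarrow> 'b::euclidean_space"
  assumes f: "f \<in> L2 \<Omega>" and g: "g \<in> L2 \<Omega>"
  shows "L2norm \<Omega> (\<lambda>x. f x + g x) \<le> L2norm \<Omega> f + L2norm \<Omega> g"
proof -
  have "(norm (f x + g x))\<^sup>2 = (norm (f x))\<^sup>2 + 2 * (f x \<bullet> g x) + (norm (g x))\<^sup>2" for x
    by (simp add: power2_norm_eq_inner inner_add_left inner_add_right inner_commute)
  then have "(L2norm \<Omega> (\<lambda>x. f x + g x))\<^sup>2 = (L2norm \<Omega> f)\<^sup>2 + 2 * (LINT x|lebesgue_on \<Omega>. f x \<bullet> g x) + (L2norm \<Omega> g)\<^sup>2"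
    using L2_integrable_sq[OF f] L2_integrable_sq[OF g] L2_inner_integrable[OF f g]
    by (simp add: L2norm_sq)
  also have "\<dots> \<le> (L2norm \<Omega> f + L2norm \<Omega> g)\<^sup>2"
    using L2_Cauchy_Schwarz[OF f g] by (simp add: power2_sum)
  finally show ?thesis by (rule power2_le_imp_le) simp
qed

lemma L2norm_uminus: "L2norm \<Omega> (\<lambda>x. - f x) = L2norm \<Omega> f"
  by (simp add: L2norm_def)

lemma L2norm_minus_commute: "L2norm \<Omega> (\<lambda>x. f x - g x) = L2norm \<Omega> (\<lambda>x. g x - f x)"
  by (simp add: L2norm_def norm_minus_commute)

lemma L2norm_diff_triangle:
  fixes f g h :: "'a::euclidean_space \<Rightarrow> 'b::euclidean_space"
  assumes "f \<in> L2 \<Omega>" "g \<in> L2 \<Omega>" "h \<in> L2 \<Omega>"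
  shows "L2norm \<Omega> (\<lambda>x. f x - h x) \<le> L2norm \<Omega> (\<lambda>x. f x - g x) + L2norm \<Omega> (\<lambda>x. g x - h x)"
  using L2norm_triangle[OF L2_diff[OF assms(1,2)] L2_diff[OF assms(2,3)]] by simp

lemma L2norm_cong_AE:
  fixes f g :: "'a::euclidean_space \<Rightarrow> 'b::euclidean_space"
  assumes "f \<in> L2 \<Omega>" "g \<in> L2 \<Omega>" "AE x in lebesgue_on \<Omega>. f x = g x"
  shows "L2norm \<Omega> f = L2norm \<Omega> g"
proof -
  have "(LINT x|lebesgue_on \<Omega>. (norm (f x))\<^sup>2) = (LINT x|lebesgue_on \<Omega>. (norm (g x))\<^sup>2)"
    using L2_integrable_sq[OF assms(1)] L2_integrable_sq[OF assms(2)] assms(3)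
    by (intro integral_cong_AE) (auto elim!: eventually_mono)
  then show ?thesis by (simp add: L2norm_def)
qed

lemma L2_tendsto_inner:
  fixes f :: "'a::euclidean_space \<Rightarrow> 'b::euclidean_space"
  assumes "f \<in> L2 \<Omega>" "\<And>k. h k \<in> L2 \<Omega>" "u \<in> L2 \<Omega>"
    and lim: "(\<lambda>k. L2norm \<Omega> (\<lambda>x. u x - h k x)) \<longlonglongrightarrow> 0"
  shows "(\<lambda>k. LINT x|lebesgue_on \<Omega>. f x \<bullet> h k x) \<longlonglongrightarrow> (LINT x|lebesgue_on \<Omega>. f x \<bullet> u x)"
proof (rule Lim_null_comparison[THEN LIM_zero_cancel])
  show "(\<lambda>k. L2norm \<Omega> f * L2norm \<Omega> (\<lambda>x. u x - h k x)) \<longlonglongrightarrow> 0"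
    using tendsto_mult_right_zero[OF lim] by simp
  have "\<bar>(LINT x|lebesgue_on \<Omega>. f x \<bullet> h k x) - (LINT x|lebesgue_on \<Omega>. f x \<bullet> u x)\<bar>
      \<le> L2norm \<Omega> f * L2norm \<Omega> (\<lambda>x. u x - h k x)" for k
  proof -
    have "(LINT x|lebesgue_on \<Omega>. f x \<bullet> (u x - h k x)) =
        (LINT x|lebesgue_on \<Omega>. f x \<bullet> u x) - (LINT x|lebesgue_on \<Omega>. f x \<bullet> h k x)"
      using assms by (simp add: inner_diff_right L2_inner_integrable)
    then show ?thesis
      using L2_Cauchy_Schwarz[OF assms(1) L2_diff[OF assms(3) assms(2)[of k]]] by (simp add: abs_minus_commute)
  qed
  then show "\<forall>\<^sub>F k in sequentially. norm ((LINT x|lebesgue_on \<Omega>. f x \<bullet> h k x) - (LINT x|lebesgue_on \<Omega>. f x \<bullet> u x))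
      \<le> L2norm \<Omega> f * L2norm \<Omega> (\<lambda>x. u x - h k x)"
    by simp
qed

lemma L2norm_tendsto:
  fixes h :: "nat \<Rightarrow> 'a::euclidean_space \<Rightarrow> 'b::euclidean_space"
  assumes "\<And>k. h k \<in> L2 \<Omega>" "u \<in> L2 \<Omega>"
    and lim: "(\<lambda>k. L2norm \<Omega> (\<lambda>x. u x - h k x)) \<longlonglongrightarrow> 0"
  shows "(\<lambda>k. L2norm \<Omega> (h k)) \<longlonglongrightarrow> L2norm \<Omega> u"
proof (rule Lim_null_comparison[THEN LIM_zero_cancel])
  have "\<bar>L2norm \<Omega> (h k) - L2norm \<Omega> u\<bar> \<le> L2norm \<Omega> (\<lambda>x. u x - h k x)" for k
    using L2norm_triangle[OF L2_diff[OF assms(2) assms(1)[of k]] assms(1)[of k]]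
      L2norm_triangle[OF L2_diff[OF assms(1)[of k] assms(2)] assms(2)]
    by (simp add: L2norm_minus_commute[of \<Omega> u])
  then show "\<forall>\<^sub>F k in sequentially. norm (L2norm \<Omega> (h k) - L2norm \<Omega> u) \<le> L2norm \<Omega> (\<lambda>x. u x - h k x)"
    by simp
qed (rule lim)

section \<open>Weak gradients and weak divergences\<close>

lemma test_function_L2:
  assumes \<psi>: "\<psi> \<in> test_functions \<Omega>" and \<Omega>: "\<Omega> \<in> sets lebesgue"
  shows "\<psi> \<in> L2 \<Omega>" "grad \<psi> \<in> L2 \<Omega>"
proof -
  obtain K where K: "compact K" "K \<subseteq> \<Omega>" "continuous_on UNIV \<psi>" "continuous_on UNIV (grad \<psi>)"
    "\<And>x. x \<notin> K \<Longrightarrow> \<psi> x = 0 \<and> grad \<psi> x = 0"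
    using test_function_props[OF \<psi>] by metis
  have "integrable (lebesgue_on \<Omega>) (\<lambda>x. (norm (\<psi> x))\<^sup>2)" "integrable (lebesgue_on \<Omega>) (\<lambda>x. (norm (grad \<psi> x))\<^sup>2)"
    by (rule continuous_compact_support(1)[OF _ K(1,2) _ \<Omega>], use K in \<open>auto intro!: continuous_intros\<close>)+
  moreover have "\<psi> \<in> borel_measurable (lebesgue_on \<Omega>)" "grad \<psi> \<in> borel_measurable (lebesgue_on \<Omega>)"
    using K(3,4) \<Omega> by (auto intro!: continuous_imp_measurable_on_sets_lebesgue intro: continuous_on_subset)
  ultimately show "\<psi> \<in> L2 \<Omega>" "grad \<psi> \<in> L2 \<Omega>" by (auto simp: L2_def)
qed

lemma test_functions_mono: "S \<subseteq> T \<Longrightarrow> test_functions S \<subseteq> test_functions T"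
  by (auto simp: test_functions_def)

lemma test_function_eq_0:
  assumes "\<psi> \<in> test_functions \<Omega>" "x \<notin> \<Omega>" shows "\<psi> x = 0" "grad \<psi> x = 0"
  using test_function_props[OF assms(1)] assms(2) by (metis subsetD)+

lemma has_weak_grad_classical:
  assumes "\<Omega> \<in> sets lebesgue" "\<And>x. (g has_derivative (\<lambda>h. D x \<bullet> h)) (at x)" "continuous_on UNIV D"
  shows "has_weak_grad \<Omega> g D"
  unfolding has_weak_grad_def using integration_by_parts(1)[OF _ assms] by blast

lemma has_weak_div_classical:
  fixes q :: "'a::euclidean_space \<Rightarrow> 'a"
  assumes \<Omega>: "\<Omega> \<in> sets lebesgue"
    and q: "\<And>i x. i \<in> Basis \<Longrightarrow> ((\<lambda>x. q x \<bullet> i) has_derivative (\<lambda>h. D i x \<bullet> h)) (at x)"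
    and D: "\<And>i. i \<in> Basis \<Longrightarrow> continuous_on UNIV (D i)"
  shows "has_weak_div \<Omega> q (\<lambda>x. \<Sum>i\<in>Basis. D i x \<bullet> i)"
  unfolding has_weak_div_def
proof
  fix \<psi> assume \<psi>: "\<psi> \<in> test_functions \<Omega>"
  obtain K where K: "compact K" "K \<subseteq> \<Omega>" "continuous_on UNIV \<psi>" "\<And>x. x \<notin> K \<Longrightarrow> \<psi> x = 0 \<and> grad \<psi> x = 0"
    using test_function_props[OF \<psi>] by metis
  have int: "integrable (lebesgue_on \<Omega>) (\<lambda>x. (D i x \<bullet> i) * \<psi> x)" if "i \<in> Basis" for i
    by (rule continuous_compact_support(1)[OF _ K(1,2) _ \<Omega>]) (use K D that in \<open>auto intro!: continuous_intros\<close>)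
  have "(LINT x|lebesgue_on \<Omega>. q x \<bullet> grad \<psi> x) = (LINT x|lebesgue_on \<Omega>. (\<Sum>i\<in>Basis. (q x \<bullet> i) * (grad \<psi> x \<bullet> i)))"
    by (subst euclidean_inner) simp
  also have "\<dots> = (\<Sum>i\<in>Basis. (LINT x|lebesgue_on \<Omega>. (q x \<bullet> i) * (grad \<psi> x \<bullet> i)))"
    by (rule Bochner_Integration.integral_sum) (rule integration_by_parts(2)[OF \<psi> \<Omega> q D])
  also have "\<dots> = (\<Sum>i\<in>Basis. - (LINT x|lebesgue_on \<Omega>. (D i x \<bullet> i) * \<psi> x))"
    by (rule sum.cong[OF refl]) (rule integration_by_parts(1)[OF \<psi> \<Omega> q D])
  also have "\<dots> = - (LINT x|lebesgue_on \<Omega>. (\<Sum>i\<in>Basis. D i x \<bullet> i) * \<psi> x)"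
    using int by (simp add: sum_negf sum_distrib_right)
  finally show "(LINT x|lebesgue_on \<Omega>. q x \<bullet> grad \<psi> x) = - (LINT x|lebesgue_on \<Omega>. (\<Sum>i\<in>Basis. D i x \<bullet> i) * \<psi> x)" .
qed

text \<open>Test functions are defined on the whole space and vanish off their domain, so those for
  \<open>S\<close> are test functions for \<Omega> and neither integral changes. This is how global
  weak derivatives are evaluated on single simplices.\<close>

lemma has_weak_grad_subset:
  assumes "has_weak_grad \<Omega> u g" "S \<subseteq> \<Omega>" "S \<in> sets lebesgue" "\<Omega> \<in> sets lebesgue"
  shows "has_weak_grad S u g"
  unfolding has_weak_grad_def
proof (intro ballI)
  fix \<psi> :: "'a \<Rightarrow> real" and i :: 'a assume \<psi>: "\<psi> \<in> test_functions S" and i: "i \<in> Basis"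
  have "(LINT x|lebesgue_on \<Omega>. u x * (grad \<psi> x \<bullet> i)) = (LINT x|lebesgue_on S. u x * (grad \<psi> x \<bullet> i))"
    "(LINT x|lebesgue_on \<Omega>. (g x \<bullet> i) * \<psi> x) = (LINT x|lebesgue_on S. (g x \<bullet> i) * \<psi> x)"
    using test_function_eq_0[OF \<psi>] assms(2-4) by (auto intro!: integral_lebesgue_on_subset)
  then show "(LINT x|lebesgue_on S. u x * (grad \<psi> x \<bullet> i)) = - (LINT x|lebesgue_on S. (g x \<bullet> i) * \<psi> x)"
    using assms(1) \<psi> i test_functions_mono[OF assms(2)] by (auto simp: has_weak_grad_def)
qed

lemma has_weak_div_subset:
  assumes "has_weak_div \<Omega> q d" "S \<subseteq> \<Omega>" "S \<in> sets lebesgue" "\<Omega> \<in> sets lebesgue"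
  shows "has_weak_div S q d"
  unfolding has_weak_div_def
proof (intro ballI)
  fix \<psi> :: "'a \<Rightarrow> real" assume \<psi>: "\<psi> \<in> test_functions S"
  have "(LINT x|lebesgue_on \<Omega>. q x \<bullet> grad \<psi> x) = (LINT x|lebesgue_on S. q x \<bullet> grad \<psi> x)"
    "(LINT x|lebesgue_on \<Omega>. d x * \<psi> x) = (LINT x|lebesgue_on S. d x * \<psi> x)"
    using test_function_eq_0[OF \<psi>] assms(2-4) by (auto intro!: integral_lebesgue_on_subset)
  then show "(LINT x|lebesgue_on S. q x \<bullet> grad \<psi> x) = - (LINT x|lebesgue_on S. d x * \<psi> x)"
    using assms(1) \<psi> test_functions_mono[OF assms(2)] by (auto simp: has_weak_div_def)
qed

lemma has_weak_grad_cong_AE: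
  fixes u v :: "'a::euclidean_space \<Rightarrow> real"
  assumes "has_weak_grad \<Omega> u g" "u \<in> L2 \<Omega>" "v \<in> borel_measurable (lebesgue_on \<Omega>)" "AE x in lebesgue_on \<Omega>. u x = v x"
    "\<Omega> \<in> sets lebesgue"
  shows "has_weak_grad \<Omega> v g"
proof -
  have "(LINT x|lebesgue_on \<Omega>. u x * (grad \<psi> x \<bullet> i)) = (LINT x|lebesgue_on \<Omega>. v x * (grad \<psi> x \<bullet> i))"
    if "\<psi> \<in> test_functions \<Omega>" for \<psi> i
  proof (rule integral_cong_AE)
    have "(\<lambda>x. grad \<psi> x \<bullet> i) \<in> borel_measurable (lebesgue_on \<Omega>)"
      using L2_measurable[OF L2_component[OF test_function_L2(2)[OF that assms(5)]]] .
    then show "(\<lambda>x. u x * (grad \<psi> x \<bullet> i)) \<in> borel_measurable (lebesgue_on \<Omega>)"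
      "(\<lambda>x. v x * (grad \<psi> x \<bullet> i)) \<in> borel_measurable (lebesgue_on \<Omega>)"
      using assms(3) L2_measurable[OF assms(2)] by (auto intro: borel_measurable_times)
  qed (use assms(4) in \<open>auto elim!: eventually_mono\<close>)
  with assms(1) show ?thesis by (simp add: has_weak_grad_def)
qed

lemma has_weak_div_cong_AE:
  fixes q p :: "'a::euclidean_space \<Rightarrow> 'a"
  assumes "has_weak_div \<Omega> q d" "q \<in> L2 \<Omega>" "p \<in> borel_measurable (lebesgue_on \<Omega>)" "AE x in lebesgue_on \<Omega>. q x = p x"
    "\<Omega> \<in> sets lebesgue"
  shows "has_weak_div \<Omega> p d"
proof -
  have "(LINT x|lebesgue_on \<Omega>. q x \<bullet> grad \<psi> x) = (LINT x|lebesgue_on \<Omega>. p x \<bullet> grad \<psi> x)"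
    if "\<psi> \<in> test_functions \<Omega>" for \<psi>
  proof (rule integral_cong_AE)
    have "grad \<psi> \<in> borel_measurable (lebesgue_on \<Omega>)"
      using L2_measurable[OF test_function_L2(2)[OF that assms(5)]] .
    then show "(\<lambda>x. q x \<bullet> grad \<psi> x) \<in> borel_measurable (lebesgue_on \<Omega>)"
      "(\<lambda>x. p x \<bullet> grad \<psi> x) \<in> borel_measurable (lebesgue_on \<Omega>)"
      using assms(3) L2_measurable[OF assms(2)] by (auto intro: borel_measurable_inner)
  qed (use assms(4) in \<open>auto elim!: eventually_mono\<close>)
  with assms(1) show ?thesis by (simp add: has_weak_div_def)
qed

lemma has_weak_grad_diff:
  assumes "has_weak_grad \<Omega> u g" "has_weak_grad \<Omega> v h" "u \<in> L2 \<Omega>" "v \<in> L2 \<Omega>" "g \<in> L2 \<Omega>" "h \<in> L2 \<Omega>"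
    and \<Omega>: "\<Omega> \<in> sets lebesgue"
  shows "has_weak_grad \<Omega> (\<lambda>x. u x - v x) (\<lambda>x. g x - h x)"
  unfolding has_weak_grad_def
proof (intro ballI)
  fix \<psi> :: "'a \<Rightarrow> real" and i :: 'a assume \<psi>: "\<psi> \<in> test_functions \<Omega>" and i: "i \<in> Basis"
  have "integrable (lebesgue_on \<Omega>) (\<lambda>x. w x * (grad \<psi> x \<bullet> i))" if "w \<in> L2 \<Omega>" for w
    by (intro L2_mult_integrable that L2_component test_function_L2[OF \<psi> \<Omega>])
  moreover have "integrable (lebesgue_on \<Omega>) (\<lambda>x. (w x \<bullet> i) * \<psi> x)" if "w \<in> L2 \<Omega>" for w
    by (intro L2_mult_integrable that L2_component test_function_L2[OF \<psi> \<Omega>])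
  ultimately show "(LINT x|lebesgue_on \<Omega>. (u x - v x) * (grad \<psi> x \<bullet> i)) = - (LINT x|lebesgue_on \<Omega>. ((g x - h x) \<bullet> i) * \<psi> x)"
    using assms \<psi> i by (simp add: left_diff_distrib inner_diff_left has_weak_grad_def)
qed

lemma has_weak_div_diff:
  assumes "has_weak_div \<Omega> p d" "has_weak_div \<Omega> q e" "p \<in> L2 \<Omega>" "q \<in> L2 \<Omega>" "d \<in> L2 \<Omega>" "e \<in> L2 \<Omega>"
    and \<Omega>: "\<Omega> \<in> sets lebesgue"
  shows "has_weak_div \<Omega> (\<lambda>x. p x - q x) (\<lambda>x. d x - e x)"
  unfolding has_weak_div_def
proof (intro ballI)
  fix \<psi> :: "'a \<Rightarrow> real" assume \<psi>: "\<psi> \<in> test_functions \<Omega>"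
  have "integrable (lebesgue_on \<Omega>) (\<lambda>x. w x \<bullet> grad \<psi> x)" if "w \<in> L2 \<Omega>" for w
    by (intro L2_inner_integrable that test_function_L2[OF \<psi> \<Omega>])
  moreover have "integrable (lebesgue_on \<Omega>) (\<lambda>x. w x * \<psi> x)" if "w \<in> L2 \<Omega>" for w
    by (intro L2_mult_integrable that test_function_L2[OF \<psi> \<Omega>])
  ultimately show "(LINT x|lebesgue_on \<Omega>. (p x - q x) \<bullet> grad \<psi> x) = - (LINT x|lebesgue_on \<Omega>. (d x - e x) * \<psi> x)"
    using assms \<psi> by (simp add: left_diff_distrib inner_diff_left has_weak_div_def)
qed

lemma AE_zero_by_components:
  fixes f :: "'b \<Rightarrow> 'a::euclidean_space"
  assumes "\<And>i. i \<in> Basis \<Longrightarrow> AE x in M. f x \<bullet> i = 0"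
  shows "AE x in M. f x = 0"
proof -
  have "AE x in M. \<forall>i\<in>Basis. f x \<bullet> i = 0"
    using assms by (intro AE_finite_allI) auto
  then show ?thesis
  proof eventually_elim
    case (elim x)
    then show ?case by (intro euclidean_eqI[of "f x" 0]) simp
  qed
qed

section \<open>Uniqueness and evaluation of weak derivatives on a bounded open set\<close>

context
  fixes \<Omega> :: "'a::euclidean_space set"
  assumes op: "open \<Omega>" and bdd: "bounded \<Omega>"
begin

lemma open_lebesgue: "\<Omega> \<in> sets lebesgue"
  using op by auto

text \<open>The fundamental lemma applied to each component of the difference. It is what makes
  \<open>weak_grad\<close> computable: the function chosen by SOME agrees almost everywhere with any
  candidate in L2 that one can exhibit.\<close>

lemma weak_grad_unique:
  assumes "has_weak_grad \<Omega> u g" "has_weak_grad \<Omega> u h" "g \<in> L2 \<Omega>" "h \<in> L2 \<Omega>"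
  shows "AE x in lebesgue_on \<Omega>. g x = h x"
proof -
  have "AE x in lebesgue_on \<Omega>. (g x - h x) \<bullet> i = 0" if i: "i \<in> Basis" for i
  proof (rule fundamental_lemma[OF op])
    have gh: "(\<lambda>x. (g x - h x) \<bullet> i) \<in> L2 \<Omega>"
      by (intro L2_component L2_diff assms)
    then show "integrable (lebesgue_on \<Omega>) (\<lambda>x. (g x - h x) \<bullet> i)"
      by (rule L2_integrable[OF bdd open_lebesgue])
    fix \<psi> assume \<psi>: "\<psi> \<in> test_functions \<Omega>"
    have "(LINT x|lebesgue_on \<Omega>. (g x \<bullet> i) * \<psi> x) = (LINT x|lebesgue_on \<Omega>. (h x \<bullet> i) * \<psi> x)"
      using assms(1,2)[unfolded has_weak_grad_def, rule_format, OF \<psi> i] by simp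
    moreover have "integrable (lebesgue_on \<Omega>) (\<lambda>x. (w x \<bullet> i) * \<psi> x)" if "w \<in> L2 \<Omega>" for w
      by (intro L2_mult_integrable that L2_component test_function_L2[OF \<psi> open_lebesgue])
    ultimately show "(LINT x|lebesgue_on \<Omega>. ((g x - h x) \<bullet> i) * \<psi> x) = 0"
      using assms(3,4) by (simp add: left_diff_distrib inner_diff_left)
  qed
  then have "AE x in lebesgue_on \<Omega>. g x - h x = 0" by (rule AE_zero_by_components)
  then show ?thesis by simp
qed

lemma weak_div_unique:
  assumes "has_weak_div \<Omega> u g" "has_weak_div \<Omega> u h" "g \<in> L2 \<Omega>" "h \<in> L2 \<Omega>"
  shows "AE x in lebesgue_on \<Omega>. g x = h x"
proof -
  have "AE x in lebesgue_on \<Omega>. g x - h x = 0"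
  proof (rule fundamental_lemma[OF op])
    show "integrable (lebesgue_on \<Omega>) (\<lambda>x. g x - h x)"
      by (rule L2_integrable[OF bdd open_lebesgue]) (intro L2_diff assms)
    fix \<psi> assume \<psi>: "\<psi> \<in> test_functions \<Omega>"
    have "(LINT x|lebesgue_on \<Omega>. g x * \<psi> x) = (LINT x|lebesgue_on \<Omega>. h x * \<psi> x)"
      using assms(1,2)[unfolded has_weak_div_def, rule_format, OF \<psi>] by simp
    moreover have "integrable (lebesgue_on \<Omega>) (\<lambda>x. w x * \<psi> x)" if "w \<in> L2 \<Omega>" for w
      by (intro L2_mult_integrable that test_function_L2[OF \<psi> open_lebesgue])
    ultimately show "(LINT x|lebesgue_on \<Omega>. (g x - h x) * \<psi> x) = 0"
      using assms(3,4) by (simp add: left_diff_distrib)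
  qed
  then show ?thesis by simp
qed

lemma H1_weak_grad:
  assumes "u \<in> H1 \<Omega>"
  shows "weak_grad \<Omega> u \<in> L2 \<Omega>" "has_weak_grad \<Omega> u (weak_grad \<Omega> u)"
proof -
  have "\<exists>g. g \<in> L2 \<Omega> \<and> has_weak_grad \<Omega> u g" using assms by (auto simp: H1_def)
  from someI_ex[OF this] show "weak_grad \<Omega> u \<in> L2 \<Omega>" "has_weak_grad \<Omega> u (weak_grad \<Omega> u)"
    by (simp_all add: weak_grad_def)
qed

lemma weak_grad_eqI:
  assumes "g \<in> L2 \<Omega>" "has_weak_grad \<Omega> u g"
  shows "AE x in lebesgue_on \<Omega>. weak_grad \<Omega> u x = g x" "weak_grad \<Omega> u \<in> L2 \<Omega>"
proof -
  have "\<exists>g. g \<in> L2 \<Omega> \<and> has_weak_grad \<Omega> u g" using assms by auto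
  from someI_ex[OF this] have "weak_grad \<Omega> u \<in> L2 \<Omega>" "has_weak_grad \<Omega> u (weak_grad \<Omega> u)"
    by (simp_all add: weak_grad_def)
  then show "AE x in lebesgue_on \<Omega>. weak_grad \<Omega> u x = g x" "weak_grad \<Omega> u \<in> L2 \<Omega>"
    using weak_grad_unique assms by auto
qed

lemma weak_div_eqI:
  assumes "d \<in> L2 \<Omega>" "has_weak_div \<Omega> q d"
  shows "AE x in lebesgue_on \<Omega>. weak_div \<Omega> q x = d x" "weak_div \<Omega> q \<in> L2 \<Omega>"
    "has_weak_div \<Omega> q (weak_div \<Omega> q)"
proof -
  have "\<exists>d. d \<in> L2 \<Omega> \<and> has_weak_div \<Omega> q d" using assms by auto
  from someI_ex[OF this] have "weak_div \<Omega> q \<in> L2 \<Omega>" "has_weak_div \<Omega> q (weak_div \<Omega> q)"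
    by (simp_all add: weak_div_def)
  then show "AE x in lebesgue_on \<Omega>. weak_div \<Omega> q x = d x" "weak_div \<Omega> q \<in> L2 \<Omega>" "has_weak_div \<Omega> q (weak_div \<Omega> q)"
    using weak_div_unique assms by auto
qed

lemma test_function_weak_grad:
  assumes \<psi>: "\<psi> \<in> test_functions \<Omega>"
  shows "has_weak_grad \<Omega> \<psi> (grad \<psi>)" "\<psi> \<in> H1 \<Omega>" "AE x in lebesgue_on \<Omega>. weak_grad \<Omega> \<psi> x = grad \<psi> x"
    "\<psi> \<in> H10 \<Omega>"
proof -
  note L2 = test_function_L2[OF \<psi> open_lebesgue]
  show weak: "has_weak_grad \<Omega> \<psi> (grad \<psi>)"
    using test_function_props[OF \<psi>] has_weak_grad_classical[OF open_lebesgue] by metis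
  with L2 show H1: "\<psi> \<in> H1 \<Omega>" by (auto simp: H1_def)
  show AE: "AE x in lebesgue_on \<Omega>. weak_grad \<Omega> \<psi> x = grad \<psi> x"
    using weak_grad_eqI(1)[OF L2(2) weak] .
  have "L2norm \<Omega> (\<lambda>x. weak_grad \<Omega> \<psi> x - grad \<psi> x) = L2norm \<Omega> (\<lambda>x. 0::'a)"
  proof (rule L2norm_cong_AE)
    show "(\<lambda>x. weak_grad \<Omega> \<psi> x - grad \<psi> x) \<in> L2 \<Omega>"
      by (intro L2_diff H1_weak_grad H1 L2)
    show "(\<lambda>x. 0::'a) \<in> L2 \<Omega>" by (simp add: L2_def)
  qed (use AE in \<open>auto elim!: eventually_mono\<close>)
  then have "L2norm \<Omega> (\<lambda>x. weak_grad \<Omega> \<psi> x - grad \<psi> x) = 0" by (simp add: L2norm_def)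
  then show "\<psi> \<in> H10 \<Omega>"
    unfolding H10_def using H1 \<psi> by (auto intro!: exI[of _ "\<lambda>_. \<psi>"] simp: L2norm_def)
qed

section \<open>Approximation by test functions and Friedrichs' inequality\<close>

lemma H10_approx:
  assumes "u \<in> H10 \<Omega>"
  obtains \<psi> where "\<And>k. \<psi> k \<in> test_functions \<Omega>"
     "(\<lambda>k. L2norm \<Omega> (\<lambda>x. u x - \<psi> k x)) \<longlonglongrightarrow> 0"
     "(\<lambda>k. L2norm \<Omega> (\<lambda>x. weak_grad \<Omega> u x - grad (\<psi> k) x)) \<longlonglongrightarrow> 0"
  using assms by (auto simp: H10_def)

lemma H10_L2:
  assumes "u \<in> H10 \<Omega>" shows "u \<in> L2 \<Omega>" "weak_grad \<Omega> u \<in> L2 \<Omega>" "has_weak_grad \<Omega> u (weak_grad \<Omega> u)"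
  using assms H1_weak_grad by (auto simp: H10_def H1_def)

lemma test_function_diff:
  assumes \<psi>: "\<psi> \<in> test_functions \<Omega>" and \<theta>: "\<theta> \<in> test_functions \<Omega>"
  shows "(\<lambda>x. \<psi> x - \<theta> x) \<in> test_functions \<Omega>" "grad (\<lambda>x. \<psi> x - \<theta> x) x = grad \<psi> x - grad \<theta> x"
proof -
  let ?s = "\<lambda>f::'a \<Rightarrow> real. closure {x. f x \<noteq> 0}"
  have sub: "?s (\<lambda>x. \<psi> x - \<theta> x) \<subseteq> ?s \<psi> \<union> ?s \<theta>"
    unfolding closure_Un[symmetric] by (rule closure_mono) auto
  moreover have comp: "compact (?s \<psi> \<union> ?s \<theta>)" and "?s \<psi> \<union> ?s \<theta> \<subseteq> \<Omega>"
    using \<psi> \<theta> by (auto simp: test_functions_def)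
  moreover have "compact (?s (\<lambda>x. \<psi> x - \<theta> x))"
    using sub comp by (meson bounded_subset closed_closure compact_eq_bounded_closed)
  moreover have "Ck_on k UNIV (\<lambda>x. \<psi> x + (-1) * \<theta> x)" for k
    using \<psi> \<theta> by (intro Ck_on_add Ck_on_mult Ck_on_const) (auto simp: test_functions_def)
  ultimately show "(\<lambda>x. \<psi> x - \<theta> x) \<in> test_functions \<Omega>"
    by (auto simp: test_functions_def)
  have "frechet_derivative (\<lambda>x. \<psi> x - \<theta> x) (at x) = (\<lambda>h. grad \<psi> x \<bullet> h - grad \<theta> x \<bullet> h)"
  proof -
    have "(\<psi> has_derivative (\<lambda>h. grad \<psi> x \<bullet> h)) (at x)" "(\<theta> has_derivative (\<lambda>h. grad \<theta> x \<bullet> h)) (at x)"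
      using test_function_props[OF \<psi>] test_function_props[OF \<theta>] by metis+
    from frechet_derivative_at[OF has_derivative_diff[OF this]] show ?thesis by simp
  qed
  then show "grad (\<lambda>x. \<psi> x - \<theta> x) x = grad \<psi> x - grad \<theta> x"
    by (subst grad_def) (simp add: scaleR_left_diff_distrib sum_subtractf euclidean_representation)
qed

text \<open>Differences of the approximating sequences approximate the difference. The chosen
  gradient of \<open>u - v\<close> is only almost everywhere the difference of the chosen gradients,
  so the norms are identified before the triangle inequality is applied.\<close>

lemma H10_diff:
  assumes u: "u \<in> H10 \<Omega>" and v: "v \<in> H10 \<Omega>"
  shows "(\<lambda>x. u x - v x) \<in> H10 \<Omega>"
    "AE x in lebesgue_on \<Omega>. weak_grad \<Omega> (\<lambda>x. u x - v x) x = weak_grad \<Omega> u x - weak_grad \<Omega> v x"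
proof -
  obtain \<psi> where \<psi>: "\<And>k. \<psi> k \<in> test_functions \<Omega>"
     "(\<lambda>k. L2norm \<Omega> (\<lambda>x. u x - \<psi> k x)) \<longlonglongrightarrow> 0"
     "(\<lambda>k. L2norm \<Omega> (\<lambda>x. weak_grad \<Omega> u x - grad (\<psi> k) x)) \<longlonglongrightarrow> 0" using H10_approx[OF u] by metis
  obtain \<theta> where \<theta>: "\<And>k. \<theta> k \<in> test_functions \<Omega>"
     "(\<lambda>k. L2norm \<Omega> (\<lambda>x. v x - \<theta> k x)) \<longlonglongrightarrow> 0"
     "(\<lambda>k. L2norm \<Omega> (\<lambda>x. weak_grad \<Omega> v x - grad (\<theta> k) x)) \<longlonglongrightarrow> 0" using H10_approx[OF v] by metis
  note L2 = H10_L2[OF u] H10_L2[OF v]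
  note tL2 = test_function_L2[OF \<psi>(1) open_lebesgue] test_function_L2[OF \<theta>(1) open_lebesgue]
  let ?g = "\<lambda>x. weak_grad \<Omega> u x - weak_grad \<Omega> v x"
  have weak: "has_weak_grad \<Omega> (\<lambda>x. u x - v x) ?g" and g: "?g \<in> L2 \<Omega>" and uv: "(\<lambda>x. u x - v x) \<in> L2 \<Omega>"
    by (intro has_weak_grad_diff L2_diff L2 open_lebesgue)+
  show AE: "AE x in lebesgue_on \<Omega>. weak_grad \<Omega> (\<lambda>x. u x - v x) x = ?g x"
    by (rule weak_grad_eqI(1)[OF g weak])
  have wL2: "weak_grad \<Omega> (\<lambda>x. u x - v x) \<in> L2 \<Omega>"
    by (rule weak_grad_eqI(2)[OF g weak])
  have "(\<lambda>k. L2norm \<Omega> (\<lambda>x. (u x - v x) - (\<psi> k x - \<theta> k x))) \<longlonglongrightarrow> 0"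
  proof (rule tendsto_sandwich[OF _ _ tendsto_const])
    show "(\<lambda>k. L2norm \<Omega> (\<lambda>x. u x - \<psi> k x) + L2norm \<Omega> (\<lambda>x. v x - \<theta> k x)) \<longlonglongrightarrow> 0"
      using tendsto_add[OF \<psi>(2) \<theta>(2)] by simp
    have "L2norm \<Omega> (\<lambda>x. (u x - v x) - (\<psi> k x - \<theta> k x)) \<le> L2norm \<Omega> (\<lambda>x. u x - \<psi> k x) + L2norm \<Omega> (\<lambda>x. v x - \<theta> k x)" for k
      using L2norm_triangle[OF L2_diff[OF L2(1) tL2(1)[of k]] L2_uminus[OF L2_diff[OF L2(4) tL2(3)[of k]]]]
        L2norm_uminus[of \<Omega> "\<lambda>x. v x - \<theta> k x"]
      by (simp add: algebra_simps)
    then show "\<forall>\<^sub>F k in sequentially. L2norm \<Omega> (\<lambda>x. (u x - v x) - (\<psi> k x - \<theta> k x)) \<le> L2norm \<Omega> (\<lambda>x. u x - \<psi> k x) + L2norm \<Omega> (\<lambda>x. v x - \<theta> k x)"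
      by simp
  qed simp
  moreover have "(\<lambda>k. L2norm \<Omega> (\<lambda>x. weak_grad \<Omega> (\<lambda>x. u x - v x) x - grad (\<lambda>x. \<psi> k x - \<theta> k x) x)) \<longlonglongrightarrow> 0"
  proof (rule tendsto_sandwich[OF _ _ tendsto_const])
    show "(\<lambda>k. L2norm \<Omega> (\<lambda>x. weak_grad \<Omega> u x - grad (\<psi> k) x) + L2norm \<Omega> (\<lambda>x. weak_grad \<Omega> v x - grad (\<theta> k) x)) \<longlonglongrightarrow> 0"
      using tendsto_add[OF \<psi>(3) \<theta>(3)] by simp
    have "L2norm \<Omega> (\<lambda>x. weak_grad \<Omega> (\<lambda>x. u x - v x) x - grad (\<lambda>x. \<psi> k x - \<theta> k x) x)
        \<le> L2norm \<Omega> (\<lambda>x. weak_grad \<Omega> u x - grad (\<psi> k) x) + L2norm \<Omega> (\<lambda>x. weak_grad \<Omega> v x - grad (\<theta> k) x)" for k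
    proof -
      have "L2norm \<Omega> (\<lambda>x. weak_grad \<Omega> (\<lambda>x. u x - v x) x - grad (\<lambda>x. \<psi> k x - \<theta> k x) x) =
          L2norm \<Omega> (\<lambda>x. (weak_grad \<Omega> u x - grad (\<psi> k) x) + - (weak_grad \<Omega> v x - grad (\<theta> k) x))"
      proof (rule L2norm_cong_AE)
        show "(\<lambda>x. weak_grad \<Omega> (\<lambda>x. u x - v x) x - grad (\<lambda>x. \<psi> k x - \<theta> k x) x) \<in> L2 \<Omega>"
          by (intro L2_diff wL2 test_function_L2 test_function_diff \<psi> \<theta> open_lebesgue)
        show "(\<lambda>x. (weak_grad \<Omega> u x - grad (\<psi> k) x) + - (weak_grad \<Omega> v x - grad (\<theta> k) x)) \<in> L2 \<Omega>"
          by (intro L2_add L2_uminus L2_diff L2 tL2)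
        show "AE x in lebesgue_on \<Omega>. weak_grad \<Omega> (\<lambda>x. u x - v x) x - grad (\<lambda>x. \<psi> k x - \<theta> k x) x =
            (weak_grad \<Omega> u x - grad (\<psi> k) x) + - (weak_grad \<Omega> v x - grad (\<theta> k) x)"
          using AE by eventually_elim (simp add: test_function_diff(2)[OF \<psi>(1) \<theta>(1)])
      qed
      also have "\<dots> \<le> L2norm \<Omega> (\<lambda>x. weak_grad \<Omega> u x - grad (\<psi> k) x) + L2norm \<Omega> (\<lambda>x. - (weak_grad \<Omega> v x - grad (\<theta> k) x))"
        by (intro L2norm_triangle L2_uminus L2_diff L2 tL2)
      finally show ?thesis by (simp only: L2norm_uminus)
    qed
    then show "\<forall>\<^sub>F k in sequentially. L2norm \<Omega> (\<lambda>x. weak_grad \<Omega> (\<lambda>x. u x - v x) x - grad (\<lambda>x. \<psi> k x - \<theta> k x) x)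
        \<le> L2norm \<Omega> (\<lambda>x. weak_grad \<Omega> u x - grad (\<psi> k) x) + L2norm \<Omega> (\<lambda>x. weak_grad \<Omega> v x - grad (\<theta> k) x)"
      by simp
  qed simp
  moreover have "(\<lambda>x. u x - v x) \<in> H1 \<Omega>" using uv g weak by (auto simp: H1_def)
  ultimately show "(\<lambda>x. u x - v x) \<in> H10 \<Omega>"
    unfolding H10_def using test_function_diff(1)[OF \<psi>(1) \<theta>(1)]
    by (auto intro!: exI[of _ "\<lambda>k x. \<psi> k x - \<theta> k x"])
qed

text \<open>The identity holds for test functions by definition, and both sides are continuous along
  the approximating sequence by Cauchy-Schwarz. It allows integration by parts against the error
  without a boundary term.\<close>

lemma H10_weak_div:
  assumes w: "w \<in> H10 \<Omega>" and q: "q \<in> L2 \<Omega>" "d \<in> L2 \<Omega>" "has_weak_div \<Omega> q d"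
  shows "(LINT x|lebesgue_on \<Omega>. q x \<bullet> weak_grad \<Omega> w x) = - (LINT x|lebesgue_on \<Omega>. d x * w x)"
proof -
  obtain \<psi> where \<psi>: "\<And>k. \<psi> k \<in> test_functions \<Omega>"
     "(\<lambda>k. L2norm \<Omega> (\<lambda>x. w x - \<psi> k x)) \<longlonglongrightarrow> 0"
     "(\<lambda>k. L2norm \<Omega> (\<lambda>x. weak_grad \<Omega> w x - grad (\<psi> k) x)) \<longlonglongrightarrow> 0" using H10_approx[OF w] by metis
  note tL2 = test_function_L2[OF \<psi>(1) open_lebesgue]
  have "(\<lambda>k. LINT x|lebesgue_on \<Omega>. q x \<bullet> grad (\<psi> k) x) \<longlonglongrightarrow> (LINT x|lebesgue_on \<Omega>. q x \<bullet> weak_grad \<Omega> w x)"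
    by (rule L2_tendsto_inner[OF q(1) tL2(2) H10_L2(2)[OF w] \<psi>(3)])
  moreover have "(\<lambda>k. - (LINT x|lebesgue_on \<Omega>. d x * \<psi> k x)) \<longlonglongrightarrow> - (LINT x|lebesgue_on \<Omega>. d x * w x)"
    using L2_tendsto_inner[OF q(2) tL2(1) H10_L2(1)[OF w] \<psi>(2)] by (intro tendsto_minus) simp
  moreover have "(LINT x|lebesgue_on \<Omega>. q x \<bullet> grad (\<psi> k) x) = - (LINT x|lebesgue_on \<Omega>. d x * \<psi> k x)" for k
    using q(3) \<psi>(1) by (simp add: has_weak_div_def)
  ultimately show ?thesis using LIMSEQ_unique by simp
qed

text \<open>Integrating the derivative of \<open>x\<^sub>i \<psi>\<^sup>2\<close> in the direction \<open>i\<close> gives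
  \<open>\<integral> \<psi>\<^sup>2 = - 2 \<integral> x\<^sub>i \<psi> \<partial>\<^sub>i \<psi>\<close>.\<close>

lemma Poincare_test_function:
  assumes \<psi>: "\<psi> \<in> test_functions \<Omega>" and M: "\<And>x. x \<in> \<Omega> \<Longrightarrow> norm x \<le> M" "0 \<le> M"
  shows "L2norm \<Omega> \<psi> \<le> 2 * M * L2norm \<Omega> (grad \<psi>)"
proof -
  obtain i :: 'a where i: "i \<in> Basis" using nonempty_Basis by blast
  obtain K where K: "compact K" "K \<subseteq> \<Omega>" "\<And>x. (\<psi> has_derivative (\<lambda>h. grad \<psi> x \<bullet> h)) (at x)"
    "continuous_on UNIV \<psi>" "continuous_on UNIV (grad \<psi>)" "\<And>x. x \<notin> K \<Longrightarrow> \<psi> x = 0 \<and> grad \<psi> x = 0"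
    using test_function_props[OF \<psi>] by metis
  note L2 = test_function_L2[OF \<psi> open_lebesgue]
  let ?k = "\<lambda>x. (x \<bullet> i) * (grad \<psi> x \<bullet> i)"
  have k: "?k \<in> L2 \<Omega>" "L2norm \<Omega> ?k \<le> M * L2norm \<Omega> (grad \<psi>)"
  proof -
    have b: "norm (?k x) \<le> M * norm (grad \<psi> x)" if "x \<in> \<Omega>" for x
      using Basis_le_norm[OF i, of x] M(1)[OF that] Basis_le_norm[OF i, of "grad \<psi> x"] M(2)
      by (auto simp: abs_mult intro!: mult_mono)
    have "continuous_on UNIV ?k" by (intro continuous_intros K(5))
    then have m: "?k \<in> borel_measurable (lebesgue_on \<Omega>)"
      using continuous_imp_measurable_on_sets_lebesgue[OF continuous_on_subset open_lebesgue] by blast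
    show "?k \<in> L2 \<Omega>" by (rule L2_dominated(1)[OF L2(2) m b M(2)])
    show "L2norm \<Omega> ?k \<le> M * L2norm \<Omega> (grad \<psi>)" by (rule L2_dominated(2)[OF L2(2) m b M(2)])
  qed
  have "(LINT x|lborel. ((\<psi> x)\<^sup>2 *\<^sub>R i + (2 * (x \<bullet> i) * \<psi> x) *\<^sub>R grad \<psi> x) \<bullet> i) = 0"
  proof (rule integral_directional_derivative_zero[where \<psi>="\<lambda>x. (x \<bullet> i) * (\<psi> x)\<^sup>2" and K=K])
    show "((\<lambda>x. (x \<bullet> i) * (\<psi> x)\<^sup>2) has_derivative
        (\<lambda>h. ((\<psi> x)\<^sup>2 *\<^sub>R i + (2 * (x \<bullet> i) * \<psi> x) *\<^sub>R grad \<psi> x) \<bullet> h)) (at x)" for x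
      by (rule has_derivative_eq_rhs, (rule derivative_intros K(3))+)
        (simp add: fun_eq_iff inner_add_left inner_commute algebra_simps)
  qed (use K in \<open>auto intro!: continuous_intros\<close>)
  moreover have "((\<psi> x)\<^sup>2 *\<^sub>R i + (2 * (x \<bullet> i) * \<psi> x) *\<^sub>R grad \<psi> x) \<bullet> i = (norm (\<psi> x))\<^sup>2 + 2 * (\<psi> x * ?k x)" for x
    using i by (simp add: inner_add_left inner_same_Basis)
  ultimately have "(LINT x|lborel. (norm (\<psi> x))\<^sup>2 + 2 * (\<psi> x * ?k x)) = 0" by simp
  moreover have "(LINT x|lebesgue_on \<Omega>. (norm (\<psi> x))\<^sup>2 + 2 * (\<psi> x * ?k x)) = (LINT x|lborel. (norm (\<psi> x))\<^sup>2 + 2 * (\<psi> x * ?k x))"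
    by (rule continuous_compact_support(2)[OF _ K(1,2) _ open_lebesgue])
      (use K in \<open>auto intro!: continuous_intros\<close>)
  ultimately have "(L2norm \<Omega> \<psi>)\<^sup>2 + 2 * (LINT x|lebesgue_on \<Omega>. \<psi> x * ?k x) = 0"
    using L2_integrable_sq[OF L2(1)] L2_mult_integrable[OF L2(1) k(1)] by (simp add: L2norm_sq)
  then have "(L2norm \<Omega> \<psi>)\<^sup>2 \<le> 2 * (L2norm \<Omega> \<psi> * L2norm \<Omega> ?k)"
    using L2_Cauchy_Schwarz[OF L2(1) k(1)] by simp
  also have "\<dots> \<le> 2 * (L2norm \<Omega> \<psi> * (M * L2norm \<Omega> (grad \<psi>)))"
    using k(2) by (intro mult_left_mono) auto
  finally have "L2norm \<Omega> \<psi> * L2norm \<Omega> \<psi> \<le> L2norm \<Omega> \<psi> * (2 * M * L2norm \<Omega> (grad \<psi>))"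
    by (simp add: power2_eq_square algebra_simps)
  then show ?thesis
    using M(2) L2norm_nonneg[of \<Omega> \<psi>] by (cases "L2norm \<Omega> \<psi> = 0") (auto simp: mult_le_cancel_left)
qed

lemma Poincare:
  assumes w: "w \<in> H10 \<Omega>" and M: "\<And>x. x \<in> \<Omega> \<Longrightarrow> norm x \<le> M" "0 \<le> M"
  shows "L2norm \<Omega> w \<le> 2 * M * L2norm \<Omega> (weak_grad \<Omega> w)"
proof -
  obtain \<psi> where \<psi>: "\<And>k. \<psi> k \<in> test_functions \<Omega>"
     "(\<lambda>k. L2norm \<Omega> (\<lambda>x. w x - \<psi> k x)) \<longlonglongrightarrow> 0"
     "(\<lambda>k. L2norm \<Omega> (\<lambda>x. weak_grad \<Omega> w x - grad (\<psi> k) x)) \<longlonglongrightarrow> 0" using H10_approx[OF w] by metis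
  note tL2 = test_function_L2[OF \<psi>(1) open_lebesgue]
  have "(\<lambda>k. L2norm \<Omega> (\<psi> k)) \<longlonglongrightarrow> L2norm \<Omega> w"
    by (rule L2norm_tendsto[OF tL2(1) H10_L2(1)[OF w] \<psi>(2)])
  moreover have "(\<lambda>k. 2 * M * L2norm \<Omega> (grad (\<psi> k))) \<longlonglongrightarrow> 2 * M * L2norm \<Omega> (weak_grad \<Omega> w)"
    by (intro tendsto_mult tendsto_const L2norm_tendsto[OF tL2(2) H10_L2(2)[OF w] \<psi>(3)])
  ultimately show ?thesis
    using Poincare_test_function[OF \<psi>(1) M] by (intro LIMSEQ_le) auto
qed

end

section \<open>Integration over cones\<close>

lemma nn_integral_translation:
  fixes f :: "'a::euclidean_space \<Rightarrow> ennreal"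
  assumes [measurable]: "f \<in> borel_measurable borel"
  shows "(\<integral>\<^sup>+x. f (x + c) \<partial>lborel) = (\<integral>\<^sup>+x. f x \<partial>lborel)"
  using nn_integral_distr[of "(+) c" lborel borel f] by (simp add: lborel_distr_plus add.commute)

lemma nn_integral_scaling:
  fixes f :: "'a::euclidean_space \<Rightarrow> ennreal"
  assumes [measurable]: "f \<in> borel_measurable borel" and "0 < s"
  shows "(\<integral>\<^sup>+x. f x \<partial>lborel) = ennreal (s ^ DIM('a)) * (\<integral>\<^sup>+x. f (s *\<^sub>R x) \<partial>lborel)"
  using assms(2) by (subst lborel_affine[of s 0]) (simp_all add: nn_integral_density nn_integral_distr nn_integral_cmult)

text \<open>The measure of the hyperplane orthogonal to \<open>\<nu>\<close> is represented by averaging over the slab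
  \<open>0 \<le> y \<bullet> \<nu> \<le> 1\<close>. Fubini's theorem for the splitting into this hyperplane and the line
  spanned by \<open>\<nu>\<close> then follows from translation invariance alone.\<close>

definition orth_proj :: "'a::real_inner \<Rightarrow> 'a \<Rightarrow> 'a" where
  "orth_proj \<nu> y = y - (y \<bullet> \<nu>) *\<^sub>R \<nu>"

lemma measurable_orth_proj [measurable]: "orth_proj (\<nu>::'a::euclidean_space) \<in> borel \<rightarrow>\<^sub>M borel"
  unfolding orth_proj_def[abs_def] by measurable

lemma orth_proj_simps:
  assumes "norm \<nu> = 1"
  shows "orth_proj \<nu> y \<bullet> \<nu> = 0" "orth_proj \<nu> (y + t *\<^sub>R \<nu>) = orth_proj \<nu> y"
    "orth_proj \<nu> (s *\<^sub>R y) = s *\<^sub>R orth_proj \<nu> y" "orth_proj \<nu> (orth_proj \<nu> y) = orth_proj \<nu> y"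
proof -
  have "\<nu> \<bullet> \<nu> = 1" using assms by (simp add: norm_eq_1)
  then show "orth_proj \<nu> y \<bullet> \<nu> = 0" "orth_proj \<nu> (y + t *\<^sub>R \<nu>) = orth_proj \<nu> y"
    "orth_proj \<nu> (s *\<^sub>R y) = s *\<^sub>R orth_proj \<nu> y" "orth_proj \<nu> (orth_proj \<nu> y) = orth_proj \<nu> y"
    by (simp_all add: orth_proj_def inner_diff_left inner_add_left algebra_simps)
qed

abbreviation slab :: "'a::real_inner \<Rightarrow> 'a \<Rightarrow> ennreal" where
  "slab \<nu> y \<equiv> indicator {0..1::real} (y \<bullet> \<nu>)"

text \<open>Insert the factor 1, written as the integral over \<open>t\<close> of the indicator of
  [0,1] at \<open>y \<bullet> \<nu> - t\<close>. For fixed \<open>t\<close> shift \<open>y\<close>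
  by \<open>t *\<^sub>R \<nu>\<close>, which frees the slab from \<open>t\<close>; for fixed
  \<open>y\<close> shift \<open>t\<close> by \<open>- (y \<bullet> \<nu>)\<close>, which leaves only
  the orthogonal part of \<open>y\<close> in the argument of \<open>K\<close>.\<close>

lemma nn_integral_slab:
  fixes \<nu> :: "'a::euclidean_space" and K :: "'a \<Rightarrow> ennreal"
  assumes \<nu>: "norm \<nu> = 1" and [measurable]: "K \<in> borel_measurable borel"
  shows "(\<integral>\<^sup>+y. K y \<partial>lborel) = (\<integral>\<^sup>+t. \<integral>\<^sup>+y. slab \<nu> y * K (orth_proj \<nu> y + t *\<^sub>R \<nu>) \<partial>lborel \<partial>lborel)"
proof -
  have \<nu>\<nu>: "\<nu> \<bullet> \<nu> = 1" using \<nu> by (simp add: norm_eq_1)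
  have "(\<integral>\<^sup>+y. K y \<partial>lborel) = (\<integral>\<^sup>+y. (\<integral>\<^sup>+t. indicator {0..1::real} (y \<bullet> \<nu> - t) * K y \<partial>lborel) \<partial>lborel)"
  proof (rule nn_integral_cong)
    fix y
    have "(\<lambda>t. indicator {0..1::real} (y \<bullet> \<nu> - t) :: ennreal) = indicator {y \<bullet> \<nu> - 1..y \<bullet> \<nu>}"
      by (auto simp: fun_eq_iff split: split_indicator)
    then have "(\<integral>\<^sup>+t. indicator {0..1::real} (y \<bullet> \<nu> - t) \<partial>lborel) = 1"
      by (simp only: nn_integral_indicator sets_lborel sets_borel atLeastAtMost_borel emeasure_lborel_Icc) simp
    then show "K y = (\<integral>\<^sup>+t. indicator {0..1::real} (y \<bullet> \<nu> - t) * K y \<partial>lborel)"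
      by (simp add: nn_integral_multc)
  qed
  also have "\<dots> = (\<integral>\<^sup>+t. (\<integral>\<^sup>+y. indicator {0..1::real} (y \<bullet> \<nu> - t) * K y \<partial>lborel) \<partial>lborel)"
    by (rule lborel_pair.Fubini') measurable
  also have "\<dots> = (\<integral>\<^sup>+t. (\<integral>\<^sup>+y. slab \<nu> y * K (y + t *\<^sub>R \<nu>) \<partial>lborel) \<partial>lborel)"
  proof (rule nn_integral_cong)
    fix t :: real
    have "(\<lambda>y. indicator {0..1::real} (y \<bullet> \<nu> - t) * K y) \<in> borel_measurable borel" by measurable
    from nn_integral_translation[OF this, of "t *\<^sub>R \<nu>"]
    show "(\<integral>\<^sup>+y. indicator {0..1::real} (y \<bullet> \<nu> - t) * K y \<partial>lborel) = (\<integral>\<^sup>+y. slab \<nu> y * K (y + t *\<^sub>R \<nu>) \<partial>lborel)"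
      by (simp add: inner_add_left \<nu>\<nu>)
  qed
  also have "\<dots> = (\<integral>\<^sup>+y. (\<integral>\<^sup>+t. slab \<nu> y * K (y + t *\<^sub>R \<nu>) \<partial>lborel) \<partial>lborel)"
    by (rule lborel_pair.Fubini') measurable
  also have "\<dots> = (\<integral>\<^sup>+y. (\<integral>\<^sup>+t. slab \<nu> y * K (orth_proj \<nu> y + t *\<^sub>R \<nu>) \<partial>lborel) \<partial>lborel)"
  proof (rule nn_integral_cong)
    fix y
    have "(\<lambda>t. slab \<nu> y * K (y + t *\<^sub>R \<nu>)) \<in> borel_measurable borel" by measurable
    from nn_integral_translation[OF this, of "- (y \<bullet> \<nu>)"]
    show "(\<integral>\<^sup>+t. slab \<nu> y * K (y + t *\<^sub>R \<nu>) \<partial>lborel) = (\<integral>\<^sup>+t. slab \<nu> y * K (orth_proj \<nu> y + t *\<^sub>R \<nu>) \<partial>lborel)"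
      by (simp add: orth_proj_def algebra_simps)
  qed
  also have "\<dots> = (\<integral>\<^sup>+t. (\<integral>\<^sup>+y. slab \<nu> y * K (orth_proj \<nu> y + t *\<^sub>R \<nu>) \<partial>lborel) \<partial>lborel)"
    by (rule lborel_pair.Fubini') measurable
  finally show ?thesis .
qed

text \<open>The hyperplane has one dimension less than the space. Scaling the whole space gives the
  power \<open>DIM('a)\<close> but also changes the thickness of the slab to \<open>1 / s\<close>;
  splitting off the normal direction again removes one factor \<open>s\<close>.\<close>

lemma nn_integral_slab_scaling:
  fixes \<nu> :: "'a::euclidean_space" and G :: "'a \<Rightarrow> ennreal"
  assumes \<nu>: "norm \<nu> = 1" and [measurable]: "G \<in> borel_measurable borel" and s: "0 < s"
  shows "(\<integral>\<^sup>+y. slab \<nu> y * G (orth_proj \<nu> y) \<partial>lborel) =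
    ennreal (s ^ (DIM('a) - 1)) * (\<integral>\<^sup>+y. slab \<nu> y * G (s *\<^sub>R orth_proj \<nu> y) \<partial>lborel)" (is "?l = _ * ?r")
proof -
  have \<nu>\<nu>: "\<nu> \<bullet> \<nu> = 1" using \<nu> by (simp add: norm_eq_1)
  have len: "(\<integral>\<^sup>+t. indicator {0..1::real} (s * t) \<partial>lborel) = ennreal (1 / s)"
  proof -
    have "(\<lambda>t. indicator {0..1::real} (s * t) :: ennreal) = indicator {0..1/s}"
      using s by (auto simp: fun_eq_iff field_simps zero_le_mult_iff split: split_indicator)
    then show ?thesis using s by simp
  qed
  have "?l = ennreal (s ^ DIM('a)) * (\<integral>\<^sup>+y. indicator {0..1::real} (s * (y \<bullet> \<nu>)) * G (s *\<^sub>R orth_proj \<nu> y) \<partial>lborel)"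
    by (subst nn_integral_scaling[OF _ s]) (simp_all add: orth_proj_simps[OF \<nu>])
  also have "(\<integral>\<^sup>+y. indicator {0..1::real} (s * (y \<bullet> \<nu>)) * G (s *\<^sub>R orth_proj \<nu> y) \<partial>lborel) =
      (\<integral>\<^sup>+t. (\<integral>\<^sup>+y. slab \<nu> y * (indicator {0..1::real} (s * t) * G (s *\<^sub>R orth_proj \<nu> y)) \<partial>lborel) \<partial>lborel)"
    by (subst nn_integral_slab[OF \<nu>]) (simp_all add: orth_proj_simps[OF \<nu>] inner_add_left \<nu>\<nu>)
  also have "\<dots> = (\<integral>\<^sup>+t. indicator {0..1::real} (s * t) * ?r \<partial>lborel)"
    by (rule nn_integral_cong, subst nn_integral_cmult[symmetric]) (auto simp: ac_simps)
  also have "\<dots> = ennreal (1 / s) * ?r"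
    by (simp add: nn_integral_multc len)
  also have "ennreal (s ^ DIM('a)) * (ennreal (1 / s) * ?r) = ennreal (s ^ (DIM('a) - 1)) * ?r"
  proof -
    have "s ^ DIM('a) * (1 / s) = s ^ (DIM('a) - 1)"
      using s by (simp add: power_diff)
    then show ?thesis using s by (simp add: mult.assoc[symmetric] ennreal_mult[symmetric])
  qed
  finally show ?thesis .
qed

text \<open>Fubini for the cone with apex 0 and base \<open>F\<close> at height \<open>d\<close>:
  the slice at height \<open>d * s\<close> is the base scaled by \<open>s\<close>, which contributes
  a power of \<open>s\<close> with exponent one below the dimension, and \<open>d\<close> is the
  Jacobian of the change from height to \<open>s\<close>.\<close>

lemma nn_integral_cone:
  fixes \<nu> :: "'a::euclidean_space" and k :: "'a \<Rightarrow> ennreal"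
  assumes \<nu>: "norm \<nu> = 1" and d: "0 < d" and F: "\<And>x. x \<in> F \<Longrightarrow> x \<bullet> \<nu> = d"
    and [measurable]: "F \<in> sets borel" "k \<in> borel_measurable borel"
    and T: "T = {s *\<^sub>R x | s x. 0 \<le> s \<and> s \<le> 1 \<and> x \<in> F}" and [measurable]: "T \<in> sets borel"
  shows "(\<integral>\<^sup>+y. indicator T y * k y \<partial>lborel) =
    (\<integral>\<^sup>+s. \<integral>\<^sup>+y. ennreal (indicator {0..1} s * (d * s ^ (DIM('a) - 1))) *
       (indicator F (orth_proj \<nu> y + d *\<^sub>R \<nu>) * indicator {d..d+1} (y \<bullet> \<nu>) * k (s *\<^sub>R (orth_proj \<nu> y + d *\<^sub>R \<nu>))) \<partial>lborel \<partial>lborel)"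
proof -
  have \<nu>\<nu>: "\<nu> \<bullet> \<nu> = 1" using \<nu> by (simp add: norm_eq_1)
  let ?K = "\<lambda>y. indicator T y * k y"
  let ?J = "\<lambda>t. \<integral>\<^sup>+y. slab \<nu> y * ?K (orth_proj \<nu> y + t *\<^sub>R \<nu>) \<partial>lborel"
  let ?I = "\<lambda>s. \<integral>\<^sup>+y. indicator F (orth_proj \<nu> y + d *\<^sub>R \<nu>) * indicator {d..d+1} (y \<bullet> \<nu>) * k (s *\<^sub>R (orth_proj \<nu> y + d *\<^sub>R \<nu>)) \<partial>lborel"
  have [measurable]: "?J \<in> borel_measurable borel" by measurable
  have "(\<integral>\<^sup>+y. ?K y \<partial>lborel) = (\<integral>\<^sup>+t. ?J t \<partial>lborel)"
    by (rule nn_integral_slab[OF \<nu>]) measurable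
  also have "\<dots> = ennreal d * (\<integral>\<^sup>+s. ?J (d * s) \<partial>lborel)"
    using nn_integral_real_affine[of ?J d 0] d by simp
  also have "\<dots> = (\<integral>\<^sup>+s. ennreal d * ?J (d * s) \<partial>lborel)"
    by (subst nn_integral_cmult) auto
  also have "\<dots> = (\<integral>\<^sup>+s. ennreal (indicator {0..1} s * (d * s ^ (DIM('a) - 1))) * ?I s \<partial>lborel)"
  proof (rule nn_integral_cong_AE)
    \<comment> \<open>The slice through the apex is not a scaled copy with positive factor; a single
      value of \<open>s\<close> may be dropped.\<close>
    have "AE s in lborel. s \<noteq> (0::real)" by (rule AE_lborel_singleton)
    then show "AE s in lborel. ennreal d * ?J (d * s) = ennreal (indicator {0..1} s * (d * s ^ (DIM('a) - 1))) * ?I s"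
    proof eventually_elim
      case (elim s)
      show ?case
      proof (cases "0 < s \<and> s \<le> 1")
        case False
        have "orth_proj \<nu> y + (d * s) *\<^sub>R \<nu> \<notin> T" for y
        proof
          assume "orth_proj \<nu> y + (d * s) *\<^sub>R \<nu> \<in> T"
          then obtain r x where r: "0 \<le> r" "r \<le> 1" "x \<in> F" "orth_proj \<nu> y + (d * s) *\<^sub>R \<nu> = r *\<^sub>R x"
            by (auto simp: T)
          from arg_cong[OF r(4), of "\<lambda>v. v \<bullet> \<nu>"] have "d * s = r * d"
            using F[OF r(3)] by (simp add: inner_add_left orth_proj_simps[OF \<nu>] \<nu>\<nu>)
          then have "s = r" using d by simp
          with False elim r show False by auto
        qed
        then have "?J (d * s) = 0" by simp
        with False elim show ?thesis by (auto split: split_indicator)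
      next
        case True
        then have s: "0 < s" "s \<le> 1" by auto
        have ind: "indicator T (s *\<^sub>R (orth_proj \<nu> y + d *\<^sub>R \<nu>)) = (indicator F (orth_proj \<nu> y + d *\<^sub>R \<nu>) :: ennreal)" for y
        proof -
          have "s *\<^sub>R (orth_proj \<nu> y + d *\<^sub>R \<nu>) \<in> T \<longleftrightarrow> orth_proj \<nu> y + d *\<^sub>R \<nu> \<in> F"
          proof
            assume "s *\<^sub>R (orth_proj \<nu> y + d *\<^sub>R \<nu>) \<in> T"
            then obtain r x where r: "0 \<le> r" "r \<le> 1" "x \<in> F" "s *\<^sub>R (orth_proj \<nu> y + d *\<^sub>R \<nu>) = r *\<^sub>R x"
              by (auto simp: T)
            from arg_cong[OF r(4), of "\<lambda>v. v \<bullet> \<nu>"] have "s * d = r * d"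
              using F[OF r(3)] by (simp add: inner_add_left orth_proj_simps[OF \<nu>] \<nu>\<nu>)
            then have "s = r" using d by simp
            with r s show "orth_proj \<nu> y + d *\<^sub>R \<nu> \<in> F" by simp
          next
            assume "orth_proj \<nu> y + d *\<^sub>R \<nu> \<in> F"
            with s show "s *\<^sub>R (orth_proj \<nu> y + d *\<^sub>R \<nu>) \<in> T" unfolding T by force
          qed
          then show ?thesis by (simp add: indicator_def)
        qed
        have "?J (d * s) = ennreal (s ^ (DIM('a) - 1)) * (\<integral>\<^sup>+y. slab \<nu> y * ?K (s *\<^sub>R orth_proj \<nu> y + (d * s) *\<^sub>R \<nu>) \<partial>lborel)"
          by (rule nn_integral_slab_scaling[OF \<nu> _ s(1), of "\<lambda>x. ?K (x + (d * s) *\<^sub>R \<nu>)"]) measurable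
        also have "(\<integral>\<^sup>+y. slab \<nu> y * ?K (s *\<^sub>R orth_proj \<nu> y + (d * s) *\<^sub>R \<nu>) \<partial>lborel) =
            (\<integral>\<^sup>+y. slab \<nu> y * (indicator F (orth_proj \<nu> y + d *\<^sub>R \<nu>) * k (s *\<^sub>R (orth_proj \<nu> y + d *\<^sub>R \<nu>))) \<partial>lborel)"
        proof (rule nn_integral_cong)
          fix y
          have v: "s *\<^sub>R orth_proj \<nu> y + (d * s) *\<^sub>R \<nu> = s *\<^sub>R (orth_proj \<nu> y + d *\<^sub>R \<nu>)"
            by (simp add: scaleR_add_right mult.commute)
          show "slab \<nu> y * ?K (s *\<^sub>R orth_proj \<nu> y + (d * s) *\<^sub>R \<nu>) =
              slab \<nu> y * (indicator F (orth_proj \<nu> y + d *\<^sub>R \<nu>) * k (s *\<^sub>R (orth_proj \<nu> y + d *\<^sub>R \<nu>)))"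
            unfolding v ind ..
        qed
        \<comment> \<open>The slab is moved from heights [0,1] to [d,d+1], so that its part over
          \<open>F\<close> is the prism standing on \<open>F\<close> that occurs in
          \<open>facet_integral\<close>.\<close>
        also have "(\<integral>\<^sup>+y. slab \<nu> y * (indicator F (orth_proj \<nu> y + d *\<^sub>R \<nu>) * k (s *\<^sub>R (orth_proj \<nu> y + d *\<^sub>R \<nu>))) \<partial>lborel) = ?I s"
        proof -
          have eq: "indicator {0..1} (y \<bullet> \<nu> - d) = (indicator {d..d+1} (y \<bullet> \<nu>) :: ennreal)" for y
            by (auto split: split_indicator)
          have "(\<lambda>y. slab \<nu> y * (indicator F (orth_proj \<nu> y + d *\<^sub>R \<nu>) * k (s *\<^sub>R (orth_proj \<nu> y + d *\<^sub>R \<nu>)))) \<in> borel_measurable borel"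
            by measurable
          from nn_integral_translation[OF this, of "(- d) *\<^sub>R \<nu>"] show ?thesis
            by (simp add: orth_proj_simps(2)[OF \<nu>, of _ "-d", simplified] inner_diff_left \<nu>\<nu> eq ac_simps)
        qed
        finally show ?thesis
          using s d by (simp add: ennreal_mult mult.assoc)
      qed
    qed
  qed
  also have "\<dots> = (\<integral>\<^sup>+s. \<integral>\<^sup>+y. ennreal (indicator {0..1} s * (d * s ^ (DIM('a) - 1))) *
       (indicator F (orth_proj \<nu> y + d *\<^sub>R \<nu>) * indicator {d..d+1} (y \<bullet> \<nu>) * k (s *\<^sub>R (orth_proj \<nu> y + d *\<^sub>R \<nu>))) \<partial>lborel \<partial>lborel)"
    by (intro nn_integral_cong nn_integral_cmult[symmetric]) measurable
  finally show ?thesis .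
qed

text \<open>The integrand on the left is the divergence of \<open>h x *\<^sub>R x\<close>. This
  field is tangential to the sides of the cone and has normal component \<open>d * h\<close> on the
  base, hence the right-hand side. Along the ray through a base point the integrand times the radial
  density is the derivative of \<open>s ^ DIM('a) * h\<close>, up to the factor \<open>d\<close>, so
  the integral over \<open>s\<close> is explicit.\<close>

lemma integral_cone_radial_divergence:
  fixes \<nu> :: "'a::euclidean_space" and h :: "'a \<Rightarrow> real"
  assumes \<nu>: "norm \<nu> = 1" and d: "0 < d" and F: "\<And>x. x \<in> F \<Longrightarrow> x \<bullet> \<nu> = d" and cF: "compact F"
    and T: "T = {s *\<^sub>R x | s x. 0 \<le> s \<and> s \<le> 1 \<and> x \<in> F}"
    and h: "\<And>x. (h has_derivative (\<lambda>e. D x \<bullet> e)) (at x)" and D: "continuous_on UNIV D"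
  shows "(LINT x|lborel. indicator T x * (real DIM('a) * h x + D x \<bullet> x)) =
    d * (LINT y|lborel. indicator {x + t *\<^sub>R \<nu> |x t. x \<in> F \<and> 0 \<le> t \<and> t \<le> 1} y * h (orth_proj \<nu> y + d *\<^sub>R \<nu>))"
proof -
  let ?n = "DIM('a)"
  have \<nu>\<nu>: "\<nu> \<bullet> \<nu> = 1" using \<nu> by (simp add: norm_eq_1)
  define Q where "Q = {x + t *\<^sub>R \<nu> |x t. x \<in> F \<and> 0 \<le> t \<and> t \<le> 1}"
  define k where "k = (\<lambda>x. real ?n * h x + D x \<bullet> x)"
  define \<pi> where "\<pi> = (\<lambda>y. orth_proj \<nu> y + d *\<^sub>R \<nu>)"
  have ch: "continuous_on S h" for S using h by (rule continuous_of_derivative)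
  have c\<pi>: "continuous_on S \<pi>" for S
    unfolding \<pi>_def orth_proj_def by (intro continuous_intros)
  have D': "continuous_on S D" for S using D continuous_on_subset by blast
  have ck: "continuous_on UNIV k"
    unfolding k_def by (intro continuous_intros ch D)
  have "Q = (\<lambda>(x, t). x + t *\<^sub>R \<nu>) ` (F \<times> {0..1})" by (fastforce simp: Q_def)
  then have cQ: "compact Q"
    using cF by (simp add: split_def) (intro compact_continuous_image compact_Times continuous_intros; simp)
  have "T = (\<lambda>(s, x). s *\<^sub>R x) ` ({0..1} \<times> F)" by (fastforce simp: T)
  then have cT: "compact T"
    using cF by (simp add: split_def) (intro compact_continuous_image compact_Times continuous_intros; simp)
  have [measurable]: "F \<in> sets borel" "T \<in> sets borel" "Q \<in> sets borel" "k \<in> borel_measurable borel" "\<pi> \<in> borel_measurable borel"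
    using cF cT cQ ck c\<pi> by (auto intro: borel_compact borel_measurable_continuous_onI)
  have Q_iff: "y \<in> Q \<longleftrightarrow> \<pi> y \<in> F \<and> d \<le> y \<bullet> \<nu> \<and> y \<bullet> \<nu> \<le> d + 1" for y
  proof
    assume "y \<in> Q"
    then obtain x t where xt: "y = x + t *\<^sub>R \<nu>" "x \<in> F" "0 \<le> t" "t \<le> 1" by (auto simp: Q_def)
    with F[OF xt(2)] show "\<pi> y \<in> F \<and> d \<le> y \<bullet> \<nu> \<and> y \<bullet> \<nu> \<le> d + 1"
      by (simp add: \<pi>_def orth_proj_simps[OF \<nu>] inner_add_left \<nu>\<nu>) (simp add: orth_proj_def)
  next
    assume a: "\<pi> y \<in> F \<and> d \<le> y \<bullet> \<nu> \<and> y \<bullet> \<nu> \<le> d + 1"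
    have "y = \<pi> y + (y \<bullet> \<nu> - d) *\<^sub>R \<nu>" by (simp add: \<pi>_def orth_proj_def algebra_simps)
    with a show "y \<in> Q" unfolding Q_def by (intro CollectI exI[of _ "\<pi> y"] exI[of _ "y \<bullet> \<nu> - d"]) auto
  qed
  define w :: "real \<times> 'a \<Rightarrow> real" where "w = (\<lambda>(s, y). indicator {0..1} s * (d * s ^ (?n - 1)) * indicator Q y)"
  define \<Phi> where "\<Phi> = (\<lambda>(s::real, y). s *\<^sub>R \<pi> y)"
  have w_meas [measurable]: "w \<in> borel_measurable (borel \<Otimes>\<^sub>M borel)"
    unfolding w_def by measurable
  have \<Phi>_meas [measurable]: "\<Phi> \<in> borel_measurable (borel \<Otimes>\<^sub>M borel)"
    unfolding \<Phi>_def by measurable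
  have w_nonneg: "0 \<le> w z" for z
    using d by (auto simp: w_def split: prod.split split_indicator)
  \<comment> \<open>The cone formula holds for nonnegative functions, but \<open>k\<close> may
    change sign. Read for indicators it is an equality of measures, namely that the cone measure is
    an image of a weighted product measure, and this transfers Bochner integrals.\<close>
  have eq: "density lborel (indicator T) = distr (density (lborel \<Otimes>\<^sub>M lborel) w) borel \<Phi>"
  proof (rule measure_eqI)
    fix A assume "A \<in> sets (density lborel (indicator T) :: 'a measure)"
    then have [measurable]: "A \<in> sets borel" by simp
    have "emeasure (density lborel (indicator T)) A = (\<integral>\<^sup>+y. indicator T y * indicator A y \<partial>lborel)"
      by (simp add: emeasure_density)
    also have "\<dots> = (\<integral>\<^sup>+s. \<integral>\<^sup>+y. ennreal (indicator {0..1} s * (d * s ^ (?n - 1))) *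
       (indicator F (orth_proj \<nu> y + d *\<^sub>R \<nu>) * indicator {d..d+1} (y \<bullet> \<nu>) * indicator A (s *\<^sub>R (orth_proj \<nu> y + d *\<^sub>R \<nu>))) \<partial>lborel \<partial>lborel)"
      by (rule nn_integral_cone[OF \<nu> d F _ _ T]) measurable
    also have "\<dots> = (\<integral>\<^sup>+s. \<integral>\<^sup>+y. ennreal (w (s, y)) * indicator A (\<Phi> (s, y)) \<partial>lborel \<partial>lborel)"
    proof (intro nn_integral_cong)
      fix s :: real and y :: 'a
      have "indicator F (\<pi> y) * indicator {d..d+1} (y \<bullet> \<nu>) = (indicator Q y :: ennreal)"
        using Q_iff[of y] by (auto split: split_indicator)
      moreover have "ennreal (w (s, y)) = ennreal (indicator {0..1} s * (d * s ^ (?n - 1))) * indicator Q y"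
        by (auto simp: w_def split: split_indicator)
      ultimately show "ennreal (indicator {0..1} s * (d * s ^ (?n - 1))) *
       (indicator F (orth_proj \<nu> y + d *\<^sub>R \<nu>) * indicator {d..d+1} (y \<bullet> \<nu>) * indicator A (s *\<^sub>R (orth_proj \<nu> y + d *\<^sub>R \<nu>)))
        = ennreal (w (s, y)) * indicator A (\<Phi> (s, y))"
        by (simp add: \<Phi>_def \<pi>_def mult.assoc)
    qed
    also have "\<dots> = (\<integral>\<^sup>+z. ennreal (w z) * indicator A (\<Phi> z) \<partial>(lborel \<Otimes>\<^sub>M lborel))"
      by (rule lborel.nn_integral_fst) measurable
    also have "\<dots> = emeasure (distr (density (lborel \<Otimes>\<^sub>M lborel) w) borel \<Phi>) A"
    proof -
      have m: "\<Phi> -` A \<inter> space (lborel \<Otimes>\<^sub>M lborel) \<in> sets (lborel \<Otimes>\<^sub>M lborel)" by measurable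
      show ?thesis
        by (subst emeasure_distr, measurable, subst emeasure_density)
          (use m in \<open>auto intro!: nn_integral_cong split: split_indicator\<close>)
    qed
    finally show "emeasure (density lborel (indicator T)) A = emeasure (distr (density (lborel \<Otimes>\<^sub>M lborel) w) borel \<Phi>) A" .
  qed simp
  have "(LINT x|lborel. indicator T x * k x) = integral\<^sup>L (density lborel (\<lambda>x. ennreal (indicator T x))) k"
    by (subst integral_density) auto
  also have "\<dots> = integral\<^sup>L (distr (density (lborel \<Otimes>\<^sub>M lborel) w) borel \<Phi>) k"
    using eq by (simp add: ennreal_indicator)
  also have "\<dots> = (LINT z|(lborel \<Otimes>\<^sub>M lborel). w z * k (\<Phi> z))"
    by (subst integral_distr, measurable, subst integral_density) (auto simp: w_nonneg)
  also have "\<dots> = (LINT y|lborel. (LINT s|lborel. w (s, y) * k (\<Phi> (s, y))))"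
  proof -
    have "integrable lborel (\<lambda>z::real\<times>'a. indicator ({0..1} \<times> Q) z *\<^sub>R (d * fst z ^ (?n - 1) * k (fst z *\<^sub>R \<pi> (snd z))))"
      by (intro borel_integrable_compact compact_Times cQ continuous_intros continuous_on_compose2[OF ck]
          continuous_on_compose2[OF c\<pi>]) auto
    moreover have "indicator ({0..1} \<times> Q) z *\<^sub>R (d * fst z ^ (?n - 1) * k (fst z *\<^sub>R \<pi> (snd z))) = w z * k (\<Phi> z)" for z
      by (cases z) (auto simp: w_def \<Phi>_def split: split_indicator)
    ultimately have "integrable (lborel \<Otimes>\<^sub>M lborel) (\<lambda>(s, y). w (s, y) * k (\<Phi> (s, y)))"
      by (simp add: lborel_prod split_def)
    from lborel_pair.integral_snd[OF this] show ?thesis by (simp add: split_def)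
  qed
  also have "\<dots> = (LINT y|lborel. d * (indicator Q y * h (\<pi> y)))"
  proof (rule Bochner_Integration.integral_cong[OF refl])
    fix y
    have deriv: "((\<lambda>s. s ^ ?n * h (s *\<^sub>R \<pi> y)) has_real_derivative s ^ (?n - 1) * k (s *\<^sub>R \<pi> y)) (at s)" for s
    proof -
      have "((\<lambda>s. s *\<^sub>R \<pi> y) has_derivative (\<lambda>r. r *\<^sub>R \<pi> y)) (at s)"
        by (auto intro!: derivative_eq_intros)
      from has_derivative_compose[OF this h]
      have hd: "((\<lambda>s. h (s *\<^sub>R \<pi> y)) has_real_derivative D (s *\<^sub>R \<pi> y) \<bullet> \<pi> y) (at s)"
        unfolding has_field_derivative_def by (rule has_derivative_eq_rhs) (simp add: fun_eq_iff)
      have "((\<lambda>s. s ^ ?n * h (s *\<^sub>R \<pi> y)) has_real_derivative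
          s ^ ?n * (D (s *\<^sub>R \<pi> y) \<bullet> \<pi> y) + (real ?n * s ^ (?n - 1)) * h (s *\<^sub>R \<pi> y)) (at s)"
        using DERIV_mult[OF DERIV_pow[of ?n s] hd] by (simp add: algebra_simps)
      moreover have "s ^ ?n = s ^ (?n - 1) * s"
        using DIM_positive[where 'a='a] by (metis One_nat_def Suc_pred power_Suc2)
      ultimately show ?thesis by (simp add: k_def algebra_simps)
    qed
    then have vec: "((\<lambda>s. s ^ ?n * h (s *\<^sub>R \<pi> y)) has_vector_derivative s ^ (?n - 1) * k (s *\<^sub>R \<pi> y)) (at s within {0..1})" for s
      by (simp add: has_real_derivative_iff_has_vector_derivative has_vector_derivative_at_within)
    have "continuous_on {0..1} (\<lambda>s. s ^ (?n - 1) * k (s *\<^sub>R \<pi> y))"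
      by (intro continuous_intros continuous_on_compose2[OF ck]) auto
    from integral_FTC_Icc[OF _ vec this]
    \<comment> \<open>The lower limit contributes nothing because \<open>0 ^ DIM('a) = 0\<close> in
      positive dimension.\<close>
    have FTC: "(LINT s|lborel. indicator {0..1} s *\<^sub>R (s ^ (?n - 1) * k (s *\<^sub>R \<pi> y))) = h (\<pi> y)"
      by simp
    have weq: "(\<lambda>s. w (s, y) * k (\<Phi> (s, y))) = (\<lambda>s. (d * indicator Q y) * (indicator {0..1} s *\<^sub>R (s ^ (?n - 1) * k (s *\<^sub>R \<pi> y))))"
      by (auto simp: w_def \<Phi>_def)
    show "(LINT s|lborel. w (s, y) * k (\<Phi> (s, y))) = d * (indicator Q y * h (\<pi> y))"
      unfolding weq integral_mult_right_zero FTC by (rule mult.assoc)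
  qed
  finally show ?thesis
    by (simp add: k_def Q_def \<pi>_def)
qed

text \<open>Rests on the completeness of Lebesgue measure. Membership in \<open>Pk\<close> only
  prescribes the values almost everywhere, so measurability has to be inherited from the polynomial
  representative.\<close>

lemma borel_measurable_lebesgue_on_cong_AE:
  fixes f g :: "'a::euclidean_space \<Rightarrow> 'b::euclidean_space"
  assumes f: "f \<in> borel_measurable (lebesgue_on S)" and S: "S \<in> sets lebesgue"
    and ae: "AE x in lebesgue_on S. f x = g x"
  shows "g \<in> borel_measurable (lebesgue_on S)"
proof (rule measurableI)
  fix B :: "'b set" assume "B \<in> sets borel"
  with f have "f -` B \<inter> space (lebesgue_on S) \<in> sets (lebesgue_on S)" by (rule measurable_sets)
  then have A: "f -` B \<inter> S \<in> sets lebesgue"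
    using S by (simp add: sets_restrict_space_iff space_restrict_space)
  have "AE x in lebesgue. x \<in> f -` B \<inter> S \<longleftrightarrow> x \<in> g -` B \<inter> S"
    using ae S by (auto simp: AE_restrict_space_iff elim!: eventually_mono)
  then have "g -` B \<inter> S \<in> sets lebesgue"
    using A by (rule completion.in_sets_AE) simp
  then show "g -` B \<inter> space (lebesgue_on S) \<in> sets (lebesgue_on S)"
    using S by (simp add: sets_restrict_space_iff space_restrict_space)
qed simp

lemma L2_cong_AE:
  fixes f g :: "'a::euclidean_space \<Rightarrow> 'b::euclidean_space"
  assumes f: "f \<in> L2 S" and S: "S \<in> sets lebesgue" and ae: "AE x in lebesgue_on S. f x = g x"
  shows "g \<in> L2 S"
proof -
  have g: "g \<in> borel_measurable (lebesgue_on S)"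
    using borel_measurable_lebesgue_on_cong_AE[OF L2_measurable[OF f] S ae] .
  have "integrable (lebesgue_on S) (\<lambda>x. (norm (g x))\<^sup>2)"
    by (rule integrable_cong_AE_imp[OF L2_integrable_sq[OF f]])
      (use g ae in \<open>auto elim!: eventually_mono\<close>)
  with g show ?thesis by (simp add: L2_def)
qed

lemma integral_lebesgue_on_borel:
  fixes f :: "'a::euclidean_space \<Rightarrow> real"
  assumes [measurable]: "S \<in> sets borel" "f \<in> borel_measurable borel"
  shows "(LINT x|lebesgue_on S. f x) = (LINT x|lborel. indicator S x * f x)"
  by (simp add: integral_restrict_space integral_completion)

section \<open>The divergence theorem on a simplex\<close>

text \<open>Dropping one vertex leaves affinely independent points that span a hyperplane, and
  independence keeps the dropped vertex off it. The sign of the normal is fixed by placing that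
  vertex strictly below, so the normal points outwards.\<close>

lemma simplex_facet_normals:
  fixes C :: "'a::euclidean_space set"
  assumes C: "\<not> affine_dependent C" "card C = Suc DIM('a)"
  obtains \<nu> :: "'a \<Rightarrow> 'a" and c :: "'a \<Rightarrow> real" where
    "\<And>z. z \<in> C \<Longrightarrow> norm (\<nu> z) = 1" "\<And>z. z \<in> C \<Longrightarrow> z \<bullet> \<nu> z < c z"
    "\<And>z. z \<in> C \<Longrightarrow> affine hull (C - {z}) = {x. x \<bullet> \<nu> z = c z}"
proof -
  have "\<exists>\<nu> c. norm \<nu> = 1 \<and> z \<bullet> \<nu> < c \<and> affine hull (C - {z}) = {x. x \<bullet> \<nu> = c}" if z: "z \<in> C" for z
  proof -
    have fin: "finite C" using C(1) aff_independent_finite by blast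
    have "\<not> affine_dependent (C - {z})" using C(1) affine_independent_Diff by blast
    then have "aff_dim (C - {z}) = DIM('a) - 1"
      using aff_dim_affine_independent[of "C - {z}"] C(2) z fin by simp
    then obtain a b where ab: "a \<noteq> 0" "affine hull (C - {z}) = {x. a \<bullet> x = b}"
      unfolding aff_dim_eq_hyperplane by blast
    have "z \<notin> affine hull (C - {z})" using C(1) z by (auto simp: affine_dependent_def)
    then have zb: "a \<bullet> z \<noteq> b" using ab by simp
    define r where "r = (if a \<bullet> z < b then 1 else -1) / norm a"
    have r: "r \<noteq> 0" "\<bar>r\<bar> = 1 / norm a" using ab(1) by (auto simp: r_def)
    show ?thesis
    proof (intro exI[of _ "r *\<^sub>R a"] exI[of _ "r * b"] conjI)
      show "norm (r *\<^sub>R a) = 1" using r ab(1) by simp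
      show "z \<bullet> (r *\<^sub>R a) < r * b"
        using zb ab(1) by (auto simp: r_def inner_commute divide_simps)
      show "affine hull (C - {z}) = {x. x \<bullet> r *\<^sub>R a = r * b}"
        using ab(2) r(1) by (simp add: inner_commute)
    qed
  qed
  then show thesis using that by metis
qed

lemma closest_point_hyperplane:
  fixes \<nu> :: "'a::euclidean_space"
  assumes "norm \<nu> = 1"
  shows "closest_point {x. x \<bullet> \<nu> = c} y = y + (c - y \<bullet> \<nu>) *\<^sub>R \<nu>"
proof (rule closest_point_unique[symmetric])
  have "\<nu> \<bullet> \<nu> = 1" using assms by (simp add: norm_eq_1)
  then show "y + (c - y \<bullet> \<nu>) *\<^sub>R \<nu> \<in> {x. x \<bullet> \<nu> = c}" by (simp add: inner_add_left)
  show "convex {x. x \<bullet> \<nu> = c}" using convex_hyperplane[of \<nu> c] by (simp add: inner_commute)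
  show "closed {x. x \<bullet> \<nu> = c}" using closed_hyperplane[of \<nu> c] by (simp add: inner_commute)
  show "\<forall>z\<in>{x. x \<bullet> \<nu> = c}. dist y (y + (c - y \<bullet> \<nu>) *\<^sub>R \<nu>) \<le> dist y z"
  proof
    fix z assume "z \<in> {x. x \<bullet> \<nu> = c}"
    then have "\<bar>c - y \<bullet> \<nu>\<bar> = \<bar>(z - y) \<bullet> \<nu>\<bar>" by (simp add: inner_diff_left)
    also have "\<dots> \<le> norm (z - y) * norm \<nu>" by (rule Cauchy_Schwarz_ineq2)
    finally show "dist y (y + (c - y \<bullet> \<nu>) *\<^sub>R \<nu>) \<le> dist y z"
      using assms by (simp add: dist_norm norm_minus_commute)
  qed
qed

text \<open>On the prism over \<open>F\<close> the closest point of the hyperplane is the foot in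
  \<open>F\<close>, so no values off the facet enter. This permits replacing traces, which are known
  only on the simplex, by polynomials.\<close>

lemma facet_integral_cong:
  fixes \<nu> :: "'a::euclidean_space"
  assumes "norm \<nu> = 1" "affine hull F = {x. x \<bullet> \<nu> = c}" "\<And>x. x \<in> F \<Longrightarrow> g x = g' x"
  shows "facet_integral \<nu> F g = facet_integral \<nu> F g'"
  unfolding facet_integral_def
proof (rule Bochner_Integration.integral_cong[OF refl])
  fix y assume "y \<in> space (lebesgue_on {x + t *\<^sub>R \<nu> |x t. x \<in> F \<and> 0 \<le> t \<and> t \<le> 1})"
  then obtain x t where xt: "y = x + t *\<^sub>R \<nu>" "x \<in> F" by (auto simp: space_restrict_space)
  have "x \<bullet> \<nu> = c" using xt(2) assms(2) hull_subset[of F affine] by auto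
  then have "closest_point (affine hull F) y = x"
    using assms(1) xt(1) unfolding assms(2) closest_point_hyperplane[OF assms(1)]
    by (simp add: inner_add_left norm_eq_1)
  with xt(2) assms(3) show "g (closest_point (affine hull F) y) = g' (closest_point (affine hull F) y)" by simp
qed

section \<open>Barycentric coordinates and the divergence theorem on one simplex\<close>

context
  fixes C :: "'a::euclidean_space set" and \<nu> :: "'a \<Rightarrow> 'a" and c :: "'a \<Rightarrow> real"
  assumes indep: "\<not> affine_dependent C" and cardC: "card C = Suc DIM('a)"
    and norm_\<nu>: "\<And>z. z \<in> C \<Longrightarrow> norm (\<nu> z) = 1" and below: "\<And>z. z \<in> C \<Longrightarrow> z \<bullet> \<nu> z < c z"
    and hull: "\<And>z. z \<in> C \<Longrightarrow> affine hull (C - {z}) = {x. x \<bullet> \<nu> z = c z}"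
begin

abbreviation facet :: "'a \<Rightarrow> 'a set" where "facet z \<equiv> convex hull (C - {z})"

text \<open>The negative gradient of the barycentric coordinate of \<open>z\<close>, which is
  \<open>(c z - x \<bullet> \<nu> z) / (c z - z \<bullet> \<nu> z)\<close>. The sign makes it a
  positive multiple of the outer normal of the opposite facet, and the denominator is the height of
  the simplex over that facet.\<close>

definition bary_grad :: "'a \<Rightarrow> 'a" where "bary_grad z = \<nu> z /\<^sub>R (c z - z \<bullet> \<nu> z)"

lemma finite_C: "finite C" using indep aff_independent_finite by blast

lemma vertex_on_facet: "z \<in> C \<Longrightarrow> w \<in> C \<Longrightarrow> w \<noteq> z \<Longrightarrow> w \<bullet> \<nu> z = c z"
  using hull[of z] hull_subset[of "C - {z}" affine] by auto

lemma facet_nonempty: "z \<in> C \<Longrightarrow> C - {z} \<noteq> {}"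
proof
  assume "z \<in> C" "C - {z} = {}"
  then have "C = {z}" by auto
  with cardC show False by simp
qed

lemma affine_hull_facet: "z \<in> C \<Longrightarrow> affine hull facet z = {x. x \<bullet> \<nu> z = c z}"
  using hull by (simp add: affine_hull_convex_hull)

lemma facet_plane: "z \<in> C \<Longrightarrow> x \<in> facet z \<Longrightarrow> x \<bullet> \<nu> z = c z"
  using affine_hull_facet[of z] hull_subset[of "facet z" affine] by auto

text \<open>The vertices affinely span the space, so \<open>x\<close> has some barycentric weights.
  Testing with \<open>\<nu> z\<close> isolates the weight of \<open>z\<close>, since all other
  vertices lie in the hyperplane of the facet opposite to \<open>z\<close>.\<close>

lemma barycentric:
  "(\<Sum>z\<in>C. (c z - x \<bullet> \<nu> z) / (c z - z \<bullet> \<nu> z)) = 1"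
  "(\<Sum>z\<in>C. ((c z - x \<bullet> \<nu> z) / (c z - z \<bullet> \<nu> z)) *\<^sub>R z) = x"
proof -
  have "aff_dim C = int DIM('a)"
    using aff_dim_affine_independent[OF indep] cardC by simp
  then have "affine hull C = UNIV" by (simp add: aff_dim_eq_full)
  then obtain u where u: "sum u C = 1" "(\<Sum>w\<in>C. u w *\<^sub>R w) = x"
    using affine_hull_finite[OF finite_C] by auto
  have "(c z - x \<bullet> \<nu> z) / (c z - z \<bullet> \<nu> z) = u z" if z: "z \<in> C" for z
  proof -
    have "c z - x \<bullet> \<nu> z = (\<Sum>w\<in>C. u w * c z) - (\<Sum>w\<in>C. u w * (w \<bullet> \<nu> z))"
      using u by (simp add: sum_distrib_right[symmetric]) (simp add: u(2)[symmetric] inner_sum_left)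
    also have "\<dots> = (\<Sum>w\<in>C. u w * (c z - w \<bullet> \<nu> z))"
      by (simp add: sum_subtractf right_diff_distrib)
    also have "\<dots> = (\<Sum>w\<in>C. if w = z then u z * (c z - z \<bullet> \<nu> z) else 0)"
      using vertex_on_facet[OF z] by (intro sum.cong) auto
    also have "\<dots> = u z * (c z - z \<bullet> \<nu> z)" using z finite_C by simp
    finally show ?thesis using below[OF z] by simp
  qed
  then show "(\<Sum>z\<in>C. (c z - x \<bullet> \<nu> z) / (c z - z \<bullet> \<nu> z)) = 1"
    "(\<Sum>z\<in>C. ((c z - x \<bullet> \<nu> z) / (c z - z \<bullet> \<nu> z)) *\<^sub>R z) = x"
    using u by (simp_all cong: sum.cong)
qed

lemma bary_grad_diff:
  "z \<in> C \<Longrightarrow> bary_grad z \<bullet> e = (c z - 0 \<bullet> \<nu> z) / (c z - z \<bullet> \<nu> z) - (c z - e \<bullet> \<nu> z) / (c z - z \<bullet> \<nu> z)"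
  unfolding diff_divide_distrib[symmetric]
  by (simp add: bary_grad_def inner_commute divide_inverse mult.commute)

lemma bary_grad_sum: "(\<Sum>z\<in>C. bary_grad z \<bullet> e) = 0"
proof -
  have "(\<Sum>z\<in>C. bary_grad z \<bullet> e) = (\<Sum>z\<in>C. (c z - 0 \<bullet> \<nu> z) / (c z - z \<bullet> \<nu> z) - (c z - e \<bullet> \<nu> z) / (c z - z \<bullet> \<nu> z))"
    by (rule sum.cong[OF refl]) (rule bary_grad_diff)
  then show ?thesis unfolding sum_subtractf barycentric by simp
qed

text \<open>Hence every vector field is a sum of radial fields about the vertices, and a radial field about
  \<open>z\<close> has flux only through the facet opposite to \<open>z\<close>.\<close>

lemma radial_decomposition: "(\<Sum>z\<in>C. (bary_grad z \<bullet> e) *\<^sub>R (x - z)) = e"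
proof -
  have "(\<Sum>z\<in>C. (bary_grad z \<bullet> e) *\<^sub>R z) = (\<Sum>z\<in>C. ((c z - 0 \<bullet> \<nu> z) / (c z - z \<bullet> \<nu> z)) *\<^sub>R z - ((c z - e \<bullet> \<nu> z) / (c z - z \<bullet> \<nu> z)) *\<^sub>R z)"
    by (rule sum.cong[OF refl]) (simp only: bary_grad_diff scaleR_left_diff_distrib)
  then have "(\<Sum>z\<in>C. (bary_grad z \<bullet> e) *\<^sub>R z) = - e" unfolding sum_subtractf barycentric by simp
  moreover have "(\<Sum>z\<in>C. (bary_grad z \<bullet> e) *\<^sub>R x) = 0"
    using bary_grad_sum by (simp add: scaleR_sum_left[symmetric])
  ultimately show ?thesis by (simp add: scaleR_right_diff_distrib sum_subtractf)
qed

text \<open>By \<open>radial_decomposition\<close> the rank-one matrices built from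
  \<open>x - z\<close> and \<open>bary_grad z\<close> sum to the identity; this is the trace of that
  equation.\<close>

lemma radial_decomposition_trace: "(\<Sum>z\<in>C. bary_grad z \<bullet> (x - z)) = real DIM('a)"
proof -
  have "(\<Sum>z\<in>C. bary_grad z \<bullet> (x - z)) = (\<Sum>z\<in>C. \<Sum>e\<in>Basis. (bary_grad z \<bullet> e) * ((x - z) \<bullet> e))"
    by (subst euclidean_inner) simp
  also have "\<dots> = (\<Sum>e\<in>Basis. (\<Sum>z\<in>C. (bary_grad z \<bullet> e) *\<^sub>R (x - z)) \<bullet> e)"
    by (subst sum.swap) (simp add: inner_sum_left)
  also have "\<dots> = (\<Sum>e\<in>(Basis::'a set). 1)"
    unfolding radial_decomposition by (intro sum.cong) auto
  finally show ?thesis by simp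
qed

text \<open>Moving the vertex \<open>z\<close> to the origin makes the simplex the cone over the
  opposite facet, at height \<open>c z - z \<bullet> \<nu> z\<close>. The remaining work matches the
  two prisms and projections under this shift.\<close>

lemma facet_integral_radial:
  fixes h :: "'a \<Rightarrow> real"
  assumes z: "z \<in> C" and h: "\<And>x. (h has_derivative (\<lambda>e. D x \<bullet> e)) (at x)" and D: "continuous_on UNIV D"
  shows "(LINT x|lebesgue_on (convex hull C). real DIM('a) * h x + D x \<bullet> (x - z)) =
    (c z - z \<bullet> \<nu> z) * facet_integral (\<nu> z) (facet z) h"
proof -
  let ?n = "real DIM('a)" and ?d = "c z - z \<bullet> \<nu> z"
  note \<nu>1 = norm_\<nu>[OF z]
  have ch: "continuous_on UNIV h" using h by (rule continuous_of_derivative)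
  have cT: "compact (convex hull C)" and cF: "compact (facet z)"
    using finite_C by (auto intro!: finite_imp_compact_convex_hull)
  define F where "F = (\<lambda>x. x - z) ` facet z"
  define T where "T = (\<lambda>x. x - z) ` (convex hull C)"
  define Q where "Q = {x + t *\<^sub>R \<nu> z |x t. x \<in> facet z \<and> 0 \<le> t \<and> t \<le> 1}"
  have "Q = (\<lambda>(x, t). x + t *\<^sub>R \<nu> z) ` (facet z \<times> {0..1})" by (fastforce simp: Q_def)
  then have "compact Q"
    using cF by (simp add: split_def) (intro compact_continuous_image compact_Times continuous_intros; simp)
  then have [measurable]: "Q \<in> sets borel" by (rule borel_compact)
  have [measurable]: "convex hull C \<in> sets borel" using cT by (rule borel_compact)
  have [measurable]: "h \<in> borel_measurable borel" "D \<in> borel_measurable borel"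
    using ch D by (auto intro: borel_measurable_continuous_onI)
  have "T = {s *\<^sub>R x | s x. 0 \<le> s \<and> s \<le> 1 \<and> x \<in> F}"
  proof -
    have "convex hull C = convex hull (insert z (C - {z}))" using z by (simp add: insert_absorb)
    also have "\<dots> = {(1 - u) *\<^sub>R z + u *\<^sub>R x |x u. 0 \<le> u \<and> u \<le> 1 \<and> x \<in> facet z}"
      using facet_nonempty[OF z] by (simp only: convex_hull_insert_alt if_False)
    finally have *: "convex hull C = {(1 - u) *\<^sub>R z + u *\<^sub>R x |x u. 0 \<le> u \<and> u \<le> 1 \<and> x \<in> facet z}" .
    have shift: "(1 - u) *\<^sub>R z + u *\<^sub>R x - z = u *\<^sub>R (x - z)" for u x by (simp add: algebra_simps)
    show ?thesis unfolding T_def F_def *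
    proof (intro set_eqI iffI)
      fix y assume "y \<in> (\<lambda>x. x - z) ` {(1 - u) *\<^sub>R z + u *\<^sub>R x |x u. 0 \<le> u \<and> u \<le> 1 \<and> x \<in> facet z}"
      then obtain x u where "y = u *\<^sub>R (x - z)" "0 \<le> u" "u \<le> 1" "x \<in> facet z" using shift by auto
      then show "y \<in> {s *\<^sub>R x |s x. 0 \<le> s \<and> s \<le> 1 \<and> x \<in> (\<lambda>x. x - z) ` facet z}" by blast
    next
      fix y assume "y \<in> {s *\<^sub>R x |s x. 0 \<le> s \<and> s \<le> 1 \<and> x \<in> (\<lambda>x. x - z) ` facet z}"
      then obtain x u where "y = u *\<^sub>R (x - z)" "0 \<le> u" "u \<le> 1" "x \<in> facet z" by auto
      then show "y \<in> (\<lambda>x. x - z) ` {(1 - u) *\<^sub>R z + u *\<^sub>R x |x u. 0 \<le> u \<and> u \<le> 1 \<and> x \<in> facet z}"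
        by (intro image_eqI[of _ _ "(1 - u) *\<^sub>R z + u *\<^sub>R x"]) (auto simp: shift)
    qed
  qed
  moreover have "x \<bullet> \<nu> z = ?d" if "x \<in> F" for x
    using that facet_plane[OF z] by (auto simp: F_def inner_diff_left)
  moreover have "compact F" unfolding F_def using cF by (intro compact_continuous_image continuous_intros)
  moreover have "((\<lambda>x. h (x + z)) has_derivative (\<lambda>e. D (x + z) \<bullet> e)) (at x)" for x
  proof -
    have "((\<lambda>x. x + z) has_derivative (\<lambda>e. e)) (at x)" by (auto intro!: derivative_eq_intros)
    from has_derivative_compose[OF this h] show ?thesis .
  qed
  moreover have "continuous_on UNIV (\<lambda>x. D (x + z))"
    by (intro continuous_on_compose2[OF D] continuous_intros) auto
  ultimately have cone: "(LINT x|lborel. indicator T x * (?n * h (x + z) + D (x + z) \<bullet> x)) =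
    ?d * (LINT y|lborel. indicator {x + t *\<^sub>R \<nu> z |x t. x \<in> F \<and> 0 \<le> t \<and> t \<le> 1} y * h (orth_proj (\<nu> z) y + ?d *\<^sub>R \<nu> z + z))"
    using integral_cone_radial_divergence[OF \<nu>1, of ?d F T "\<lambda>x. h (x + z)" "\<lambda>x. D (x + z)"] below[OF z] by simp
  have "(LINT x|lebesgue_on (convex hull C). ?n * h x + D x \<bullet> (x - z)) =
      (LINT x|lborel. indicator (convex hull C) x * (?n * h x + D x \<bullet> (x - z)))"
    by (rule integral_lebesgue_on_borel) measurable
  also have "\<dots> = (LINT x|lborel. indicator (convex hull C) (x + z) * (?n * h (x + z) + D (x + z) \<bullet> ((x + z) - z)))"
    by (rule integral_translation[symmetric]) measurable
  also have "\<dots> = (LINT x|lborel. indicator T x * (?n * h (x + z) + D (x + z) \<bullet> x))"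
  proof (rule Bochner_Integration.integral_cong[OF refl])
    fix x
    have "x + z \<in> convex hull C \<longleftrightarrow> x \<in> T" unfolding T_def by (auto intro: image_eqI[of _ _ "x + z"])
    then show "indicator (convex hull C) (x + z) * (?n * h (x + z) + D (x + z) \<bullet> ((x + z) - z)) = indicator T x * (?n * h (x + z) + D (x + z) \<bullet> x)"
      by (simp add: indicator_def)
  qed
  also note cone
  also have "(LINT y|lborel. indicator {x + t *\<^sub>R \<nu> z |x t. x \<in> F \<and> 0 \<le> t \<and> t \<le> 1} y * h (orth_proj (\<nu> z) y + ?d *\<^sub>R \<nu> z + z)) =
      (LINT y|lborel. indicator Q (y + z) * h ((y + z) + (c z - (y + z) \<bullet> \<nu> z) *\<^sub>R \<nu> z))"
  proof (rule Bochner_Integration.integral_cong[OF refl])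
    fix y
    have A: "y + z \<in> Q \<longleftrightarrow> y \<in> {x + t *\<^sub>R \<nu> z |x t. x \<in> F \<and> 0 \<le> t \<and> t \<le> 1}"
    proof
      assume "y + z \<in> Q"
      then obtain x t where "y + z = x + t *\<^sub>R \<nu> z" "x \<in> facet z" "0 \<le> t" "t \<le> 1" by (auto simp: Q_def)
      then have "y = (x - z) + t *\<^sub>R \<nu> z" "x - z \<in> F" "0 \<le> t" "t \<le> 1" by (auto simp: F_def algebra_simps)
      then show "y \<in> {x + t *\<^sub>R \<nu> z |x t. x \<in> F \<and> 0 \<le> t \<and> t \<le> 1}" by blast
    next
      assume "y \<in> {x + t *\<^sub>R \<nu> z |x t. x \<in> F \<and> 0 \<le> t \<and> t \<le> 1}"
      then obtain x t where "y = (x - z) + t *\<^sub>R \<nu> z" "x \<in> facet z" "0 \<le> t" "t \<le> 1" by (auto simp: F_def)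
      then have "y + z = x + t *\<^sub>R \<nu> z" "x \<in> facet z" "0 \<le> t" "t \<le> 1" by auto
      then show "y + z \<in> Q" unfolding Q_def by blast
    qed
    have B: "orth_proj (\<nu> z) y + ?d *\<^sub>R \<nu> z + z = (y + z) + (c z - (y + z) \<bullet> \<nu> z) *\<^sub>R \<nu> z"
      by (simp add: orth_proj_def inner_add_left algebra_simps)
    show "indicator {x + t *\<^sub>R \<nu> z |x t. x \<in> F \<and> 0 \<le> t \<and> t \<le> 1} y * h (orth_proj (\<nu> z) y + ?d *\<^sub>R \<nu> z + z) =
      indicator Q (y + z) * h ((y + z) + (c z - (y + z) \<bullet> \<nu> z) *\<^sub>R \<nu> z)"
      by (simp only: indicator_def A B)
  qed
  also have "\<dots> = (LINT y|lborel. indicator Q y * h (y + (c z - y \<bullet> \<nu> z) *\<^sub>R \<nu> z))"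
    by (rule integral_translation[of "\<lambda>y. indicator Q y * h (y + (c z - y \<bullet> \<nu> z) *\<^sub>R \<nu> z)"]) measurable
  also have "\<dots> = (LINT y|lebesgue_on Q. h (y + (c z - y \<bullet> \<nu> z) *\<^sub>R \<nu> z))"
    by (rule integral_lebesgue_on_borel[symmetric]) measurable
  also have "\<dots> = facet_integral (\<nu> z) (facet z) h"
    unfolding facet_integral_def Q_def affine_hull_facet[OF z] closest_point_hyperplane[OF \<nu>1] ..
  finally show ?thesis .
qed

text \<open>The field \<open>v x *\<^sub>R q x\<close> is the sum over \<open>z\<close> of
  \<open>h z x *\<^sub>R (x - z)\<close>. Each summand has flux through its own facet only, where
  the height of the simplex cancels the denominator in \<open>bary_grad\<close> and leaves
  \<open>(q x \<bullet> \<nu> z) * v x\<close>. The divergences add up to that of the field, because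
  the \<open>bary_grad\<close> sum to zero and the trace above equals the dimension.\<close>

lemma divergence_theorem_affine:
  fixes A m \<beta> :: 'a and b \<alpha> :: real
  defines "q \<equiv> \<lambda>x. A + b *\<^sub>R (x - m)" and "v \<equiv> \<lambda>x. \<alpha> + \<beta> \<bullet> x"
  shows "(\<Sum>z\<in>C. facet_integral (\<nu> z) (facet z) (\<lambda>x. (q x \<bullet> \<nu> z) * v x)) =
    (LINT x|lebesgue_on (convex hull C). q x \<bullet> \<beta> + real DIM('a) * b * v x)"
proof -
  let ?n = "real DIM('a)"
  define h where "h = (\<lambda>z x. (bary_grad z \<bullet> q x) * v x)"
  define D where "D = (\<lambda>z x. (b * v x) *\<^sub>R bary_grad z + (bary_grad z \<bullet> q x) *\<^sub>R \<beta>)"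
  have cqv: "continuous_on S q" "continuous_on S v" for S
    unfolding q_def v_def by (intro continuous_intros)+
  have h: "(h z has_derivative (\<lambda>e. D z x \<bullet> e)) (at x)" for z x
    unfolding h_def D_def q_def v_def
    by (auto intro!: derivative_eq_intros simp: fun_eq_iff inner_add_left inner_add_right inner_diff_right algebra_simps)
  have D: "continuous_on UNIV (D z)" for z
    unfolding D_def by (intro continuous_intros cqv)
  have ch: "continuous_on UNIV (h z)" for z using h by (rule continuous_of_derivative)
  have cT: "compact (convex hull C)" using finite_C by (rule finite_imp_compact_convex_hull)
  have int: "integrable (lebesgue_on (convex hull C)) (\<lambda>x. ?n * h z x + D z x \<bullet> (x - z))" for z
  proof (rule L2_integrable)
    show "bounded (convex hull C)" "convex hull C \<in> sets lebesgue"
      using cT by (auto intro: compact_imp_bounded lmeasurable_compact fmeasurableD)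
    then show "(\<lambda>x. ?n * h z x + D z x \<bullet> (x - z)) \<in> L2 (convex hull C)"
      using ch D by (intro L2_continuous continuous_intros) auto
  qed
  have pt: "(\<Sum>z\<in>C. ?n * h z x + D z x \<bullet> (x - z)) = q x \<bullet> \<beta> + ?n * b * v x" for x
  proof -
    have "(\<Sum>z\<in>C. ?n * h z x) = ?n * v x * (\<Sum>z\<in>C. bary_grad z \<bullet> q x)"
      by (simp add: h_def sum_distrib_left ac_simps)
    also have "\<dots> = 0" by (simp add: bary_grad_sum)
    moreover have "(\<Sum>z\<in>C. D z x \<bullet> (x - z)) =
        (\<Sum>z\<in>C. b * v x * (bary_grad z \<bullet> (x - z)) + ((bary_grad z \<bullet> q x) *\<^sub>R (x - z)) \<bullet> \<beta>)"
      by (rule sum.cong[OF refl]) (simp add: D_def inner_add_left inner_commute[of \<beta>])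
    moreover have "\<dots> = b * v x * (\<Sum>z\<in>C. bary_grad z \<bullet> (x - z)) + (\<Sum>z\<in>C. (bary_grad z \<bullet> q x) *\<^sub>R (x - z)) \<bullet> \<beta>"
      by (simp add: sum.distrib sum_distrib_left inner_sum_left)
    moreover have "\<dots> = b * v x * ?n + q x \<bullet> \<beta>"
      by (simp only: radial_decomposition radial_decomposition_trace)
    ultimately show ?thesis by (simp add: sum.distrib)
  qed
  have "(\<Sum>z\<in>C. facet_integral (\<nu> z) (facet z) (\<lambda>x. (q x \<bullet> \<nu> z) * v x)) =
      (\<Sum>z\<in>C. (LINT x|lebesgue_on (convex hull C). ?n * h z x + D z x \<bullet> (x - z)))"
  proof (rule sum.cong[OF refl])
    fix z assume z: "z \<in> C"
    have "(\<lambda>x. (q x \<bullet> \<nu> z) * v x) = (\<lambda>x. (c z - z \<bullet> \<nu> z) * h z x)"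
      using below[OF z] by (simp add: h_def bary_grad_def fun_eq_iff inner_commute)
    then have "facet_integral (\<nu> z) (facet z) (\<lambda>x. (q x \<bullet> \<nu> z) * v x) = (c z - z \<bullet> \<nu> z) * facet_integral (\<nu> z) (facet z) (h z)"
      by (simp add: facet_integral_def)
    then show "facet_integral (\<nu> z) (facet z) (\<lambda>x. (q x \<bullet> \<nu> z) * v x) =
        (LINT x|lebesgue_on (convex hull C). ?n * h z x + D z x \<bullet> (x - z))"
      using facet_integral_radial[OF z h D] by simp
  qed
  also have "\<dots> = (LINT x|lebesgue_on (convex hull C). q x \<bullet> \<beta> + ?n * b * v x)"
    unfolding pt[symmetric] by (rule Bochner_Integration.integral_sum[symmetric]) (rule int)
  finally show ?thesis .
qed

text \<open>For uniqueness, let \<open>\<mu>\<close> be constant on the facet and decompose an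
  arbitrary vector radially, based at a vertex \<open>x\<close> of the facet. Of the products
  \<open>\<mu> \<bullet> (x - w)\<close> only the one with \<open>w = z\<close> survives, so
  \<open>\<mu>\<close> is a multiple of \<open>\<nu> z\<close>; the half-space condition makes the
  factor nonnegative and normalization makes it 1.\<close>

lemma outer_normal_facet:
  assumes z: "z \<in> C"
  shows "outer_normal (convex hull C) (facet z) = \<nu> z"
  unfolding outer_normal_def
proof (rule the_equality)
  have "C \<subseteq> {x. \<nu> z \<bullet> x \<le> c z}"
  proof
    fix w assume "w \<in> C"
    then show "w \<in> {x. \<nu> z \<bullet> x \<le> c z}"
      using vertex_on_facet[OF z, of w] below[OF z] by (cases "w = z") (auto simp: inner_commute)
  qed
  then have "convex hull C \<subseteq> {x. \<nu> z \<bullet> x \<le> c z}"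
    by (rule hull_minimal) (rule convex_halfspace_le)
  moreover have "facet z \<subseteq> {x. \<nu> z \<bullet> x = c z}"
    using facet_plane[OF z] by (auto simp: inner_commute)
  ultimately show "norm (\<nu> z) = 1 \<and> (\<exists>s. convex hull C \<subseteq> {x. \<nu> z \<bullet> x \<le> s} \<and> facet z \<subseteq> {x. \<nu> z \<bullet> x = s})"
    using norm_\<nu>[OF z] by blast
next
  fix \<mu> assume "norm \<mu> = 1 \<and> (\<exists>s. convex hull C \<subseteq> {x. \<mu> \<bullet> x \<le> s} \<and> facet z \<subseteq> {x. \<mu> \<bullet> x = s})"
  then obtain s where \<mu>: "norm \<mu> = 1" "convex hull C \<subseteq> {x. \<mu> \<bullet> x \<le> s}" "facet z \<subseteq> {x. \<mu> \<bullet> x = s}" by auto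
  obtain x where x: "x \<in> C - {z}" using facet_nonempty[OF z] by auto
  have on: "\<mu> \<bullet> w = s" if "w \<in> C" "w \<noteq> z" for w
    using \<mu>(3) that hull_subset[of "C - {z}" convex] by auto
  have le: "\<mu> \<bullet> z \<le> s" using \<mu>(2) z hull_subset[of C convex] by auto
  define r where "r = (s - \<mu> \<bullet> z) / (c z - z \<bullet> \<nu> z)"
  have "\<mu> \<bullet> e = r * (\<nu> z \<bullet> e)" for e
  proof -
    have "\<mu> \<bullet> e = \<mu> \<bullet> (\<Sum>w\<in>C. (bary_grad w \<bullet> e) *\<^sub>R (x - w))" by (simp only: radial_decomposition)
    also have "\<dots> = (\<Sum>w\<in>C. if w = z then (bary_grad z \<bullet> e) * (s - \<mu> \<bullet> z) else 0)"
      unfolding inner_sum_right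
      by (rule sum.cong[OF refl]) (use on x in \<open>auto simp: inner_diff_right\<close>)
    also have "\<dots> = (bary_grad z \<bullet> e) * (s - \<mu> \<bullet> z)" using z finite_C by simp
    finally show ?thesis by (simp add: bary_grad_def r_def divide_inverse)
  qed
  then have "\<mu> = r *\<^sub>R \<nu> z" by (metis inner_scaleR_left vector_eq_rdot)
  moreover have "0 \<le> r" using le below[OF z] by (simp add: r_def)
  ultimately show "\<mu> = \<nu> z" using \<mu>(1) norm_\<nu>[OF z] by simp
qed

lemma boundary_integral_simplex:
  "boundary_integral (convex hull C) g = (\<Sum>z\<in>C. facet_integral (\<nu> z) (facet z) (\<lambda>x. g x (\<nu> z)))"
proof -
  have "inj_on facet C"
  proof (rule inj_onI, rule ccontr)
    fix z w assume zw: "z \<in> C" "w \<in> C" "facet z = facet w" "z \<noteq> w"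
    then have "z \<in> facet w" using hull_subset[of "C - {w}" convex] by auto
    then have "z \<bullet> \<nu> z = c z" using zw(3) facet_plane[OF zw(1)] by auto
    with below[OF zw(1)] show False by simp
  qed
  moreover have "{F. F facet_of convex hull C} = facet ` C"
    using facet_of_convex_hull_affine_independent[OF indep] facet_nonempty by fastforce
  ultimately show ?thesis
    unfolding boundary_integral_def by (simp add: sum.reindex outer_normal_facet)
qed

end

section \<open>Traces\<close>

text \<open>Means of a continuous function over small sets around \<open>x\<close> tend to its value
  at \<open>x\<close>, at every point of \<open>T\<close>. Replacing \<open>v\<close> by
  \<open>g\<close> does not change the means, since they agree almost everywhere on
  \<open>T\<close>.\<close>

lemma bdry_trace_continuous:
  fixes g :: "'a::euclidean_space \<Rightarrow> 'b::euclidean_space"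
  assumes T: "convex T" "compact T" "interior T \<noteq> {}" and x: "x \<in> T"
    and g: "continuous_on UNIV g" and ae: "AE y in lebesgue_on T. v y = g y"
  shows "bdry_trace T v x = g x"
proof -
  have [simp]: "T \<in> sets lebesgue" using T(2) by (auto intro: lmeasurable_compact fmeasurableD)
  let ?M = "\<lambda>r. lebesgue_on (ball x r \<inter> T)"
  let ?\<mu> = "\<lambda>r. measure lebesgue (ball x r \<inter> T)"
  have "((\<lambda>r. (LINT y|?M r. v y) /\<^sub>R ?\<mu> r) \<longlongrightarrow> g x) (at_right 0)"
  proof (rule tendstoI)
    fix e :: real assume "0 < e"
    then obtain d where d: "0 < d" "\<And>y. dist y x < d \<Longrightarrow> dist (g y) (g x) < e / 2"
      using g by (metis UNIV_I continuous_on_iff half_gt_zero)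
    have "dist ((LINT y|?M r. v y) /\<^sub>R ?\<mu> r) (g x) < e" if r: "0 < r" "r < d" for r
    proof -
      let ?B = "ball x r \<inter> T"
      have B: "?B \<in> sets lebesgue" "bounded ?B" by (auto intro: bounded_Int)
      have lm: "?B \<in> lmeasurable" using B by (rule bounded_set_imp_lmeasurable[rotated])
      \<comment> \<open>The means need a positive denominator also at vertices. A convex set with
        interior points is contained in the closure of its interior, so every ball about
        \<open>x\<close> contains an open piece of \<open>T\<close>.\<close>
      have pos: "0 < ?\<mu> r"
      proof -
        have "x \<in> closure (interior T)"
          using T x convex_closure_interior[of T] closure_subset by blast
        then have "ball x r \<inter> interior T \<noteq> {}"
          using r(1) by (metis centre_in_ball disjoint_iff open_ball open_Int_closure_eq_empty Int_commute)
        moreover have "open (ball x r \<inter> interior T)" by blast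
        ultimately have "\<not> negligible (ball x r \<inter> interior T)" using open_not_negligible by blast
        moreover have "ball x r \<inter> interior T \<subseteq> ?B" using interior_subset by blast
        ultimately have "\<not> negligible ?B" using negligible_subset by blast
        then show ?thesis
          using lm by (metis measure_nonneg negligible_iff_measure order_le_less)
      qed
      have "emeasure lebesgue ?B < \<infinity>"
        using lm by (metis fmeasurableD2 infinity_ennreal_def less_top)
      then interpret finite_measure "?M r"
        using B by (intro finite_measureI) (simp add: emeasure_restrict_space less_top)
      have gM: "g \<in> borel_measurable (?M r)"
        using g B(1) by (intro continuous_imp_measurable_on_sets_lebesgue) (auto intro: continuous_on_subset)
      have ae': "AE y in ?M r. g y = v y"
        using AE_lebesgue_on_subset[OF ae _ B(1)] by (auto elim!: eventually_mono)
      have vM: "v \<in> borel_measurable (?M r)"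
        by (rule borel_measurable_lebesgue_on_cong_AE[OF gM B(1) ae'])
      have bound: "norm (g y - g x) \<le> e / 2" if "y \<in> ?B" for y
      proof -
        have "dist y x < d" using that r by (simp add: dist_commute)
        from d(2)[OF this] show ?thesis by (simp add: dist_norm)
      qed
      have gint: "integrable (?M r) (\<lambda>y. g y - g x)"
        by (rule integrable_const_bound[of _ "e / 2"]) (use gM bound in \<open>auto intro!: AE_I2\<close>)
      have meas: "measure (?M r) (space (?M r)) = ?\<mu> r"
        using B(1) by (simp add: measure_restrict_space)
      have "(LINT y|?M r. v y) = (LINT y|?M r. g y)"
        using gM vM ae' by (intro integral_cong_AE) (auto elim!: eventually_mono)
      also have "\<dots> = (LINT y|?M r. (g y - g x) + g x)" by simp
      also have "\<dots> = (LINT y|?M r. g y - g x) + ?\<mu> r *\<^sub>R g x"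
        using gint meas by (subst Bochner_Integration.integral_add) auto
      finally have "(LINT y|?M r. v y) /\<^sub>R ?\<mu> r - g x = (LINT y|?M r. g y - g x) /\<^sub>R ?\<mu> r"
        using pos by (simp add: scaleR_add_right)
      moreover have "norm (LINT y|?M r. g y - g x) \<le> e / 2 * ?\<mu> r"
      proof -
        have "norm (LINT y|?M r. g y - g x) \<le> (LINT y|?M r. norm (g y - g x))"
          by (rule integral_norm_bound)
        also have "\<dots> \<le> (LINT y|?M r. e / 2)"
          by (rule integral_mono) (use gint bound in auto)
        finally show ?thesis using meas by (simp add: mult.commute)
      qed
      ultimately have "dist ((LINT y|?M r. v y) /\<^sub>R ?\<mu> r) (g x) \<le> e / 2"
        using pos by (simp add: dist_norm field_simps)
      then show ?thesis using \<open>0 < e\<close> by simp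
    qed
    then show "\<forall>\<^sub>F r in at_right 0. dist ((LINT y|?M r. v y) /\<^sub>R ?\<mu> r) (g x) < e"
      using d(1) by (auto simp: eventually_at_right_field)
  qed
  then show ?thesis
    unfolding bdry_trace_def by (rule tendsto_Lim[rotated]) simp
qed

section \<open>Polynomials of degree at most one\<close>

text \<open>Written as a restricted function because the index set in \<open>poly_deg_le\<close> is
  an extensional product: its members are \<open>undefined\<close> off \<open>Basis\<close>.\<close>

definition zero_index :: "'a::euclidean_space \<Rightarrow> nat" where
  "zero_index = (\<lambda>j\<in>Basis. 0)"

definition unit_index :: "'a::euclidean_space \<Rightarrow> 'a \<Rightarrow> nat" where
  "unit_index i = (\<lambda>j\<in>Basis. if j = i then 1 else 0)"

lemma indices_deg_0:
  "{\<alpha>. \<alpha> \<in> Basis \<rightarrow>\<^sub>E {..0::nat} \<and> (\<Sum>i\<in>(Basis::'a::euclidean_space set). \<alpha> i) \<le> 0} = {zero_index}"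
  by (auto simp: zero_index_def PiE_def extensional_def fun_eq_iff)

lemma indices_deg_1:
  "{\<alpha>. \<alpha> \<in> Basis \<rightarrow>\<^sub>E {..1::nat} \<and> (\<Sum>i\<in>(Basis::'a::euclidean_space set). \<alpha> i) \<le> 1} =
    insert zero_index (unit_index ` Basis)" (is "?I = _")
proof (intro set_eqI iffI)
  fix \<alpha> :: "'a \<Rightarrow> nat" assume "\<alpha> \<in> ?I"
  then have ext: "\<And>j. j \<notin> Basis \<Longrightarrow> \<alpha> j = undefined" and sum: "(\<Sum>i\<in>Basis. \<alpha> i) \<le> 1"
    by (auto simp: PiE_def extensional_def)
  show "\<alpha> \<in> insert zero_index (unit_index ` Basis)"
  proof (cases "\<forall>i\<in>Basis. \<alpha> i = 0")
    case True
    then have "\<alpha> = zero_index" using ext by (auto simp: zero_index_def fun_eq_iff)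
    then show ?thesis by simp
  next
    case False
    then obtain i where i: "i \<in> Basis" "\<alpha> i \<noteq> 0" by auto
    then have "\<alpha> i + (\<Sum>j\<in>Basis - {i}. \<alpha> j) \<le> 1"
      using sum by (simp add: sum.remove)
    then have "\<alpha> i = 1" "(\<Sum>j\<in>Basis - {i}. \<alpha> j) = 0" using i(2) by linarith+
    then have "\<alpha> = unit_index i" using ext by (auto simp: unit_index_def fun_eq_iff)
    then show ?thesis using i by simp
  qed
next
  fix \<alpha> :: "'a \<Rightarrow> nat" assume "\<alpha> \<in> insert zero_index (unit_index ` Basis)"
  then show "\<alpha> \<in> ?I"
    by (auto simp: zero_index_def unit_index_def PiE_def Pi_def sum.If_cases Int_def)
qed

lemma poly_deg_le_0_iff: "poly_deg_le 0 p \<longleftrightarrow> (\<exists>a. \<forall>x. p x = a)"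
proof -
  have "(\<Prod>i\<in>Basis. (x \<bullet> i) ^ zero_index i) = 1" for x :: 'a by (simp add: zero_index_def)
  then show ?thesis
    unfolding poly_deg_le_def indices_deg_0 by (auto intro: exI[of _ "\<lambda>_. _"])
qed

lemma poly_deg_le_1_iff: "poly_deg_le 1 p \<longleftrightarrow> (\<exists>a b. \<forall>x. p x = a + b \<bullet> x)"
proof -
  have m0: "(\<Prod>i\<in>Basis. (x \<bullet> i) ^ zero_index i) = 1" for x :: 'a by (simp add: zero_index_def)
  have m1: "(\<Prod>j\<in>Basis. (x \<bullet> j) ^ unit_index i j) = x \<bullet> i" if "i \<in> Basis" for x i :: 'a
  proof -
    have "(\<Prod>j\<in>Basis. (x \<bullet> j) ^ unit_index i j) = (\<Prod>j\<in>Basis. if j = i then x \<bullet> i else 1)"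
      by (rule prod.cong) (auto simp: unit_index_def)
    then show ?thesis using that by simp
  qed
  have inj: "inj_on unit_index (Basis :: 'a set)"
  proof (rule inj_onI)
    fix i j :: 'a assume "i \<in> Basis" "j \<in> Basis" "unit_index i = unit_index j"
    from this(3) have "unit_index i i = unit_index j i" by simp
    then show "i = j" using \<open>i \<in> Basis\<close> by (simp add: unit_index_def split: if_splits)
  qed
  have ne: "zero_index \<noteq> unit_index i" if "i \<in> Basis" for i :: 'a
  proof
    assume "zero_index = unit_index i"
    then have "zero_index i = unit_index i i" by simp
    with that show False by (simp add: zero_index_def unit_index_def)
  qed
  have sum_eq: "(\<Sum>\<alpha> | \<alpha> \<in> Basis \<rightarrow>\<^sub>E {..1} \<and> (\<Sum>i\<in>Basis. \<alpha> i) \<le> 1. c \<alpha> * (\<Prod>i\<in>Basis. (x \<bullet> i) ^ \<alpha> i)) =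
      c zero_index + (\<Sum>i\<in>Basis. c (unit_index i) * (x \<bullet> i))" for c and x :: 'a
    unfolding indices_deg_1 using ne m1
    by (subst sum.insert) (auto simp: sum.reindex[OF inj] m0)
  show ?thesis unfolding poly_deg_le_def sum_eq
  proof
    assume "\<exists>c. \<forall>x. p x = c zero_index + (\<Sum>i\<in>Basis. c (unit_index i) * (x \<bullet> i))"
    then obtain c where c: "\<And>x. p x = c zero_index + (\<Sum>i\<in>Basis. c (unit_index i) * (x \<bullet> i))" by auto
    show "\<exists>a b. \<forall>x. p x = a + b \<bullet> x"
    proof (intro exI allI)
      fix x
      show "p x = c zero_index + (\<Sum>i\<in>Basis. c (unit_index i) *\<^sub>R i) \<bullet> x"
        by (simp add: c inner_sum_left inner_commute[of x])
    qed
  next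
    assume "\<exists>a b. \<forall>x. p x = a + b \<bullet> x"
    then obtain a b where ab: "\<And>x. p x = a + b \<bullet> x" by auto
    define c where "c = (\<lambda>\<alpha>. if \<alpha> = zero_index then a else \<Sum>j\<in>Basis. real (\<alpha> j) * (b \<bullet> j))"
    have "c (unit_index i) = b \<bullet> i" if "i \<in> Basis" for i
    proof -
      have "(\<Sum>j\<in>Basis. real (unit_index i j) * (b \<bullet> j)) = (\<Sum>j\<in>Basis. if j = i then b \<bullet> i else 0)"
        by (rule sum.cong) (auto simp: unit_index_def)
      then show ?thesis using ne[OF that] that by (simp add: c_def)
    qed
    then have "a + b \<bullet> x = c zero_index + (\<Sum>i\<in>Basis. c (unit_index i) * (x \<bullet> i))" for x
      using euclidean_inner[of b x] by (simp add: c_def)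
    then show "\<exists>c. \<forall>x. p x = c zero_index + (\<Sum>i\<in>Basis. c (unit_index i) * (x \<bullet> i))"
      using ab by auto
  qed
qed

lemma Pk_0_iff: "v \<in> Pk 0 \<T> \<longleftrightarrow> (\<exists>a. \<forall>T\<in>\<T>. AE x in lebesgue_on T. v x = a T)"
proof -
  have "(\<exists>p. poly_deg_le 0 p \<and> (AE x in lebesgue_on T. v x = p x)) \<longleftrightarrow> (\<exists>a. AE x in lebesgue_on T. v x = a)" for T
  proof
    assume "\<exists>p. poly_deg_le 0 p \<and> (AE x in lebesgue_on T. v x = p x)"
    then obtain p a where "\<forall>x. p x = a" "AE x in lebesgue_on T. v x = p x"
      unfolding poly_deg_le_0_iff by blast
    then have "AE x in lebesgue_on T. v x = a" by simp
    then show "\<exists>a. AE x in lebesgue_on T. v x = a" by blast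
  next
    assume "\<exists>a. AE x in lebesgue_on T. v x = a"
    then obtain a where "AE x in lebesgue_on T. v x = a" by blast
    then show "\<exists>p. poly_deg_le 0 p \<and> (AE x in lebesgue_on T. v x = p x)"
      unfolding poly_deg_le_0_iff by (intro exI[of _ "\<lambda>x. a"]) simp
  qed
  then have "v \<in> Pk 0 \<T> \<longleftrightarrow> (\<forall>T\<in>\<T>. \<exists>a. AE x in lebesgue_on T. v x = a)"
    by (simp add: Pk_def)
  also have "\<dots> \<longleftrightarrow> (\<exists>a. \<forall>T\<in>\<T>. AE x in lebesgue_on T. v x = a T)" by (rule bchoice_iff)
  finally show ?thesis .
qed

lemma Pk_1_iff: "v \<in> Pk 1 \<T> \<longleftrightarrow> (\<exists>a b. \<forall>T\<in>\<T>. AE x in lebesgue_on T. v x = a T + b T \<bullet> x)"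
proof -
  have "(\<exists>p. poly_deg_le 1 p \<and> (AE x in lebesgue_on T. v x = p x)) \<longleftrightarrow>
      (\<exists>a b. AE x in lebesgue_on T. v x = a + b \<bullet> x)" for T
  proof
    assume "\<exists>p. poly_deg_le 1 p \<and> (AE x in lebesgue_on T. v x = p x)"
    then obtain p a b where "\<forall>x. p x = a + b \<bullet> x" "AE x in lebesgue_on T. v x = p x"
      unfolding poly_deg_le_1_iff by blast
    then have "AE x in lebesgue_on T. v x = a + b \<bullet> x" by simp
    then show "\<exists>a b. AE x in lebesgue_on T. v x = a + b \<bullet> x" by blast
  next
    assume "\<exists>a b. AE x in lebesgue_on T. v x = a + b \<bullet> x"
    then obtain a b where "AE x in lebesgue_on T. v x = a + b \<bullet> x" by blast
    then show "\<exists>p. poly_deg_le 1 p \<and> (AE x in lebesgue_on T. v x = p x)"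
      unfolding poly_deg_le_1_iff by (intro exI[of _ "\<lambda>x. a + b \<bullet> x"]) auto
  qed
  then have "v \<in> Pk 1 \<T> \<longleftrightarrow> (\<forall>T\<in>\<T>. \<exists>a b. AE x in lebesgue_on T. v x = a + b \<bullet> x)"
    by (simp add: Pk_def)
  also have "\<dots> \<longleftrightarrow> (\<exists>a. \<forall>T\<in>\<T>. \<exists>b. AE x in lebesgue_on T. v x = a T + b \<bullet> x)" by (rule bchoice_iff)
  also have "\<dots> \<longleftrightarrow> (\<exists>a b. \<forall>T\<in>\<T>. AE x in lebesgue_on T. v x = a T + b T \<bullet> x)"
    by (simp only: bchoice_iff)
  finally show ?thesis .
qed

section \<open>Triangulated domains\<close>

text \<open>A Lipschitz domain lies on one side of its boundary, so it has no slits. At a point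
  \<open>z\<close> off \<Omega> but interior to its closure, a small step in direction
  \<open>- e\<close> would reach a point of the closure that is strictly below the graph.\<close>

lemma interior_closure_lipschitz_domain:
  fixes \<Omega> :: "'a::euclidean_space set"
  assumes "bounded_lipschitz_domain \<Omega>"
  shows "interior (closure \<Omega>) = \<Omega>"
proof
  have op: "open \<Omega>" using assms by (simp add: bounded_lipschitz_domain_def)
  then show "\<Omega> \<subseteq> interior (closure \<Omega>)" by (simp add: closure_subset interior_maximal)
  show "interior (closure \<Omega>) \<subseteq> \<Omega>"
  proof
    fix z assume z: "z \<in> interior (closure \<Omega>)"
    show "z \<in> \<Omega>"
    proof (rule ccontr)
      assume nz: "z \<notin> \<Omega>"
      then have zf: "z \<in> frontier \<Omega>"
        using z op interior_subset by (auto simp: frontier_def interior_open)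
      obtain U e L \<psi> where U: "open U" "z \<in> U" "norm e = 1" "L-lipschitz_on {y. y \<bullet> e = 0} \<psi>"
        "\<Omega> \<inter> U = {y \<in> U. \<psi> (y - (y \<bullet> e) *\<^sub>R e) < y \<bullet> e}"
        using bspec[OF conjunct2[OF conjunct2[OF conjunct2[OF conjunct2[OF assms[unfolded bounded_lipschitz_domain_def]]]]] zf]
        by (elim exE conjE) rule
      have ee: "e \<bullet> e = 1" using U(3) by (simp add: norm_eq_1)
      define P where "P = (\<lambda>y. y - (y \<bullet> e) *\<^sub>R e)"
      have cP: "continuous_on UNIV (\<lambda>y. \<psi> (P y) - y \<bullet> e)"
      proof (intro continuous_intros)
        show "continuous_on UNIV (\<lambda>y. \<psi> (P y))"
          by (rule continuous_on_compose2[OF lipschitz_on_continuous_on[OF U(4)]])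
            (auto simp: P_def inner_diff_left ee intro!: continuous_intros)
      qed
      have "((\<lambda>t. z - t *\<^sub>R e) \<longlongrightarrow> z - 0 *\<^sub>R e) (at_right 0)" by (intro tendsto_intros)
      moreover have "open (U \<inter> interior (closure \<Omega>))" "z - 0 *\<^sub>R e \<in> U \<inter> interior (closure \<Omega>)"
        using U z by auto
      ultimately have "\<forall>\<^sub>F t in at_right 0. z - t *\<^sub>R e \<in> U \<inter> interior (closure \<Omega>)"
        by (rule topological_tendstoD)
      moreover have "\<forall>\<^sub>F t in at_right 0. (0::real) < t" by (rule eventually_at_right_less)
      ultimately have "\<forall>\<^sub>F t in at_right 0. (0::real) < t \<and> z - t *\<^sub>R e \<in> U \<inter> interior (closure \<Omega>)"
        by eventually_elim auto
      then obtain t :: real where t: "0 < t" "z - t *\<^sub>R e \<in> U" "z - t *\<^sub>R e \<in> closure \<Omega>"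
        using eventually_happens'[OF trivial_limit_at_right_real] interior_subset by blast
      \<comment> \<open>The part of \<open>U\<close> strictly below the graph is open and misses
        \<Omega>, hence it cannot meet the closure either.\<close>
      let ?V = "U \<inter> {y. 0 < \<psi> (P y) - y \<bullet> e}"
      have "open ?V"
        by (intro open_Int U(1) open_Collect_less[OF continuous_on_const cP])
      moreover have "P (z - t *\<^sub>R e) = P z" by (simp add: P_def inner_diff_left ee algebra_simps)
      moreover have "z \<bullet> e \<le> \<psi> (P z)" using U(2,5) nz unfolding P_def by fastforce
      ultimately have "z - t *\<^sub>R e \<in> ?V" using t by (simp add: inner_diff_left ee)
      then have "?V \<inter> \<Omega> \<noteq> {}"
        using t(3) \<open>open ?V\<close> open_Int_closure_eq_empty by blast
      then obtain y where y: "y \<in> \<Omega> \<inter> U" "0 < \<psi> (P y) - y \<bullet> e" by auto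
      have "\<psi> (P y) < y \<bullet> e" using y(1) unfolding U(5) P_def by simp
      with y(2) show False by simp
    qed
  qed
qed

lemma negligible_frontier_polyhedral:
  fixes \<Omega> :: "'a::euclidean_space set"
  assumes "polyhedral_boundary \<Omega>"
  shows "negligible (frontier \<Omega>)"
proof -
  obtain \<F> where \<F>: "finite \<F>" "\<And>P. P \<in> \<F> \<Longrightarrow> polytope P \<and> aff_dim P = int DIM('a) - 1" "frontier \<Omega> = \<Union>\<F>"
    using assms by (auto simp: polyhedral_boundary_def)
  have "negligible P" if "P \<in> \<F>" for P
  proof -
    have "interior P = {}" using \<F>(2)[OF that] aff_dim_nonempty_interior[of P] by fastforce
    then show ?thesis using \<F>(2)[OF that] negligible_convex_interior polytope_imp_convex by blast
  qed
  then show ?thesis unfolding \<F>(3) using \<F>(1) by (intro negligible_Union) auto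
qed

lemma AE_lebesgue_on_negligible_diff:
  assumes "AE x in lebesgue_on S. P x" "negligible (T - S)" "S \<in> sets lebesgue" "T \<in> sets lebesgue"
  shows "AE x in lebesgue_on T. P x"
proof -
  have "AE x in lebesgue. x \<notin> T - S"
    using assms(2) by (intro AE_not_in) (simp add: negligible_iff_null_sets)
  moreover have "AE x in lebesgue. x \<in> S \<longrightarrow> P x"
    using assms(1,3) by (simp add: AE_restrict_space_iff)
  ultimately have "AE x in lebesgue. x \<in> T \<longrightarrow> P x" by eventually_elim blast
  then show ?thesis using assms(4) by (simp add: AE_restrict_space_iff)
qed

lemma L2_sum:
  fixes f :: "'i \<Rightarrow> 'a::euclidean_space \<Rightarrow> 'b::euclidean_space"
  assumes "\<And>i. i \<in> I \<Longrightarrow> f i \<in> L2 \<Omega>"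
  shows "(\<lambda>x. \<Sum>i\<in>I. f i x) \<in> L2 \<Omega>"
  using assms
proof (induction I rule: infinite_finite_induct)
  case (insert i I)
  then show ?case using L2_add[of "f i" \<Omega> "\<lambda>x. \<Sum>i\<in>I. f i x"] by simp
qed (simp_all add: L2_def)

text \<open>A triangulation covers the closure of \<Omega>, while all function spaces live on
  \<Omega>. The condition \<open>int_closure\<close> ensures that the interiors of the simplices lie
  in \<Omega>.\<close>

locale triangulated_domain =
  fixes \<Omega> :: "'a::euclidean_space set" and \<T> :: "'a set set"
  assumes op: "open \<Omega>" and bdd: "bounded \<Omega>" and frontier_null: "negligible (frontier \<Omega>)"
    and int_closure: "interior (closure \<Omega>) = \<Omega>" and tri: "regular_triangulation \<Omega> \<T>"
begin

lemma meas_\<Omega>: "\<Omega> \<in> sets lebesgue" using op by auto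

lemma finite_\<T>: "finite \<T>" and Union_\<T>: "\<Union>\<T> = closure \<Omega>"
  using tri by (auto simp: regular_triangulation_def triangulation_def)

lemma simplex_vertices:
  assumes "T \<in> \<T>"
  obtains C where "\<not> affine_dependent C" "card C = Suc DIM('a)" "T = convex hull C"
proof -
  have "int DIM('a) simplex T" using tri assms by (simp add: regular_triangulation_def)
  then obtain C where "\<not> affine_dependent C" "int (card C) = int DIM('a) + 1" "T = convex hull C"
    by (auto simp: simplex_def)
  with that show thesis by simp
qed

section \<open>Topology and null sets of a single simplex\<close>

context
  fixes T assumes T: "T \<in> \<T>"
begin

lemma simplex_convex: "convex T" and simplex_compact: "compact T" and simplex_interior: "interior T \<noteq> {}"
proof -
  obtain C where C: "\<not> affine_dependent C" "card C = Suc DIM('a)" "T = convex hull C"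
    using simplex_vertices[OF T] .
  have fin: "finite C" using C(1) aff_independent_finite by blast
  show "convex T" "compact T" using C(3) fin by (auto intro: finite_imp_compact_convex_hull)
  have "aff_dim C = int DIM('a)" using aff_dim_affine_independent[OF C(1)] C(2) by simp
  then have "affine hull T = UNIV" using C(3) by (simp add: affine_hull_convex_hull aff_dim_eq_full)
  then have "interior T = rel_interior T" by (simp add: rel_interior_interior)
  moreover have "T \<noteq> {}" using C by auto
  ultimately show "interior T \<noteq> {}" using \<open>convex T\<close> by (simp add: rel_interior_eq_empty)
qed

lemma meas_simplex: "T \<in> sets lebesgue" and meas_interior: "interior T \<in> sets lebesgue"
  using simplex_compact by (auto intro: lmeasurable_compact fmeasurableD)

lemma negligible_simplex_boundary: "negligible (T - interior T)"
proof -
  have "T - interior T \<subseteq> frontier T" using closure_subset by (auto simp: frontier_def)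
  then show ?thesis using negligible_convex_frontier[OF simplex_convex] negligible_subset by blast
qed

lemma interior_simplex_subset: "interior T \<subseteq> \<Omega>"
proof -
  have "interior T \<subseteq> interior (closure \<Omega>)" using T Union_\<T> by (intro interior_mono) auto
  then show ?thesis using int_closure by simp
qed

lemma bounded_interior: "bounded (interior T)"
  using interior_simplex_subset bdd bounded_subset by blast

lemma AE_interior_iff: "(AE x in lebesgue_on (interior T). P x) \<longleftrightarrow> (AE x in lebesgue_on T. P x)"
  using AE_lebesgue_on_subset[OF _ interior_subset meas_interior meas_simplex]
    AE_lebesgue_on_negligible_diff[OF _ negligible_simplex_boundary meas_interior meas_simplex] by blast

lemma AE_simplex: "AE x in lebesgue_on \<Omega>. P x \<Longrightarrow> AE x in lebesgue_on T. P x"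
  using AE_lebesgue_on_subset[OF _ interior_simplex_subset meas_interior meas_\<Omega>, of P] AE_interior_iff by blast

end

text \<open>The intersection of two simplices of the triangulation is a face of each. A face that
  meets the relative interior is everything, so a common interior point forces inclusion in both
  directions.\<close>

lemma interiors_disjoint:
  assumes "T \<in> \<T>" "T' \<in> \<T>" "T \<noteq> T'"
  shows "interior T \<inter> interior T' = {}"
proof (rule ccontr)
  assume "interior T \<inter> interior T' \<noteq> {}"
  then obtain x where x: "x \<in> interior T" "x \<in> interior T'" by auto
  have sub: "A \<subseteq> B" if "A \<in> \<T>" "B \<in> \<T>" "x \<in> interior A" "x \<in> interior B" for A B
  proof -
    have "A \<inter> B face_of A" using tri that by (auto simp: regular_triangulation_def triangulation_def)
    moreover have "x \<in> (A \<inter> B) \<inter> rel_interior A"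
      using that interior_subset interior_subset_rel_interior by blast
    ultimately have "A \<subseteq> A \<inter> B" using subset_of_face_of by blast
    then show ?thesis by simp
  qed
  show False using sub[of T T'] sub[of T' T] x assms by auto
qed

text \<open>Reduces statements on \<Omega> to single simplices: these are finitely many, cover
  \<Omega>, and leave it at most in their negligible boundaries.\<close>

lemma AE_\<Omega>_iff: "(AE x in lebesgue_on \<Omega>. P x) \<longleftrightarrow> (\<forall>T\<in>\<T>. AE x in lebesgue_on T. P x)"
proof
  assume "\<forall>T\<in>\<T>. AE x in lebesgue_on T. P x"
  then have "AE x in lebesgue. x \<in> T \<longrightarrow> P x" if "T \<in> \<T>" for T
    using that meas_simplex by (auto simp: AE_restrict_space_iff)
  then have "AE x in lebesgue. \<forall>T\<in>\<T>. x \<in> T \<longrightarrow> P x" by (intro AE_finite_allI finite_\<T>)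
  then have "AE x in lebesgue. x \<in> \<Omega> \<longrightarrow> P x"
    using Union_\<T> closure_subset[of \<Omega>] by (auto elim!: eventually_mono)
  then show "AE x in lebesgue_on \<Omega>. P x" using meas_\<Omega> by (simp add: AE_restrict_space_iff)
qed (use AE_simplex in blast)

lemma sum_indicator_interior:
  fixes F :: "'a set \<Rightarrow> 'b::real_vector"
  assumes "T \<in> \<T>" "x \<in> interior T"
  shows "(\<Sum>T\<in>\<T>. indicator (interior T) x *\<^sub>R F T) = F T"
proof -
  have "(\<Sum>S\<in>\<T>. indicator (interior S) x *\<^sub>R F S) = (\<Sum>S\<in>\<T>. if S = T then F T else 0)"
    using interiors_disjoint assms by (intro sum.cong) (auto simp: indicator_def)
  then show ?thesis using assms finite_\<T> by simp
qed

lemma AE_sum_indicator_interior: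
  fixes F :: "'a set \<Rightarrow> 'a \<Rightarrow> 'b::real_vector"
  assumes T: "T \<in> \<T>"
  shows "AE x in lebesgue_on T. (\<Sum>T\<in>\<T>. indicator (interior T) x *\<^sub>R F T x) = F T x"
proof -
  have "AE x in lebesgue_on (interior T). (\<Sum>T\<in>\<T>. indicator (interior T) x *\<^sub>R F T x) = F T x"
    by (rule AE_I2) (simp add: space_restrict_space sum_indicator_interior[OF T])
  then show ?thesis using AE_interior_iff[OF T] by blast
qed

lemma integral_decompose:
  fixes h :: "'a \<Rightarrow> real"
  assumes h: "integrable (lebesgue_on \<Omega>) h"
  shows "(LINT x|lebesgue_on \<Omega>. h x) = (\<Sum>T\<in>\<T>. (LINT x|lebesgue_on (interior T). h x))"
proof -
  let ?g = "\<lambda>x. \<Sum>T\<in>\<T>. indicator (interior T) x *\<^sub>R h x"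
  have ind: "integrable (lebesgue_on \<Omega>) (\<lambda>x. indicator (interior T) x *\<^sub>R h x)" if "T \<in> \<T>" for T
    using interior_simplex_subset[OF that] meas_interior[OF that] meas_\<Omega>
    by (intro integrable_mult_indicator h) (auto simp: sets_restrict_space_iff)
  have "(LINT x|lebesgue_on \<Omega>. h x) = (LINT x|lebesgue_on \<Omega>. ?g x)"
  proof (rule integral_cong_AE)
    show "?g \<in> borel_measurable (lebesgue_on \<Omega>)"
      using ind by (intro borel_measurable_sum) auto
    show "AE x in lebesgue_on \<Omega>. h x = ?g x"
      unfolding AE_\<Omega>_iff
    proof
      fix T assume "T \<in> \<T>"
      from AE_sum_indicator_interior[OF this, of "\<lambda>_. h"]
      show "AE x in lebesgue_on T. h x = ?g x" by eventually_elim simp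
    qed
  qed (use h in auto)
  also have "\<dots> = (\<Sum>T\<in>\<T>. (LINT x|lebesgue_on \<Omega>. indicator (interior T) x *\<^sub>R h x))"
    by (rule Bochner_Integration.integral_sum) (rule ind)
  also have "\<dots> = (\<Sum>T\<in>\<T>. (LINT x|lebesgue_on (interior T). h x))"
  proof (rule sum.cong[OF refl])
    fix T assume T: "T \<in> \<T>"
    have "(LINT x|lebesgue_on \<Omega>. indicator (interior T) x *\<^sub>R h x) = (LINT x|lebesgue_on (interior T). indicator (interior T) x *\<^sub>R h x)"
      by (rule integral_lebesgue_on_subset)
        (use interior_simplex_subset[OF T] meas_interior[OF T] meas_\<Omega> in auto)
    also have "\<dots> = (LINT x|lebesgue_on (interior T). h x)"
      by (rule Bochner_Integration.integral_cong) (auto simp: space_restrict_space)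
    finally show "(LINT x|lebesgue_on \<Omega>. indicator (interior T) x *\<^sub>R h x) = (LINT x|lebesgue_on (interior T). h x)" .
  qed
  finally show ?thesis .
qed

lemma integral_interior:
  fixes h :: "'a \<Rightarrow> real"
  assumes T: "T \<in> \<T>" and h: "continuous_on UNIV h"
  shows "(LINT x|lebesgue_on (interior T). h x) = (LINT x|lebesgue_on T. h x)"
proof -
  have m: "h \<in> borel_measurable borel" using h by (rule borel_measurable_continuous_onI)
  have "AE x in lborel. indicator (interior T) x * h x = indicator T x * h x"
  proof -
    have "T - interior T \<in> sets borel" using simplex_compact[OF T] by (auto intro: borel_compact)
    then have "T - interior T \<in> null_sets lborel"
      using negligible_simplex_boundary[OF T] by (simp add: negligible_iff_null_sets null_sets_completion_iff)
    then have "AE x in lborel. x \<notin> T - interior T" by (rule AE_not_in)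
    then show ?thesis
    proof eventually_elim
      case (elim x)
      then show ?case using interior_subset[of T] by (auto split: split_indicator)
    qed
  qed
  then have "(LINT x|lborel. indicator (interior T) x * h x) = (LINT x|lborel. indicator T x * h x)"
    using m borel_compact[OF simplex_compact[OF T]]
    by (intro integral_cong_AE) (auto intro!: borel_measurable_times borel_measurable_indicator)
  then show ?thesis
    using m borel_compact[OF simplex_compact[OF T]] by (simp add: integral_lebesgue_on_borel)
qed

text \<open>The sum of the pieces cut off by the indicators of the interiors is square integrable,
  and \<open>g\<close> agrees with it almost everywhere; measurability of \<open>g\<close> comes
  from that agreement.\<close>

lemma piecewise_continuous_L2:
  fixes g :: "'a \<Rightarrow> 'b::euclidean_space"
  assumes g: "\<And>T. T \<in> \<T> \<Longrightarrow> AE x in lebesgue_on T. g x = F T x" and F: "\<And>T. T \<in> \<T> \<Longrightarrow> continuous_on UNIV (F T)"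
  shows "g \<in> L2 \<Omega>"
proof (rule L2_cong_AE[OF _ meas_\<Omega>])
  let ?h = "\<lambda>x. \<Sum>T\<in>\<T>. indicator (interior T) x *\<^sub>R F T x"
  have "(\<lambda>x. indicator (interior T) x *\<^sub>R F T x) \<in> L2 \<Omega>" if T: "T \<in> \<T>" for T
  proof (rule L2_dominated(1)[of _ _ _ 1])
    show FL2: "F T \<in> L2 \<Omega>" by (rule L2_continuous[OF F[OF T] bdd meas_\<Omega>])
    have "indicator (interior T) \<in> borel_measurable (lebesgue_on \<Omega>)"
      using interior_simplex_subset[OF T] meas_interior[OF T] meas_\<Omega>
      by (intro borel_measurable_indicator) (auto simp: sets_restrict_space_iff)
    then show "(\<lambda>x. indicator (interior T) x *\<^sub>R F T x) \<in> borel_measurable (lebesgue_on \<Omega>)"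
      using L2_measurable[OF FL2] by (intro borel_measurable_scaleR)
  qed (auto simp: indicator_def)
  then show "?h \<in> L2 \<Omega>" by (rule L2_sum)
  show "AE x in lebesgue_on \<Omega>. ?h x = g x"
    unfolding AE_\<Omega>_iff
  proof
    fix T assume T: "T \<in> \<T>"
    show "AE x in lebesgue_on T. ?h x = g x"
      using AE_sum_indicator_interior[OF T, of F] g[OF T] by eventually_elim simp
  qed
qed

text \<open>Allows any Euclidean range, so that one notion serves gradients, fluxes, divergences and
  projections; for real functions it is \<open>Pk 0 \<T>\<close>.\<close>

definition pw_const :: "('a \<Rightarrow> 'b::euclidean_space) \<Rightarrow> bool" where
  "pw_const g \<longleftrightarrow> (\<exists>a. \<forall>T\<in>\<T>. AE x in lebesgue_on T. g x = a T)"

lemma pw_const_L2: "pw_const g \<Longrightarrow> g \<in> L2 \<Omega>"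
  unfolding pw_const_def using piecewise_continuous_L2[of g "\<lambda>T x. _ T"] by auto

text \<open>The map \<open>H\<close> is arbitrary, in particular nonlinear. This is why the discrete
  flux \<sigma> applied to a piecewise constant gradient is an admissible competitor for the
  projection.\<close>

lemma pw_const_map:
  assumes "pw_const g" shows "pw_const (\<lambda>x. H (g x))"
proof -
  obtain a where a: "\<forall>T\<in>\<T>. AE x in lebesgue_on T. g x = a T" using assms by (auto simp: pw_const_def)
  show ?thesis unfolding pw_const_def
  proof (intro exI ballI)
    fix T assume "T \<in> \<T>"
    with a show "AE x in lebesgue_on T. H (g x) = H (a T)" by (auto elim!: eventually_mono)
  qed
qed

lemma pw_const_map2:
  assumes "pw_const g" "pw_const g'" shows "pw_const (\<lambda>x. H (g x) (g' x))"
proof -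
  obtain a a' where a: "\<forall>T\<in>\<T>. AE x in lebesgue_on T. g x = a T" "\<forall>T\<in>\<T>. AE x in lebesgue_on T. g' x = a' T"
    using assms by (auto simp: pw_const_def)
  show ?thesis unfolding pw_const_def
  proof (intro exI ballI)
    fix T assume T: "T \<in> \<T>"
    show "AE x in lebesgue_on T. H (g x) (g' x) = H (a T) (a' T)"
      using a(1)[rule_format, OF T] a(2)[rule_format, OF T] by eventually_elim simp
  qed
qed

lemma Pk_0_pw_const: "v \<in> Pk 0 \<T> \<longleftrightarrow> pw_const v"
  by (simp add: Pk_0_iff pw_const_def)

lemma Pk_1_grad_NC:
  assumes v: "\<forall>T\<in>\<T>. AE x in lebesgue_on T. v x = a T + b T \<bullet> x"
  shows "\<forall>T\<in>\<T>. AE x in lebesgue_on T. grad_NC \<T> v x = b T"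
proof
  fix T assume T: "T \<in> \<T>"
  let ?I = "interior T"
  have "has_weak_grad ?I v (\<lambda>x. b T)"
  proof (rule has_weak_grad_cong_AE)
    show weak: "has_weak_grad ?I (\<lambda>x. a T + b T \<bullet> x) (\<lambda>x. b T)"
      by (rule has_weak_grad_classical) (auto intro!: derivative_eq_intros)
    show L2: "(\<lambda>x. a T + b T \<bullet> x) \<in> L2 ?I"
      by (intro L2_continuous bounded_interior T continuous_intros) auto
    show ae: "AE x in lebesgue_on ?I. a T + b T \<bullet> x = v x"
      using v T unfolding AE_interior_iff[OF T] by (auto elim!: eventually_mono)
    show "v \<in> borel_measurable (lebesgue_on ?I)"
      by (rule borel_measurable_lebesgue_on_cong_AE[OF L2_measurable[OF L2] _ ae]) auto
  qed auto
  then have "AE x in lebesgue_on ?I. weak_grad ?I v x = b T"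
    using weak_grad_eqI(1)[OF open_interior bounded_interior[OF T]] L2_const[OF bounded_interior[OF T]] by auto
  then have "AE x in lebesgue_on T. weak_grad ?I v x = b T" using AE_interior_iff[OF T] by blast
  then show "AE x in lebesgue_on T. grad_NC \<T> v x = b T"
    using AE_sum_indicator_interior[OF T, of "\<lambda>T. weak_grad (interior T) v"]
    by eventually_elim (simp add: grad_NC_def)
qed

text \<open>The supply of test functions: on each simplex the value offset \<delta> and the gradient
  \<gamma> may be prescribed independently of the neighbours.\<close>

lemma pw_affine_Pk_1:
  assumes "pw_const \<delta>" "pw_const \<gamma>" and v: "\<And>x. v x = \<delta> x + \<gamma> x \<bullet> x"
  shows "v \<in> Pk 1 \<T>" "AE x in lebesgue_on \<Omega>. grad_NC \<T> v x = \<gamma> x"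
proof -
  obtain a b where ab: "\<forall>T\<in>\<T>. AE x in lebesgue_on T. \<delta> x = a T" "\<forall>T\<in>\<T>. AE x in lebesgue_on T. \<gamma> x = b T"
    using assms by (auto simp: pw_const_def)
  have *: "\<forall>T\<in>\<T>. AE x in lebesgue_on T. v x = a T + b T \<bullet> x"
  proof
    fix T assume T: "T \<in> \<T>"
    show "AE x in lebesgue_on T. v x = a T + b T \<bullet> x"
      using ab(1)[rule_format, OF T] ab(2)[rule_format, OF T] by eventually_elim (simp add: v)
  qed
  then show "v \<in> Pk 1 \<T>" unfolding Pk_1_iff by blast
  show "AE x in lebesgue_on \<Omega>. grad_NC \<T> v x = \<gamma> x"
    unfolding AE_\<Omega>_iff
  proof
    fix T assume T: "T \<in> \<T>"
    show "AE x in lebesgue_on T. grad_NC \<T> v x = \<gamma> x"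
      using Pk_1_grad_NC[OF *, rule_format, OF T] ab(2)[rule_format, OF T] by eventually_elim simp
  qed
qed

lemma Pk_1_L2:
  assumes "v \<in> Pk 1 \<T>"
  shows "v \<in> L2 \<Omega>" "grad_NC \<T> v \<in> L2 \<Omega>"
proof -
  obtain a b where ab: "\<forall>T\<in>\<T>. AE x in lebesgue_on T. v x = a T + b T \<bullet> x"
    using assms unfolding Pk_1_iff by blast
  then show "v \<in> L2 \<Omega>"
    by (intro piecewise_continuous_L2[of v "\<lambda>T x. a T + b T \<bullet> x"]) (auto intro!: continuous_intros)
  show "grad_NC \<T> v \<in> L2 \<Omega>"
    using Pk_1_grad_NC[OF ab] by (intro piecewise_continuous_L2[of "grad_NC \<T> v" "\<lambda>T x. b T"]) auto
qed

text \<open>Restricted to the interior of a simplex, the global weak gradient is a weak gradient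
  there, and uniqueness identifies it with the constant gradient of the affine piece.\<close>

lemma S10_weak_grad:
  assumes "v \<in> S10 \<Omega> \<T>"
  shows "pw_const (weak_grad \<Omega> v)"
proof -
  have v: "v \<in> H10 \<Omega>" and "v \<in> Pk 1 \<T>" using assms by (auto simp: S10_def)
  then obtain a b where ab: "\<forall>T\<in>\<T>. AE x in lebesgue_on T. v x = a T + b T \<bullet> x"
    unfolding Pk_1_iff by blast
  note g = H10_L2[OF op bdd v]
  have "AE x in lebesgue_on T. weak_grad \<Omega> v x = b T" if T: "T \<in> \<T>" for T
  proof -
    let ?I = "interior T"
    note sub = interior_simplex_subset[OF T] meas_interior[OF T] meas_\<Omega>
    have "weak_grad \<Omega> v \<in> L2 ?I" "has_weak_grad ?I v (weak_grad \<Omega> v)"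
      using L2_subset[OF g(2) sub] has_weak_grad_subset[OF g(3) sub] .
    from weak_grad_eqI(1)[OF open_interior bounded_interior[OF T] this]
    have "AE x in lebesgue_on T. weak_grad ?I v x = weak_grad \<Omega> v x" using AE_interior_iff[OF T] by blast
    moreover have "AE x in lebesgue_on T. grad_NC \<T> v x = b T" using Pk_1_grad_NC[OF ab] T by blast
    ultimately show ?thesis
      using AE_sum_indicator_interior[OF T, of "\<lambda>T. weak_grad (interior T) v"]
      by eventually_elim (simp add: grad_NC_def)
  qed
  then show ?thesis by (auto simp: pw_const_def)
qed

text \<open>The local classical divergence of \<open>b T *\<^sub>R (x - m T)\<close> is the
  dimension times \<open>b T\<close>, whatever the base point, and by uniqueness the global weak
  divergence coincides with it on each interior.\<close>

lemma RT0_weak_div: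
  assumes q: "q \<in> Hdiv \<Omega>" and Ab: "\<forall>T\<in>\<T>. AE x in lebesgue_on T. q x = A T + b T *\<^sub>R (x - m T)"
  shows "\<forall>T\<in>\<T>. AE x in lebesgue_on T. weak_div \<Omega> q x = real DIM('a) * b T"
proof
  fix T assume T: "T \<in> \<T>"
  let ?I = "interior T" and ?q = "\<lambda>x. A T + b T *\<^sub>R (x - m T)"
  note sub = interior_simplex_subset[OF T] meas_interior[OF T] meas_\<Omega>
  obtain d where "d \<in> L2 \<Omega>" "has_weak_div \<Omega> q d" and qL2: "q \<in> L2 \<Omega>" using q by (auto simp: Hdiv_def)
  note d = weak_div_eqI[OF op bdd this(1,2)]
  have "has_weak_div ?I ?q (\<lambda>x. \<Sum>i\<in>(Basis::'a set). (b T *\<^sub>R i) \<bullet> i)"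
    by (rule has_weak_div_classical[where D="\<lambda>i x. b T *\<^sub>R i"])
      (auto intro!: derivative_eq_intros simp: inner_add_left inner_diff_left fun_eq_iff inner_commute)
  then have 1: "has_weak_div ?I ?q (\<lambda>x. real DIM('a) * b T)" by (simp add: inner_same_Basis)
  have 2: "?q \<in> L2 ?I"
    by (intro L2_continuous bounded_interior T continuous_intros) auto
  have 3: "AE x in lebesgue_on ?I. ?q x = q x"
    using Ab T unfolding AE_interior_iff[OF T] by (auto elim!: eventually_mono)
  have "has_weak_div ?I q (\<lambda>x. real DIM('a) * b T)"
    by (rule has_weak_div_cong_AE[OF 1 2 L2_measurable[OF L2_subset[OF qL2 sub]] 3 sub(2)])
  from weak_div_unique[OF open_interior bounded_interior[OF T] has_weak_div_subset[OF d(3) sub] this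
      L2_subset[OF d(2) sub] L2_const[OF bounded_interior[OF T] sub(2)]]
  have "AE x in lebesgue_on ?I. weak_div \<Omega> q x = real DIM('a) * b T" .
  then show "AE x in lebesgue_on T. weak_div \<Omega> q x = real DIM('a) * b T" using AE_interior_iff[OF T] by blast
qed

text \<open>\<open>Pi0\<close> is a choice and has its defining properties only once a witness
  exists; the mean values over the simplices provide one, their interiors having positive
  measure.\<close>

lemma Pi0_properties:
  assumes f: "f \<in> L2 \<Omega>"
  shows "pw_const (Pi0 \<Omega> \<T> f)" "\<And>w. pw_const w \<Longrightarrow> (LINT x|lebesgue_on \<Omega>. (f x - Pi0 \<Omega> \<T> f x) * w x) = 0"
proof -
  define m where "m = (\<lambda>T. (LINT x|lebesgue_on (interior T). f x) / measure lebesgue (interior T))"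
  define g where "g = (\<lambda>x. \<Sum>T\<in>\<T>. indicator (interior T) x *\<^sub>R m T)"
  have ae: "\<forall>T\<in>\<T>. AE x in lebesgue_on T. g x = m T"
    unfolding g_def using AE_sum_indicator_interior[of _ "\<lambda>T _. m T"] by blast
  then have g: "pw_const g" by (auto simp: pw_const_def)
  have orth: "(LINT x|lebesgue_on \<Omega>. (f x - g x) * w x) = 0" if w: "pw_const w" for w
  proof -
    obtain a where a: "\<forall>T\<in>\<T>. AE x in lebesgue_on T. w x = a T" using w by (auto simp: pw_const_def)
    have int: "integrable (lebesgue_on \<Omega>) (\<lambda>x. (f x - g x) * w x)"
      by (intro L2_mult_integrable L2_diff f pw_const_L2 g w)
    have "(LINT x|lebesgue_on (interior T). (f x - g x) * w x) = 0" if T: "T \<in> \<T>" for T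
    proof -
      note sub = interior_simplex_subset[OF T] meas_interior[OF T] meas_\<Omega>
      have fin: "f \<in> L2 (interior T)" by (rule L2_subset[OF f sub])
      then have fi: "integrable (lebesgue_on (interior T)) f"
        by (rule L2_integrable[OF bounded_interior[OF T] sub(2)])
      have ci: "integrable (lebesgue_on (interior T)) (\<lambda>x. m T)"
        by (intro L2_integrable L2_const bounded_interior T sub(2))
      have "interior T \<in> lmeasurable" using bounded_interior[OF T] by (intro bounded_set_imp_lmeasurable sub(2))
      moreover have "\<not> negligible (interior T)"
        using simplex_interior[OF T] open_not_negligible by blast
      ultimately have pos: "0 < measure lebesgue (interior T)"
        by (metis measure_nonneg negligible_iff_measure order_le_less)
      have "(LINT x|lebesgue_on (interior T). (f x - g x) * w x) = (LINT x|lebesgue_on (interior T). (f x - m T) * a T)"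
      proof (rule integral_cong_AE)
        show "(\<lambda>x. (f x - g x) * w x) \<in> borel_measurable (lebesgue_on (interior T))"
          using integrable_lebesgue_on_subset[OF int sub] by auto
        show "(\<lambda>x. (f x - m T) * a T) \<in> borel_measurable (lebesgue_on (interior T))"
          using L2_measurable[OF fin] by auto
        show "AE x in lebesgue_on (interior T). (f x - g x) * w x = (f x - m T) * a T"
          unfolding AE_interior_iff[OF T] using ae[rule_format, OF T] a[rule_format, OF T]
          by eventually_elim simp
      qed
      also have "\<dots> = ((LINT x|lebesgue_on (interior T). f x) - m T * measure lebesgue (interior T)) * a T"
        using fi ci sub(2) by (simp add: measure_restrict_space space_restrict_space mult.commute)
      also have "\<dots> = 0" using pos by (simp add: m_def)
      finally show ?thesis .
    qed
    then show ?thesis unfolding integral_decompose[OF int] by simp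
  qed
  have "\<exists>g. g \<in> Pk 0 \<T> \<and> (\<forall>w\<in>Pk 0 \<T>. (LINT x|lebesgue_on \<Omega>. (f x - g x) * w x) = 0)"
    using g orth by (auto simp: Pk_0_pw_const)
  from someI_ex[OF this] show "pw_const (Pi0 \<Omega> \<T> f)"
    "\<And>w. pw_const w \<Longrightarrow> (LINT x|lebesgue_on \<Omega>. (f x - Pi0 \<Omega> \<T> f x) * w x) = 0"
    unfolding Pi0_def[symmetric] by (auto simp: Pk_0_pw_const)
qed

text \<open>Pythagoras: the projection error is orthogonal to the piecewise constant function
  \<open>Pi0 \<Omega> \<T> f - w\<close>.\<close>

lemma Pi0_best:
  assumes f: "f \<in> L2 \<Omega>" and w: "pw_const w"
  shows "L2norm \<Omega> (\<lambda>x. f x - Pi0 \<Omega> \<T> f x) \<le> L2norm \<Omega> (\<lambda>x. f x - w x)"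
proof -
  note P = Pi0_properties[OF f]
  let ?d = "\<lambda>x. f x - Pi0 \<Omega> \<T> f x" and ?e = "\<lambda>x. Pi0 \<Omega> \<T> f x - w x"
  have e: "pw_const ?e" using pw_const_map2[OF P(1) w] .
  have dL2: "?d \<in> L2 \<Omega>" and eL2: "?e \<in> L2 \<Omega>" by (intro L2_diff f pw_const_L2 P e)+
  have "(norm (f x - w x))\<^sup>2 = (norm (?d x))\<^sup>2 + 2 * (?d x * ?e x) + (norm (?e x))\<^sup>2" for x
    by (simp add: power2_eq_square algebra_simps)
  then have "(L2norm \<Omega> (\<lambda>x. f x - w x))\<^sup>2 = (L2norm \<Omega> ?d)\<^sup>2 + 2 * (LINT x|lebesgue_on \<Omega>. ?d x * ?e x) + (L2norm \<Omega> ?e)\<^sup>2"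
    using L2_integrable_sq[OF dL2] L2_integrable_sq[OF eL2] L2_mult_integrable[OF dL2 eL2]
    by (simp add: L2norm_sq del: real_norm_def power2_abs)
  then have "(L2norm \<Omega> ?d)\<^sup>2 \<le> (L2norm \<Omega> (\<lambda>x. f x - w x))\<^sup>2" using P(2)[OF e] by simp
  then show ?thesis by (rule power2_le_imp_le) simp
qed

lemma L2norm_sq_components:
  fixes g :: "'a \<Rightarrow> 'a"
  assumes "g \<in> L2 \<Omega>"
  shows "(L2norm \<Omega> g)\<^sup>2 = (\<Sum>i\<in>Basis. (L2norm \<Omega> (\<lambda>x. g x \<bullet> i))\<^sup>2)"
proof -
  have "(norm (g x))\<^sup>2 = (\<Sum>i\<in>Basis. (norm (g x \<bullet> i))\<^sup>2)" for x
    unfolding power2_norm_eq_inner by (subst euclidean_inner) (simp add: power2_eq_square)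
  then show ?thesis
    using L2_integrable_sq[OF L2_component[OF assms]] by (simp add: L2norm_sq del: real_norm_def power2_abs)
qed

lemma Pi0_vec_properties:
  fixes q :: "'a \<Rightarrow> 'a"
  assumes q: "q \<in> L2 \<Omega>"
  shows "pw_const (Pi0_vec \<Omega> \<T> q)"
    "\<And>w. pw_const w \<Longrightarrow> (LINT x|lebesgue_on \<Omega>. (q x - Pi0_vec \<Omega> \<T> q x) \<bullet> w x) = 0"
    "\<And>w. pw_const w \<Longrightarrow> L2norm \<Omega> (\<lambda>x. q x - Pi0_vec \<Omega> \<T> q x) \<le> L2norm \<Omega> (\<lambda>x. q x - w x)"
proof -
  let ?P = "Pi0_vec \<Omega> \<T> q"
  have comp: "?P x \<bullet> i = Pi0 \<Omega> \<T> (\<lambda>y. q y \<bullet> i) x" if "i \<in> Basis" for x i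
    using that by (simp add: Pi0_vec_def inner_sum_left inner_Basis if_distrib cong: if_cong)
  note P = Pi0_properties[OF L2_component[OF q]]
  have "\<exists>a. \<forall>i. \<forall>T\<in>\<T>. AE x in lebesgue_on T. Pi0 \<Omega> \<T> (\<lambda>y. q y \<bullet> i) x = a i T"
    using P(1) unfolding pw_const_def by (intro choice) auto
  then obtain a where a: "\<And>i T. T \<in> \<T> \<Longrightarrow> AE x in lebesgue_on T. Pi0 \<Omega> \<T> (\<lambda>y. q y \<bullet> i) x = a i T" by blast
  show pP: "pw_const ?P"
    unfolding pw_const_def
  proof (intro exI ballI)
    fix T assume T: "T \<in> \<T>"
    have "AE x in lebesgue_on T. \<forall>i\<in>Basis. Pi0 \<Omega> \<T> (\<lambda>y. q y \<bullet> i) x = a i T"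
      using a[OF T] by (intro AE_finite_allI) auto
    then show "AE x in lebesgue_on T. ?P x = (\<Sum>i\<in>Basis. a i T *\<^sub>R i)"
      by eventually_elim (simp add: Pi0_vec_def)
  qed
  have dL2: "(\<lambda>x. q x - ?P x) \<in> L2 \<Omega>" by (intro L2_diff q pw_const_L2 pP)
  fix w :: "'a \<Rightarrow> 'a" assume w: "pw_const w"
  have "(\<lambda>x. (q x - ?P x) \<bullet> w x) = (\<lambda>x. \<Sum>i\<in>Basis. (q x \<bullet> i - Pi0 \<Omega> \<T> (\<lambda>y. q y \<bullet> i) x) * (w x \<bullet> i))"
    by (subst euclidean_inner) (simp add: inner_diff_left comp cong: sum.cong)
  moreover have wi: "pw_const (\<lambda>x. w x \<bullet> i)" for i by (rule pw_const_map[OF w])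
  have "integrable (lebesgue_on \<Omega>) (\<lambda>x. (q x \<bullet> i - Pi0 \<Omega> \<T> (\<lambda>y. q y \<bullet> i) x) * (w x \<bullet> i))" for i
    by (intro L2_mult_integrable L2_diff L2_component q pw_const_L2 w P)
  ultimately show "(LINT x|lebesgue_on \<Omega>. (q x - ?P x) \<bullet> w x) = 0"
    using P(2)[OF wi] by simp
  have "(L2norm \<Omega> (\<lambda>x. q x - ?P x))\<^sup>2 = (\<Sum>i\<in>Basis. (L2norm \<Omega> (\<lambda>x. q x \<bullet> i - Pi0 \<Omega> \<T> (\<lambda>y. q y \<bullet> i) x))\<^sup>2)"
    unfolding L2norm_sq_components[OF dL2] by (simp add: inner_diff_left comp cong: sum.cong)
  also have "\<dots> \<le> (\<Sum>i\<in>Basis. (L2norm \<Omega> (\<lambda>x. q x \<bullet> i - w x \<bullet> i))\<^sup>2)"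
    by (intro sum_mono power_mono Pi0_best L2_component q wi) simp
  also have "\<dots> = (L2norm \<Omega> (\<lambda>x. q x - w x))\<^sup>2"
    using L2norm_sq_components[OF L2_diff[OF q pw_const_L2[OF w]]] by (simp add: inner_diff_left)
  finally show "L2norm \<Omega> (\<lambda>x. q x - ?P x) \<le> L2norm \<Omega> (\<lambda>x. q x - w x)"
    by (rule power2_le_imp_le) simp
qed

end

section \<open>The residual\<close>

context triangulated_domain
begin

lemma boundary_integral_piecewise_affine:
  assumes T: "T \<in> \<T>" and q: "AE x in lebesgue_on T. q x = A + b *\<^sub>R (x - m)"
    and v: "AE x in lebesgue_on T. v x = \<alpha> + \<beta> \<bullet> x"
  shows "boundary_integral T (\<lambda>x \<nu>. (bdry_trace T q x \<bullet> \<nu>) * bdry_trace T v x) =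
    (LINT x|lebesgue_on T. (A + b *\<^sub>R (x - m)) \<bullet> \<beta> + real DIM('a) * b * (\<alpha> + \<beta> \<bullet> x))"
proof -
  obtain C where C: "\<not> affine_dependent C" "card C = Suc DIM('a)" "T = convex hull C"
    using simplex_vertices[OF T] .
  obtain \<nu> :: "'a \<Rightarrow> 'a" and c :: "'a \<Rightarrow> real" where n:
    "\<And>z. z \<in> C \<Longrightarrow> norm (\<nu> z) = 1" "\<And>z. z \<in> C \<Longrightarrow> z \<bullet> \<nu> z < c z"
    "\<And>z. z \<in> C \<Longrightarrow> affine hull (C - {z}) = {x. x \<bullet> \<nu> z = c z}"
    using simplex_facet_normals[OF C(1,2)] by metis
  have tq: "bdry_trace T q x = A + b *\<^sub>R (x - m)" if "x \<in> T" for x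
    by (rule bdry_trace_continuous[OF simplex_convex[OF T] simplex_compact[OF T] simplex_interior[OF T] that _ q])
      (intro continuous_intros)
  have tv: "bdry_trace T v x = \<alpha> + \<beta> \<bullet> x" if "x \<in> T" for x
    by (rule bdry_trace_continuous[OF simplex_convex[OF T] simplex_compact[OF T] simplex_interior[OF T] that _ v])
      (intro continuous_intros)
  have "boundary_integral T (\<lambda>x \<nu>. (bdry_trace T q x \<bullet> \<nu>) * bdry_trace T v x) =
    (\<Sum>z\<in>C. facet_integral (\<nu> z) (convex hull (C - {z})) (\<lambda>x. (bdry_trace T q x \<bullet> \<nu> z) * bdry_trace T v x))"
    unfolding C(3) by (rule boundary_integral_simplex[OF C(1,2) n])
  also have "\<dots> = (\<Sum>z\<in>C. facet_integral (\<nu> z) (convex hull (C - {z})) (\<lambda>x. ((A + b *\<^sub>R (x - m)) \<bullet> \<nu> z) * (\<alpha> + \<beta> \<bullet> x)))"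
  proof (rule sum.cong[OF refl], rule facet_integral_cong[where c="c _"])
    fix z assume z: "z \<in> C"
    show "norm (\<nu> z) = 1" by (rule n(1)[OF z])
    show "affine hull (convex hull (C - {z})) = {x. x \<bullet> \<nu> z = c z}"
      using n(3)[OF z] by (simp add: affine_hull_convex_hull)
    fix x assume "x \<in> convex hull (C - {z})"
    then have "x \<in> T" unfolding C(3) using hull_mono[of "C - {z}" C convex] by auto
    then show "(bdry_trace T q x \<bullet> \<nu> z) * bdry_trace T v x = ((A + b *\<^sub>R (x - m)) \<bullet> \<nu> z) * (\<alpha> + \<beta> \<bullet> x)"
      by (simp only: tq tv)
  qed
  also have "\<dots> = (LINT x|lebesgue_on T. (A + b *\<^sub>R (x - m)) \<bullet> \<beta> + real DIM('a) * b * (\<alpha> + \<beta> \<bullet> x))"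
    unfolding C(3) by (rule divergence_theorem_affine[OF C(1,2) n])
  finally show ?thesis .
qed

text \<open>Every simplex contributes its own divergence identity, with the one-sided values of
  \<open>v\<close>; nothing has to cancel across facets. The local constants are recognized as the
  values of \<open>grad_NC\<close> and of the global weak divergence.\<close>

lemma boundary_integrals_sum:
  assumes q: "q \<in> RT0 \<Omega> \<T>" and v: "v \<in> Pk 1 \<T>"
  shows "(\<Sum>T\<in>\<T>. boundary_integral T (\<lambda>x \<nu>. (bdry_trace T q x \<bullet> \<nu>) * bdry_trace T v x)) =
    (LINT x|lebesgue_on \<Omega>. q x \<bullet> grad_NC \<T> v x + weak_div \<Omega> q x * v x)"
proof -
  obtain a b where ab: "\<forall>T\<in>\<T>. AE x in lebesgue_on T. v x = a T + b T \<bullet> x"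
    using v unfolding Pk_1_iff by blast
  have qd: "q \<in> Hdiv \<Omega>" and "\<forall>T\<in>\<T>. \<exists>A b. AE x in lebesgue_on T. q x = A + b *\<^sub>R (x - barycenter T)"
    using q by (auto simp: RT0_def)
  then obtain A B where AB: "\<forall>T\<in>\<T>. AE x in lebesgue_on T. q x = A T + B T *\<^sub>R (x - barycenter T)"
    by (simp only: bchoice_iff) blast
  obtain d where "d \<in> L2 \<Omega>" "has_weak_div \<Omega> q d" and qL2: "q \<in> L2 \<Omega>" using qd by (auto simp: Hdiv_def)
  note d = weak_div_eqI[OF op bdd this(1,2)]
  note vL2 = Pk_1_L2[OF v]
  have int: "integrable (lebesgue_on \<Omega>) (\<lambda>x. q x \<bullet> grad_NC \<T> v x + weak_div \<Omega> q x * v x)"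
    by (intro Bochner_Integration.integrable_add L2_inner_integrable L2_mult_integrable qL2 vL2 d)
  show ?thesis
    unfolding integral_decompose[OF int]
  proof (rule sum.cong[OF refl])
    fix T assume T: "T \<in> \<T>"
    let ?h = "\<lambda>x. (A T + B T *\<^sub>R (x - barycenter T)) \<bullet> b T + real DIM('a) * B T * (a T + b T \<bullet> x)"
    have ch: "continuous_on UNIV ?h" by (intro continuous_intros)
    have "boundary_integral T (\<lambda>x \<nu>. (bdry_trace T q x \<bullet> \<nu>) * bdry_trace T v x) = (LINT x|lebesgue_on T. ?h x)"
      by (rule boundary_integral_piecewise_affine[OF T AB[rule_format, OF T] ab[rule_format, OF T]])
    also have "\<dots> = (LINT x|lebesgue_on (interior T). ?h x)"
      by (rule integral_interior[OF T ch, symmetric])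
    also have "\<dots> = (LINT x|lebesgue_on (interior T). q x \<bullet> grad_NC \<T> v x + weak_div \<Omega> q x * v x)"
    proof (rule integral_cong_AE)
      show "?h \<in> borel_measurable (lebesgue_on (interior T))"
        using L2_measurable[OF L2_continuous[OF ch bounded_interior[OF T] meas_interior[OF T]]] .
      show "(\<lambda>x. q x \<bullet> grad_NC \<T> v x + weak_div \<Omega> q x * v x) \<in> borel_measurable (lebesgue_on (interior T))"
        using integrable_lebesgue_on_subset[OF int interior_simplex_subset[OF T] meas_interior[OF T] meas_\<Omega>] by auto
      show "AE x in lebesgue_on (interior T). ?h x = q x \<bullet> grad_NC \<T> v x + weak_div \<Omega> q x * v x"
        unfolding AE_interior_iff[OF T]
        using AB[rule_format, OF T] ab[rule_format, OF T] Pk_1_grad_NC[OF ab, rule_format, OF T]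
          RT0_weak_div[OF qd AB, rule_format, OF T]
        by eventually_elim simp
    qed
    finally show "boundary_integral T (\<lambda>x \<nu>. (bdry_trace T q x \<bullet> \<nu>) * bdry_trace T v x) =
        (LINT x|lebesgue_on (interior T). q x \<bullet> grad_NC \<T> v x + weak_div \<Omega> q x * v x)" .
  qed
qed

lemma RT0_L2:
  assumes q: "q \<in> RT0 \<Omega> \<T>"
  shows "q \<in> L2 \<Omega>" "weak_div \<Omega> q \<in> L2 \<Omega>" "has_weak_div \<Omega> q (weak_div \<Omega> q)" "pw_const (weak_div \<Omega> q)"
proof -
  have qd: "q \<in> Hdiv \<Omega>" and "\<forall>T\<in>\<T>. \<exists>A b. AE x in lebesgue_on T. q x = A + b *\<^sub>R (x - barycenter T)"
    using q by (auto simp: RT0_def)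
  then obtain A B where AB: "\<forall>T\<in>\<T>. AE x in lebesgue_on T. q x = A T + B T *\<^sub>R (x - barycenter T)"
    by (simp only: bchoice_iff) blast
  from RT0_weak_div[OF qd AB] show "pw_const (weak_div \<Omega> q)"
    unfolding pw_const_def by (intro exI[of _ "\<lambda>T. real DIM('a) * B T"])
  show "q \<in> L2 \<Omega>" using qd by (simp add: Hdiv_def)
  obtain d where "d \<in> L2 \<Omega>" "has_weak_div \<Omega> q d" using qd by (auto simp: Hdiv_def)
  from weak_div_eqI[OF op bdd this] show "weak_div \<Omega> q \<in> L2 \<Omega>" "has_weak_div \<Omega> q (weak_div \<Omega> q)" by auto
qed

lemma a_form_self:
  assumes "v \<in> Pk 1 \<T>"
  shows "a_form \<Omega> \<T> v v = (L2norm \<Omega> v)\<^sup>2 + (L2norm \<Omega> (grad_NC \<T> v))\<^sup>2"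
proof -
  have "a_form \<Omega> \<T> v v = (LINT x|lebesgue_on \<Omega>. (norm (v x))\<^sup>2 + (norm (grad_NC \<T> v x))\<^sup>2)"
    by (simp add: a_form_def power2_eq_square power2_norm_eq_inner[symmetric])
  then show ?thesis
    using L2_integrable_sq[OF Pk_1_L2(1)[OF assms]] L2_integrable_sq[OF Pk_1_L2(2)[OF assms]]
    by (simp add: L2norm_sq del: real_norm_def power2_abs)
qed

end

section \<open>The exact flux and its divergence\<close>

locale exact_solution = triangulated_domain \<Omega> \<T>
  for \<Omega> :: "'a::euclidean_space set" and \<T> :: "'a set set" +
  fixes \<gamma>\<^sub>1 \<gamma>\<^sub>2 :: real and \<phi> :: "real \<Rightarrow> real" and f u :: "'a \<Rightarrow> real"
  assumes adm: "admissible_nonlinearity \<gamma>\<^sub>1 \<gamma>\<^sub>2 \<phi>" and \<gamma>\<^sub>1_pos: "0 < \<gamma>\<^sub>1"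
    and f: "f \<in> L2 \<Omega>" and sol: "weak_solution \<Omega> \<phi> f u"
begin

abbreviation "\<sigma> \<equiv> sigma_map \<phi> :: 'a \<Rightarrow> 'a"

definition "p x = \<sigma> (weak_grad \<Omega> u x)"
lemma u_H10: "u \<in> H10 \<Omega>" using sol by (simp add: weak_solution_def)

lemma sigma_L2:
  assumes "g \<in> L2 \<Omega>" shows "(\<lambda>x. \<sigma> (g x)) \<in> L2 \<Omega>"
proof (rule L2_dominated(1)[OF assms])
  show "(\<lambda>x. \<sigma> (g x)) \<in> borel_measurable (lebesgue_on \<Omega>)"
    by (rule borel_measurable_continuous_on[OF continuous_sigma_map[OF adm \<gamma>\<^sub>1_pos] L2_measurable[OF assms]])
  show "norm (\<sigma> (g x)) \<le> \<gamma>\<^sub>2 * norm (g x)" for x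
    using sigma_map_lipschitz[OF adm \<gamma>\<^sub>1_pos, of "g x" 0] by (simp add: sigma_map_def)
  show "0 \<le> \<gamma>\<^sub>2" using nonlinearity_bounds[OF adm \<gamma>\<^sub>1_pos, of 0] by simp
qed

lemma p_L2: "p \<in> L2 \<Omega>"
  unfolding p_def[abs_def] by (rule sigma_L2[OF H10_L2(2)[OF op bdd u_H10]])

lemma weak_solutionD:
  "v \<in> H10 \<Omega> \<Longrightarrow> (LINT x|lebesgue_on \<Omega>. p x \<bullet> weak_grad \<Omega> v x) = (LINT x|lebesgue_on \<Omega>. f x * v x)"
  using sol by (simp add: weak_solution_def p_def sigma_map_def)

text \<open>Test functions belong to \<open>H10\<close>, so the weak formulation applied to them
  states that \<open>- f\<close> is the distributional divergence of the flux.\<close>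

lemma p_weak_div: "has_weak_div \<Omega> p (\<lambda>x. - f x)"
  unfolding has_weak_div_def
proof
  fix \<psi> assume \<psi>: "\<psi> \<in> test_functions \<Omega>"
  note t = test_function_weak_grad[OF op bdd \<psi>] and tL2 = test_function_L2[OF \<psi> meas_\<Omega>]
  have "(LINT x|lebesgue_on \<Omega>. p x \<bullet> grad \<psi> x) = (LINT x|lebesgue_on \<Omega>. p x \<bullet> weak_grad \<Omega> \<psi> x)"
    using L2_inner_integrable[OF p_L2 tL2(2)] L2_inner_integrable[OF p_L2 H10_L2(2)[OF op bdd t(4)]] t(3)
    by (intro integral_cong_AE) (auto elim!: eventually_mono)
  then show "(LINT x|lebesgue_on \<Omega>. p x \<bullet> grad \<psi> x) = - (LINT x|lebesgue_on \<Omega>. - f x * \<psi> x)"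
    by (simp add: weak_solutionD[OF t(4)])
qed

lemma p_Hdiv: "p \<in> Hdiv \<Omega>"
  unfolding Hdiv_def using p_L2 p_weak_div L2_uminus[OF f] by auto

end

text \<open>\<open>M\<close> bounds the position vector on the domain. It is kept as a parameter so
  that all estimates are explicit in it and its value can be fixed before the triangulation.\<close>

locale residual_setting = exact_solution \<Omega> \<T> \<gamma>\<^sub>1 \<gamma>\<^sub>2 \<phi> f u
  for \<Omega> :: "'a::euclidean_space set" and \<T> :: "'a set set" and \<gamma>\<^sub>1 \<gamma>\<^sub>2 \<phi> f u +
  fixes v\<^sub>C :: "'a \<Rightarrow> real" and q :: "'a \<Rightarrow> 'a" and M :: real
  assumes v\<^sub>C: "v\<^sub>C \<in> S10 \<Omega> \<T>" and q: "q \<in> RT0 \<Omega> \<T>"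
    and M: "\<And>x. x \<in> \<Omega> \<Longrightarrow> norm x \<le> M" "0 \<le> M"
begin

definition "r x = f x + weak_div \<Omega> q x"
definition "s x = q x - \<sigma> (weak_grad \<Omega> v\<^sub>C x)"
definition "D = dual_norm \<Omega> \<T> (Pk 1 \<T>) (\<lambda>v. (LINT x|lebesgue_on \<Omega>. f x * v x) - b_form \<Omega> \<T> \<phi> v\<^sub>C q v)"

lemma sigma_v\<^sub>C: "pw_const (\<lambda>x. \<sigma> (weak_grad \<Omega> v\<^sub>C x))"
  by (rule pw_const_map[OF S10_weak_grad[OF v\<^sub>C]])

lemma r_L2: "r \<in> L2 \<Omega>" and s_L2: "s \<in> L2 \<Omega>"
  unfolding r_def[abs_def] s_def[abs_def] by (intro L2_add L2_diff f RT0_L2[OF q] pw_const_L2[OF sigma_v\<^sub>C])+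

lemma residual_formula:
  assumes v: "v \<in> Pk 1 \<T>"
  shows "(LINT x|lebesgue_on \<Omega>. f x * v x) - b_form \<Omega> \<T> \<phi> v\<^sub>C q v =
    (LINT x|lebesgue_on \<Omega>. r x * v x) + (LINT x|lebesgue_on \<Omega>. s x \<bullet> grad_NC \<T> v x)"
proof -
  note vL2 = Pk_1_L2[OF v] and qL2 = RT0_L2[OF q]
  note ints = L2_mult_integrable[OF f vL2(1)] L2_mult_integrable[OF qL2(2) vL2(1)]
    L2_inner_integrable[OF qL2(1) vL2(2)] L2_inner_integrable[OF pw_const_L2[OF sigma_v\<^sub>C] vL2(2)]
  show ?thesis
    unfolding b_form_def boundary_integrals_sum[OF q v] r_def s_def
    using ints by (simp add: distrib_right inner_diff_left)
qed

lemma residual_bound: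
  assumes v: "v \<in> Pk 1 \<T>" and "a_form \<Omega> \<T> v v \<le> 1"
  shows "(LINT x|lebesgue_on \<Omega>. f x * v x) - b_form \<Omega> \<T> \<phi> v\<^sub>C q v \<le> L2norm \<Omega> r + L2norm \<Omega> s"
proof -
  note vL2 = Pk_1_L2[OF v]
  have le: "(L2norm \<Omega> v)\<^sup>2 + (L2norm \<Omega> (grad_NC \<T> v))\<^sup>2 \<le> 1"
    using assms(2) by (simp only: a_form_self[OF v])
  moreover have "0 \<le> (L2norm \<Omega> v)\<^sup>2" "0 \<le> (L2norm \<Omega> (grad_NC \<T> v))\<^sup>2" by simp_all
  ultimately have "(L2norm \<Omega> v)\<^sup>2 \<le> 1\<^sup>2" "(L2norm \<Omega> (grad_NC \<T> v))\<^sup>2 \<le> 1\<^sup>2"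
    unfolding power_one by linarith+
  then have n: "L2norm \<Omega> v \<le> 1" "L2norm \<Omega> (grad_NC \<T> v) \<le> 1"
    using power2_le_imp_le[of _ "1::real"] zero_le_one by blast+
  have "(LINT x|lebesgue_on \<Omega>. r x * v x) \<le> L2norm \<Omega> r * L2norm \<Omega> v"
    using L2_Cauchy_Schwarz[OF r_L2 vL2(1)] by simp
  also have "\<dots> \<le> L2norm \<Omega> r" using n(1) by (simp add: mult_left_le)
  finally have 1: "(LINT x|lebesgue_on \<Omega>. r x * v x) \<le> L2norm \<Omega> r" .
  have "(LINT x|lebesgue_on \<Omega>. s x \<bullet> grad_NC \<T> v x) \<le> L2norm \<Omega> s * L2norm \<Omega> (grad_NC \<T> v)"
    using L2_Cauchy_Schwarz[OF s_L2 vL2(2)] by simp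
  also have "\<dots> \<le> L2norm \<Omega> s" using n(2) by (simp add: mult_left_le)
  finally show ?thesis using 1 by (simp only: residual_formula[OF v])
qed

text \<open>The supremum in \<open>dual_norm\<close> is taken in the reals, where it dominates the
  single values only for sets that are bounded above.\<close>

lemma bdd_above_residual:
  "bdd_above ((\<lambda>v. (LINT x|lebesgue_on \<Omega>. f x * v x) - b_form \<Omega> \<T> \<phi> v\<^sub>C q v) ` {v \<in> Pk 1 \<T>. a_form \<Omega> \<T> v v \<le> 1})"
  by (rule bdd_aboveI2[where M="L2norm \<Omega> r + L2norm \<Omega> s"], rule residual_bound) simp_all

text \<open>Normalization of a test function: \<open>v\<close> divided by \<open>N\<close> is
  admissible in the supremum. It is enough that \<open>N\<close> is an upper bound for the norm, so
  a convenient multiple of another norm may be inserted.\<close>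

lemma residual_test:
  assumes "pw_const \<delta>" "pw_const \<gamma>" and v: "\<And>x. v x = \<delta> x + \<gamma> x \<bullet> x"
    and N: "0 < N" "(L2norm \<Omega> v)\<^sup>2 + (L2norm \<Omega> \<gamma>)\<^sup>2 \<le> N\<^sup>2"
  shows "(LINT x|lebesgue_on \<Omega>. r x * v x) + (LINT x|lebesgue_on \<Omega>. s x \<bullet> \<gamma> x) \<le> N * D"
proof -
  define w where "w = (\<lambda>x. v x / N)"
  have \<delta>: "pw_const (\<lambda>x. \<delta> x / N)" and \<gamma>: "pw_const (\<lambda>x. \<gamma> x /\<^sub>R N)"
    by (rule pw_const_map[OF assms(1)], rule pw_const_map[OF assms(2)])
  have weq: "w x = \<delta> x / N + (\<gamma> x /\<^sub>R N) \<bullet> x" for x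
    by (simp add: w_def v divide_inverse distrib_left distrib_right mult.commute)
  note w = pw_affine_Pk_1[OF \<delta> \<gamma> weq]
  have wL2: "w \<in> L2 \<Omega>" "grad_NC \<T> w \<in> L2 \<Omega>" using Pk_1_L2[OF w(1)] .
  have \<gamma>L2: "(\<lambda>x. \<gamma> x /\<^sub>R N) \<in> L2 \<Omega>" by (rule pw_const_L2[OF \<gamma>])
  have "(L2norm \<Omega> w)\<^sup>2 = (L2norm \<Omega> v)\<^sup>2 / N\<^sup>2"
    by (simp add: L2norm_sq w_def power_divide)
  moreover have "(L2norm \<Omega> (grad_NC \<T> w))\<^sup>2 = (L2norm \<Omega> \<gamma>)\<^sup>2 / N\<^sup>2"
    unfolding L2norm_cong_AE[OF wL2(2) \<gamma>L2 w(2)]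
    by (simp add: L2norm_sq power_mult_distrib power_inverse divide_inverse mult.commute)
  ultimately have "a_form \<Omega> \<T> w w = ((L2norm \<Omega> v)\<^sup>2 + (L2norm \<Omega> \<gamma>)\<^sup>2) / N\<^sup>2"
    by (simp add: a_form_self[OF w(1)] add_divide_distrib)
  also have "\<dots> \<le> 1" using N by simp
  finally have "(LINT x|lebesgue_on \<Omega>. f x * w x) - b_form \<Omega> \<T> \<phi> v\<^sub>C q w \<le> D"
    unfolding D_def dual_norm_def using w(1) by (intro cSUP_upper bdd_above_residual) simp
  then have "(LINT x|lebesgue_on \<Omega>. r x * w x) + (LINT x|lebesgue_on \<Omega>. s x \<bullet> grad_NC \<T> w x) \<le> D"
    by (simp only: residual_formula[OF w(1)])
  moreover have "(LINT x|lebesgue_on \<Omega>. s x \<bullet> grad_NC \<T> w x) = (LINT x|lebesgue_on \<Omega>. s x \<bullet> (\<gamma> x /\<^sub>R N))"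
    using L2_inner_integrable[OF s_L2 wL2(2)] L2_inner_integrable[OF s_L2 \<gamma>L2] w(2)
    by (intro integral_cong_AE) (auto elim!: eventually_mono)
  moreover have "(LINT x|lebesgue_on \<Omega>. r x * w x) = (LINT x|lebesgue_on \<Omega>. r x * v x) / N"
    by (simp add: w_def)
  moreover have "(LINT x|lebesgue_on \<Omega>. s x \<bullet> (\<gamma> x /\<^sub>R N)) = (LINT x|lebesgue_on \<Omega>. s x \<bullet> \<gamma> x) / N"
    by (simp add: divide_inverse mult.commute)
  ultimately have "((LINT x|lebesgue_on \<Omega>. r x * v x) + (LINT x|lebesgue_on \<Omega>. s x \<bullet> \<gamma> x)) / N \<le> D"
    by (simp add: add_divide_distrib)
  then show ?thesis using N(1) by (simp add: divide_le_eq mult.commute)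
qed

text \<open>The zero function serves twice: tested with \<open>N = 1\<close> it shows that
  \<open>D\<close> is nonnegative, and it makes the set of admissible functions nonempty, as the
  upper bound for a supremum requires.\<close>

lemma dual_norm_bounds: "0 \<le> D" "D \<le> L2norm \<Omega> r + L2norm \<Omega> s"
proof -
  have z: "pw_const (\<lambda>x. 0::real)" "pw_const (\<lambda>x. 0::'a)" by (auto simp: pw_const_def intro!: exI[of _ "\<lambda>_. 0"])
  have "(LINT x|lebesgue_on \<Omega>. r x * 0) + (LINT x|lebesgue_on \<Omega>. s x \<bullet> 0) \<le> 1 * D"
    by (rule residual_test[OF z]) (simp_all add: L2norm_def)
  then show "0 \<le> D" by simp
  note w = pw_affine_Pk_1[OF z, of "\<lambda>x. 0", simplified]
  have "L2norm \<Omega> (grad_NC \<T> (\<lambda>x. 0)) = L2norm \<Omega> (\<lambda>x. 0::'a)"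
    by (rule L2norm_cong_AE[OF Pk_1_L2(2) pw_const_L2]) (use w z in auto)
  then have "a_form \<Omega> \<T> (\<lambda>x. 0) (\<lambda>x. 0) \<le> 1"
    using a_form_self[of "\<lambda>x. 0"] w(1) by (simp add: L2norm_def)
  then have "{v \<in> Pk 1 \<T>. a_form \<Omega> \<T> v v \<le> 1} \<noteq> {}" using w(1) by auto
  then show "D \<le> L2norm \<Omega> r + L2norm \<Omega> s"
    unfolding D_def dual_norm_def by (rule cSUP_least, intro residual_bound) simp_all
qed

section \<open>Control of r and s by the dual norm and the oscillations\<close>

abbreviation "osc_f \<equiv> L2norm \<Omega> (\<lambda>x. f x - Pi0 \<Omega> \<T> f x)"
abbreviation "osc_q \<equiv> L2norm \<Omega> (\<lambda>x. q x - Pi0_vec \<Omega> \<T> q x)"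

text \<open>Best approximation with the competitors \<open>- weak_div \<Omega> q\<close> for
  \<open>f\<close> and the discrete flux for \<open>q\<close>; the resulting differences are
  \<open>r\<close> and \<open>s\<close>.\<close>

lemma osc_bounds: "osc_f \<le> L2norm \<Omega> r" "osc_q \<le> L2norm \<Omega> s"
proof -
  have "pw_const (\<lambda>x. - weak_div \<Omega> q x)" by (rule pw_const_map[OF RT0_L2(4)[OF q]])
  from Pi0_best[OF f this] show "osc_f \<le> L2norm \<Omega> r" by (simp add: r_def[abs_def])
  from Pi0_vec_properties(3)[OF RT0_L2(1)[OF q] sigma_v\<^sub>C] show "osc_q \<le> L2norm \<Omega> s"
    by (simp add: s_def[abs_def])
qed

text \<open>Since the divergence of \<open>q\<close> is piecewise constant, \<open>w\<close> is the
  projection of \<open>r\<close>, and the projection error of \<open>f\<close> is orthogonal to it.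
  Testing with \<open>w\<close> and gradient zero, normalized by its own norm, bounds that norm by
  \<open>D\<close>; the rest of \<open>r\<close> is the oscillation of \<open>f\<close>.\<close>

lemma r_bound: "L2norm \<Omega> r \<le> osc_f + D"
proof -
  define w where "w = (\<lambda>x. Pi0 \<Omega> \<T> f x + weak_div \<Omega> q x)"
  have w: "pw_const w"
    unfolding w_def by (rule pw_const_map2[OF Pi0_properties(1)[OF f] RT0_L2(4)[OF q]])
  have wL2: "w \<in> L2 \<Omega>" by (rule pw_const_L2[OF w])
  have dL2: "(\<lambda>x. f x - Pi0 \<Omega> \<T> f x) \<in> L2 \<Omega>" by (intro L2_diff f pw_const_L2 Pi0_properties)
  have z: "pw_const (\<lambda>x. 0::'a)" by (auto simp: pw_const_def intro!: exI[of _ "\<lambda>_. 0"])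
  have req: "r x = (f x - Pi0 \<Omega> \<T> f x) + w x" for x by (simp add: r_def w_def)
  have "(LINT x|lebesgue_on \<Omega>. r x * w x) = (LINT x|lebesgue_on \<Omega>. (f x - Pi0 \<Omega> \<T> f x) * w x) + (LINT x|lebesgue_on \<Omega>. w x * w x)"
    unfolding req distrib_right by (intro Bochner_Integration.integral_add L2_mult_integrable dL2 wL2)
  also have "\<dots> = (L2norm \<Omega> w)\<^sup>2"
    using Pi0_properties(2)[OF f w] by (simp add: L2norm_sq) (simp add: power2_eq_square)
  finally have rw: "(LINT x|lebesgue_on \<Omega>. r x * w x) = (L2norm \<Omega> w)\<^sup>2" .
  have "L2norm \<Omega> w \<le> D"
  proof (cases "L2norm \<Omega> w = 0")
    case True
    then show ?thesis using dual_norm_bounds(1) by simp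
  next
    case False
    then have N: "0 < L2norm \<Omega> w" using L2norm_nonneg[of \<Omega> w] by linarith
    have "(LINT x|lebesgue_on \<Omega>. r x * w x) + (LINT x|lebesgue_on \<Omega>. s x \<bullet> 0) \<le> L2norm \<Omega> w * D"
      by (rule residual_test[OF w z _ N]) (simp_all add: L2norm_def)
    then have "L2norm \<Omega> w * L2norm \<Omega> w \<le> L2norm \<Omega> w * D"
      by (simp add: rw power2_eq_square)
    then show ?thesis using N by simp
  qed
  moreover have "L2norm \<Omega> r \<le> osc_f + L2norm \<Omega> w"
    using L2norm_triangle[OF dL2 wL2] by (simp only: req[abs_def])
  ultimately show ?thesis by linarith
qed

text \<open>Here \<open>w\<close> is the projection of \<open>s\<close>, and the test function
  \<open>v\<close> has piecewise gradient \<open>w\<close>. In contrast to the bound for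
  \<open>r\<close>, the test function also pairs with \<open>r\<close>. That pairing costs
  \<open>M * L2norm \<Omega> r\<close>, since
  \<open>norm (v x) \<le> M * norm (w x)\<close>.\<close>

lemma s_bound: "L2norm \<Omega> s \<le> osc_q + (1 + M) * D + M * L2norm \<Omega> r"
proof -
  note P = Pi0_vec_properties[OF RT0_L2(1)[OF q]]
  define w where "w = (\<lambda>x. Pi0_vec \<Omega> \<T> q x - \<sigma> (weak_grad \<Omega> v\<^sub>C x))"
  have w: "pw_const w"
    unfolding w_def by (rule pw_const_map2[OF P(1) sigma_v\<^sub>C])
  have wL2: "w \<in> L2 \<Omega>" by (rule pw_const_L2[OF w])
  have dL2: "(\<lambda>x. q x - Pi0_vec \<Omega> \<T> q x) \<in> L2 \<Omega>" by (intro L2_diff RT0_L2[OF q] pw_const_L2 P)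
  have z: "pw_const (\<lambda>x. 0::real)" by (auto simp: pw_const_def intro!: exI[of _ "\<lambda>_. 0"])
  have seq: "s x = (q x - Pi0_vec \<Omega> \<T> q x) + w x" for x by (simp add: s_def w_def)
  have "(LINT x|lebesgue_on \<Omega>. s x \<bullet> w x) = (LINT x|lebesgue_on \<Omega>. (q x - Pi0_vec \<Omega> \<T> q x) \<bullet> w x) + (LINT x|lebesgue_on \<Omega>. w x \<bullet> w x)"
    unfolding seq inner_add_left by (intro Bochner_Integration.integral_add L2_inner_integrable dL2 wL2)
  also have "\<dots> = (L2norm \<Omega> w)\<^sup>2"
    using P(2)[OF w] by (simp add: L2norm_sq power2_norm_eq_inner)
  finally have sw: "(LINT x|lebesgue_on \<Omega>. s x \<bullet> w x) = (L2norm \<Omega> w)\<^sup>2" .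
  define v where "v = (\<lambda>x. w x \<bullet> x)"
  have v: "v x = 0 + w x \<bullet> x" for x by (simp add: v_def)
  have vL2: "v \<in> L2 \<Omega>" by (rule Pk_1_L2(1)[OF pw_affine_Pk_1(1)[OF z w v]])
  have vn: "L2norm \<Omega> v \<le> M * L2norm \<Omega> w"
  proof (rule L2_dominated(2)[OF wL2 L2_measurable[OF vL2] _ M(2)])
    fix x assume "x \<in> \<Omega>"
    have "norm (v x) \<le> norm (w x) * norm x" unfolding v_def real_norm_def by (rule Cauchy_Schwarz_ineq2)
    also have "\<dots> \<le> norm (w x) * M" using M(1)[OF \<open>x \<in> \<Omega>\<close>] by (intro mult_left_mono) auto
    finally show "norm (v x) \<le> M * norm (w x)" by (simp add: mult.commute)
  qed
  have "L2norm \<Omega> w \<le> (1 + M) * D + M * L2norm \<Omega> r"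
  proof (cases "L2norm \<Omega> w = 0")
    case True
    then show ?thesis using dual_norm_bounds(1) M(2) by simp
  next
    case False
    then have W: "0 < L2norm \<Omega> w" using L2norm_nonneg[of \<Omega> w] by linarith
    \<comment> \<open>The normalization covers both parts of the energy norm of \<open>v\<close>,
      because \<open>M\<^sup>2 + 1 \<le> (1 + M)\<^sup>2\<close>.\<close>
    have N: "0 < (1 + M) * L2norm \<Omega> w" using W M(2) by simp
    have "(L2norm \<Omega> v)\<^sup>2 + (L2norm \<Omega> w)\<^sup>2 \<le> (M * L2norm \<Omega> w)\<^sup>2 + (L2norm \<Omega> w)\<^sup>2"
      using vn by (simp add: power_mono)
    also have "\<dots> = (M\<^sup>2 + 1) * (L2norm \<Omega> w)\<^sup>2" by (simp add: power_mult_distrib distrib_right)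
    also have "\<dots> \<le> (1 + M)\<^sup>2 * (L2norm \<Omega> w)\<^sup>2"
      using M(2) by (intro mult_right_mono) (simp_all add: power2_sum)
    finally have "(L2norm \<Omega> v)\<^sup>2 + (L2norm \<Omega> w)\<^sup>2 \<le> ((1 + M) * L2norm \<Omega> w)\<^sup>2"
      by (simp add: power_mult_distrib)
    from residual_test[OF z w v N this]
    have "(LINT x|lebesgue_on \<Omega>. r x * v x) + (L2norm \<Omega> w)\<^sup>2 \<le> (1 + M) * L2norm \<Omega> w * D"
      by (simp only: sw)
    moreover have "- (LINT x|lebesgue_on \<Omega>. r x * v x) \<le> L2norm \<Omega> r * (M * L2norm \<Omega> w)"
    proof -
      have "- (LINT x|lebesgue_on \<Omega>. r x * v x) \<le> L2norm \<Omega> r * L2norm \<Omega> v"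
        using L2_Cauchy_Schwarz[OF r_L2 vL2] by simp
      also have "\<dots> \<le> L2norm \<Omega> r * (M * L2norm \<Omega> w)" using vn by (intro mult_left_mono) auto
      finally show ?thesis .
    qed
    ultimately have "(L2norm \<Omega> w)\<^sup>2 \<le> (1 + M) * L2norm \<Omega> w * D + L2norm \<Omega> r * (M * L2norm \<Omega> w)" by linarith
    then have "L2norm \<Omega> w * L2norm \<Omega> w \<le> L2norm \<Omega> w * ((1 + M) * D + M * L2norm \<Omega> r)"
      by (simp add: power2_eq_square algebra_simps)
    then show ?thesis using W by simp
  qed
  moreover have "L2norm \<Omega> s \<le> osc_q + L2norm \<Omega> w"
    using L2norm_triangle[OF dL2 wL2] by (simp only: seq[abs_def])
  ultimately show ?thesis by linarith
qed

section \<open>The error in terms of r and s\<close>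

definition "w x = u x - v\<^sub>C x"

lemma v\<^sub>C_H10: "v\<^sub>C \<in> H10 \<Omega>" using v\<^sub>C by (simp add: S10_def)
lemma w_H10: "w \<in> H10 \<Omega>" unfolding w_def[abs_def] by (rule H10_diff(1)[OF op bdd u_H10 v\<^sub>C_H10])

lemmas w_L2 = H10_L2[OF op bdd w_H10]

lemma weak_grad_w:
  "AE x in lebesgue_on \<Omega>. weak_grad \<Omega> w x = weak_grad \<Omega> u x - weak_grad \<Omega> v\<^sub>C x"
  unfolding w_def[abs_def] by (rule H10_diff(2)[OF op bdd u_H10 v\<^sub>C_H10])

lemma Hdiv_error: "(Hdiv_norm \<Omega> (\<lambda>x. p x - q x))\<^sup>2 = (L2norm \<Omega> (\<lambda>x. p x - q x))\<^sup>2 + (L2norm \<Omega> r)\<^sup>2"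
proof -
  have weak: "has_weak_div \<Omega> (\<lambda>x. p x - q x) (\<lambda>x. - f x - weak_div \<Omega> q x)"
    by (intro has_weak_div_diff p_weak_div RT0_L2[OF q] p_L2 L2_uminus f meas_\<Omega>)
  have L2: "(\<lambda>x. - f x - weak_div \<Omega> q x) \<in> L2 \<Omega>" by (intro L2_diff L2_uminus f RT0_L2[OF q])
  note d = weak_div_eqI[OF op bdd L2 weak]
  have "L2norm \<Omega> (weak_div \<Omega> (\<lambda>x. p x - q x)) = L2norm \<Omega> (\<lambda>x. - f x - weak_div \<Omega> q x)"
    by (rule L2norm_cong_AE[OF d(2) L2 d(1)])
  also have "\<dots> = L2norm \<Omega> r"
    using L2norm_uminus[of \<Omega> r] by (simp add: r_def[abs_def])
  finally show ?thesis by (simp add: Hdiv_norm_def)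
qed

lemma flux_difference:
  "L2norm \<Omega> (\<lambda>x. p x - \<sigma> (weak_grad \<Omega> v\<^sub>C x)) \<le> \<gamma>\<^sub>2 * L2norm \<Omega> (weak_grad \<Omega> w)"
proof -
  let ?g = "\<lambda>x. weak_grad \<Omega> u x - weak_grad \<Omega> v\<^sub>C x"
  note uL2 = H10_L2[OF op bdd u_H10] and vL2 = H10_L2[OF op bdd v\<^sub>C_H10]
  have g: "?g \<in> L2 \<Omega>" by (intro L2_diff uL2 vL2)
  have "L2norm \<Omega> (\<lambda>x. p x - \<sigma> (weak_grad \<Omega> v\<^sub>C x)) \<le> \<gamma>\<^sub>2 * L2norm \<Omega> ?g"
  proof (rule L2_dominated(2)[OF g])
    show "(\<lambda>x. p x - \<sigma> (weak_grad \<Omega> v\<^sub>C x)) \<in> borel_measurable (lebesgue_on \<Omega>)"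
      by (intro L2_measurable L2_diff p_L2 sigma_L2 vL2)
    show "norm (p x - \<sigma> (weak_grad \<Omega> v\<^sub>C x)) \<le> \<gamma>\<^sub>2 * norm (?g x)" for x
      unfolding p_def by (rule sigma_map_lipschitz[OF adm \<gamma>\<^sub>1_pos])
    show "0 \<le> \<gamma>\<^sub>2" using nonlinearity_bounds[OF adm \<gamma>\<^sub>1_pos, of 0] by simp
  qed
  also have "L2norm \<Omega> ?g = L2norm \<Omega> (weak_grad \<Omega> w)"
    using L2norm_cong_AE[OF w_L2(2) g weak_grad_w] by simp
  finally show ?thesis .
qed

text \<open>Strong monotonicity bounds the energy of the error by the flux difference tested with
  the gradient of \<open>w\<close>. The weak equation turns the exact flux into \<open>f\<close>,
  and inserting \<open>q\<close>, integrated by parts against \<open>w\<close>, produces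
  \<open>r\<close> and \<open>s\<close>. Friedrichs' inequality for \<open>w\<close> then leaves a
  common factor, which cancels.\<close>

lemma energy_bound: "\<gamma>\<^sub>1 * L2norm \<Omega> (weak_grad \<Omega> w) \<le> 2 * M * L2norm \<Omega> r + L2norm \<Omega> s"
proof -
  let ?G = "weak_grad \<Omega> w" and ?S = "\<lambda>x. \<sigma> (weak_grad \<Omega> v\<^sub>C x)"
  note qL2 = RT0_L2[OF q]
  have SL2: "?S \<in> L2 \<Omega>" by (rule pw_const_L2[OF sigma_v\<^sub>C])
  have pS: "(\<lambda>x. p x - ?S x) \<in> L2 \<Omega>" by (intro L2_diff p_L2 SL2)
  have "\<gamma>\<^sub>1 * (L2norm \<Omega> ?G)\<^sup>2 = (LINT x|lebesgue_on \<Omega>. \<gamma>\<^sub>1 * (norm (?G x))\<^sup>2)" by (simp add: L2norm_sq)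
  also have "\<dots> \<le> (LINT x|lebesgue_on \<Omega>. (p x - ?S x) \<bullet> ?G x)"
  proof (rule integral_mono_AE)
    show "AE x in lebesgue_on \<Omega>. \<gamma>\<^sub>1 * (norm (?G x))\<^sup>2 \<le> (p x - ?S x) \<bullet> ?G x"
      using weak_grad_w
    proof eventually_elim
      case (elim x)
      then show ?case using sigma_map_strongly_monotone[OF adm \<gamma>\<^sub>1_pos] by (simp add: p_def)
    qed
  qed (use L2_integrable_sq[OF w_L2(2)] L2_inner_integrable[OF pS w_L2(2)] in auto)
  also have "\<dots> = (LINT x|lebesgue_on \<Omega>. p x \<bullet> ?G x) - (LINT x|lebesgue_on \<Omega>. ?S x \<bullet> ?G x)"
    using L2_inner_integrable[OF p_L2 w_L2(2)] L2_inner_integrable[OF SL2 w_L2(2)] by (simp add: inner_diff_left)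
  also have "\<dots> = (LINT x|lebesgue_on \<Omega>. r x * w x) + (LINT x|lebesgue_on \<Omega>. s x \<bullet> ?G x)"
  proof -
    have "(LINT x|lebesgue_on \<Omega>. q x \<bullet> ?G x) = - (LINT x|lebesgue_on \<Omega>. weak_div \<Omega> q x * w x)"
      by (rule H10_weak_div[OF op bdd w_H10 qL2(1-3)])
    moreover have "(LINT x|lebesgue_on \<Omega>. s x \<bullet> ?G x) = (LINT x|lebesgue_on \<Omega>. q x \<bullet> ?G x) - (LINT x|lebesgue_on \<Omega>. ?S x \<bullet> ?G x)"
      using L2_inner_integrable[OF qL2(1) w_L2(2)] L2_inner_integrable[OF SL2 w_L2(2)] by (simp add: s_def inner_diff_left)
    moreover have "(LINT x|lebesgue_on \<Omega>. r x * w x) = (LINT x|lebesgue_on \<Omega>. f x * w x) + (LINT x|lebesgue_on \<Omega>. weak_div \<Omega> q x * w x)"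
      using L2_mult_integrable[OF f w_L2(1)] L2_mult_integrable[OF qL2(2) w_L2(1)] by (simp add: r_def distrib_right)
    ultimately show ?thesis using weak_solutionD[OF w_H10] by simp
  qed
  also have "\<dots> \<le> L2norm \<Omega> r * (2 * M * L2norm \<Omega> ?G) + L2norm \<Omega> s * L2norm \<Omega> ?G"
  proof (rule add_mono)
    have "(LINT x|lebesgue_on \<Omega>. r x * w x) \<le> L2norm \<Omega> r * L2norm \<Omega> w"
      using L2_Cauchy_Schwarz[OF r_L2 w_L2(1)] by simp
    also have "\<dots> \<le> L2norm \<Omega> r * (2 * M * L2norm \<Omega> ?G)"
      using Poincare[OF op bdd w_H10 M] by (intro mult_left_mono) auto
    finally show "(LINT x|lebesgue_on \<Omega>. r x * w x) \<le> L2norm \<Omega> r * (2 * M * L2norm \<Omega> ?G)" .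
    show "(LINT x|lebesgue_on \<Omega>. s x \<bullet> ?G x) \<le> L2norm \<Omega> s * L2norm \<Omega> ?G"
      using L2_Cauchy_Schwarz[OF s_L2 w_L2(2)] by simp
  qed
  finally have "L2norm \<Omega> ?G * (\<gamma>\<^sub>1 * L2norm \<Omega> ?G) \<le> L2norm \<Omega> ?G * (2 * M * L2norm \<Omega> r + L2norm \<Omega> s)"
    by (simp add: power2_eq_square algebra_simps)
  then show ?thesis
    using M(2) L2norm_nonneg[of \<Omega> ?G] by (cases "L2norm \<Omega> ?G = 0") (auto simp: mult_le_cancel_left)
qed

lemma flux_error: "L2norm \<Omega> (\<lambda>x. p x - q x) \<le> \<gamma>\<^sub>2 * L2norm \<Omega> (weak_grad \<Omega> w) + L2norm \<Omega> s"
  and s_error: "L2norm \<Omega> s \<le> L2norm \<Omega> (\<lambda>x. p x - q x) + \<gamma>\<^sub>2 * L2norm \<Omega> (weak_grad \<Omega> w)"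
proof -
  let ?S = "\<lambda>x. \<sigma> (weak_grad \<Omega> v\<^sub>C x)"
  have SL2: "?S \<in> L2 \<Omega>" by (rule pw_const_L2[OF sigma_v\<^sub>C])
  note qL2 = RT0_L2(1)[OF q]
  show "L2norm \<Omega> (\<lambda>x. p x - q x) \<le> \<gamma>\<^sub>2 * L2norm \<Omega> (weak_grad \<Omega> w) + L2norm \<Omega> s"
    using L2norm_diff_triangle[OF p_L2 SL2 qL2] flux_difference L2norm_minus_commute[of \<Omega> ?S q]
    by (simp add: s_def[abs_def])
  show "L2norm \<Omega> s \<le> L2norm \<Omega> (\<lambda>x. p x - q x) + \<gamma>\<^sub>2 * L2norm \<Omega> (weak_grad \<Omega> w)"
    using L2norm_diff_triangle[OF qL2 p_L2 SL2] flux_difference L2norm_minus_commute[of \<Omega> q p]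
    by (simp add: s_def[abs_def])
qed

section \<open>Equivalence of error and residual with explicit constants\<close>

abbreviation "R \<equiv> residual_sq \<Omega> \<T> \<phi> f v\<^sub>C q"
abbreviation "E \<equiv> (Hdiv_norm \<Omega> (\<lambda>x. p x - q x))\<^sup>2 + (L2norm \<Omega> (weak_grad \<Omega> w))\<^sup>2"

lemma R_eq: "R = D\<^sup>2 + osc_f\<^sup>2 + osc_q\<^sup>2"
  by (simp add: residual_sq_def D_def)

text \<open>Origin of the constant: \<open>D\<^sup>2\<close> is at most twice the sum of the squares
  of \<open>?r\<close> and \<open>?s\<close>, and the oscillations add one more of each. Splitting
  \<open>?s\<close> into the flux error and \<open>\<gamma>\<^sub>2\<close> times the gradient error
  doubles again. The coefficients 3, 6 and \<open>6 * \<gamma>\<^sub>2\<^sup>2\<close> are all at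
  most \<open>9 + 6 * \<gamma>\<^sub>2\<^sup>2\<close>.\<close>

lemma efficiency: "1 / (9 + 6 * \<gamma>\<^sub>2\<^sup>2) * R \<le> E"
proof -
  let ?r = "L2norm \<Omega> r" and ?s = "L2norm \<Omega> s" and ?e = "L2norm \<Omega> (\<lambda>x. p x - q x)" and ?g = "L2norm \<Omega> (weak_grad \<Omega> w)"
  have sq: "(a + b)\<^sup>2 \<le> 2 * a\<^sup>2 + 2 * b\<^sup>2" for a b :: real
    using sum_squares_bound[of a b] by (simp add: power2_sum)
  have "D\<^sup>2 \<le> (?r + ?s)\<^sup>2" using dual_norm_bounds by (intro power_mono)
  moreover have "osc_f\<^sup>2 \<le> ?r\<^sup>2" "osc_q\<^sup>2 \<le> ?s\<^sup>2" using osc_bounds by (auto intro!: power_mono)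
  ultimately have R: "R \<le> 3 * ?r\<^sup>2 + 3 * ?s\<^sup>2" unfolding R_eq using sq[of ?r ?s] by linarith
  have "?s\<^sup>2 \<le> (?e + \<gamma>\<^sub>2 * ?g)\<^sup>2" using s_error by (intro power_mono) auto
  then have "?s\<^sup>2 \<le> 2 * ?e\<^sup>2 + 2 * \<gamma>\<^sub>2\<^sup>2 * ?g\<^sup>2" using sq[of ?e "\<gamma>\<^sub>2 * ?g"] by (simp add: power_mult_distrib)
  then have "R \<le> 3 * ?r\<^sup>2 + 6 * ?e\<^sup>2 + (6 * \<gamma>\<^sub>2\<^sup>2) * ?g\<^sup>2" using R by linarith
  also have "\<dots> \<le> (9 + 6 * \<gamma>\<^sub>2\<^sup>2) * ?r\<^sup>2 + (9 + 6 * \<gamma>\<^sub>2\<^sup>2) * ?e\<^sup>2 + (9 + 6 * \<gamma>\<^sub>2\<^sup>2) * ?g\<^sup>2"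
    by (intro add_mono mult_right_mono) auto
  also have "\<dots> = (9 + 6 * \<gamma>\<^sub>2\<^sup>2) * E" unfolding Hdiv_error by (simp add: distrib_left)
  finally show ?thesis by (simp add: divide_le_eq add_pos_nonneg mult.commute)
qed

text \<open>All contributions are measured by the single sum \<open>S\<close> of the three
  computable quantities: \<open>r\<close> by \<open>S\<close>, \<open>s\<close> by
  \<open>(1 + 2 * M) * S\<close>, the gradient by \<open>K * S\<close>, where
  \<open>1 + 4 * M\<close> in \<open>K\<close> is \<open>2 * M\<close> from Friedrichs plus
  \<open>1 + 2 * M\<close> from \<open>s\<close>. The factor 3 is the price for
  \<open>S\<^sup>2\<close> against the sum of three squares.\<close>

lemma reliability:
  fixes K
  defines "K \<equiv> (1 + 4 * M) / \<gamma>\<^sub>1"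
  shows "E \<le> 3 * (1 + K\<^sup>2 + (\<gamma>\<^sub>2 * K + 1 + 2 * M)\<^sup>2) * R"
proof -
  let ?r = "L2norm \<Omega> r" and ?s = "L2norm \<Omega> s" and ?e = "L2norm \<Omega> (\<lambda>x. p x - q x)" and ?g = "L2norm \<Omega> (weak_grad \<Omega> w)"
  define S where "S = D + osc_f + osc_q"
  have nonneg: "0 \<le> D" "0 \<le> osc_f" "0 \<le> osc_q" using dual_norm_bounds by auto
  have \<gamma>\<^sub>2: "0 \<le> \<gamma>\<^sub>2" using nonlinearity_bounds[OF adm \<gamma>\<^sub>1_pos, of 0] by simp
  have r: "?r \<le> S" unfolding S_def using r_bound nonneg by linarith
  have MD: "0 \<le> M * D" "0 \<le> M * osc_f" "0 \<le> M * osc_q" using nonneg M(2) by auto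
  have "M * ?r \<le> M * (osc_f + D)" using r_bound M(2) by (rule mult_left_mono)
  \<comment> \<open>Inserting the bound for \<open>r\<close> into that for \<open>s\<close> gives
    the coefficients \<open>1 + 2 * M\<close> for \<open>D\<close>, \<open>M\<close> for
    \<open>osc_f\<close> and 1 for \<open>osc_q\<close>.\<close>
  then have s: "?s \<le> (1 + 2 * M) * S"
    unfolding S_def using s_bound nonneg MD by (simp only: distrib_left distrib_right mult_1_left)
  have "2 * M * ?r \<le> 2 * M * S" using r M(2) by (intro mult_left_mono) auto
  then have "\<gamma>\<^sub>1 * ?g \<le> (1 + 4 * M) * S" using energy_bound s by (simp add: algebra_simps)
  then have g: "?g \<le> K * S" using \<gamma>\<^sub>1_pos by (simp add: K_def field_simps)
  have "\<gamma>\<^sub>2 * ?g \<le> \<gamma>\<^sub>2 * (K * S)" using g \<gamma>\<^sub>2 by (rule mult_left_mono)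
  then have e: "?e \<le> (\<gamma>\<^sub>2 * K + 1 + 2 * M) * S" using flux_error s by (simp add: algebra_simps)
  have "E \<le> ((\<gamma>\<^sub>2 * K + 1 + 2 * M) * S)\<^sup>2 + S\<^sup>2 + (K * S)\<^sup>2"
    unfolding Hdiv_error using r g e by (intro add_mono power_mono) auto
  also have "\<dots> = (1 + K\<^sup>2 + (\<gamma>\<^sub>2 * K + 1 + 2 * M)\<^sup>2) * S\<^sup>2"
  proof -
    have "(a * t)\<^sup>2 + t\<^sup>2 + (b * t)\<^sup>2 = (1 + b\<^sup>2 + a\<^sup>2) * t\<^sup>2" for a b t :: real
      by (simp add: power_mult_distrib distrib_right)
    then show ?thesis .
  qed
  also have "\<dots> \<le> (1 + K\<^sup>2 + (\<gamma>\<^sub>2 * K + 1 + 2 * M)\<^sup>2) * (3 * R)"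
  proof (rule mult_left_mono)
    show "S\<^sup>2 \<le> 3 * R"
      unfolding R_eq S_def
      using sum_squares_bound[of D osc_f] sum_squares_bound[of D osc_q] sum_squares_bound[of osc_f osc_q]
      by (simp add: power2_eq_square algebra_simps)
    show "0 \<le> 1 + K\<^sup>2 + (\<gamma>\<^sub>2 * K + 1 + 2 * M)\<^sup>2" by simp
  qed
  finally show ?thesis by (simp only: mult.assoc mult.left_commute[of _ 3])
qed

end

section \<open>Choice of the constants and assembly\<close>

theorem theorem4p1:
  fixes \<Omega> :: "'a::euclidean_space set" and \<T>\<^sub>0 :: "'a set set" and \<gamma>\<^sub>1 \<gamma>\<^sub>2 \<rho> :: real
  assumes "bounded_lipschitz_domain \<Omega>" and "polyhedral_boundary \<Omega>"
    and "regular_triangulation \<Omega> \<T>\<^sub>0"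
    and "0 < \<gamma>\<^sub>1" and "\<gamma>\<^sub>1 \<le> \<gamma>\<^sub>2" and "0 < \<rho>"
  shows "\<exists>c C. 0 < c \<and> c \<le> C \<and>
    (\<forall>\<phi>. admissible_nonlinearity \<gamma>\<^sub>1 \<gamma>\<^sub>2 \<phi> \<and> Ck_on 1 UNIV (sigma_map \<phi> :: 'a \<Rightarrow> 'a) \<longrightarrow>
      (\<forall>\<T> \<in> admissible_triangulations \<Omega> \<T>\<^sub>0 \<rho>. \<forall>f \<in> L2 \<Omega>. \<forall>u. weak_solution \<Omega> \<phi> f u \<longrightarrow>
        (let p = (\<lambda>x. sigma_map \<phi> (weak_grad \<Omega> u x)) in
          p \<in> Hdiv \<Omega> \<and>
          (\<forall>v\<^sub>C \<in> S10 \<Omega> \<T>. \<forall>q \<in> RT0 \<Omega> \<T>.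
            (let R = residual_sq \<Omega> \<T> \<phi> f v\<^sub>C q;
                 E = (Hdiv_norm \<Omega> (\<lambda>x. p x - q x))\<^sup>2
                   + (L2norm \<Omega> (weak_grad \<Omega> (\<lambda>x. u x - v\<^sub>C x)))\<^sup>2
             in c * R \<le> E \<and> E \<le> C * R)))))"
proof -
  have op: "open \<Omega>" and bdd: "bounded \<Omega>" using assms(1) by (auto simp: bounded_lipschitz_domain_def)
  \<comment> \<open>The bound depends on the domain, which is recovered from the initial
    triangulation as the interior of its union. It is fixed before \<phi>, the refinement and the
    data are introduced.\<close>
  obtain M where M: "\<And>x. x \<in> \<Omega> \<Longrightarrow> norm x \<le> M" "0 \<le> M"
    using bdd unfolding bounded_pos by (meson less_imp_le)
  define K where "K = (1 + 4 * M) / \<gamma>\<^sub>1"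
  define c where "c = 1 / (9 + 6 * \<gamma>\<^sub>2\<^sup>2)"
  define C where "C = 3 * (1 + K\<^sup>2 + (\<gamma>\<^sub>2 * K + 1 + 2 * M)\<^sup>2)"
  have "0 < c" unfolding c_def by (simp add: add_pos_nonneg)
  moreover have "c \<le> C"
  proof -
    \<comment> \<open>The order of the two constants is read off from 1, which separates
      them.\<close>
    have "c \<le> 1" unfolding c_def by (simp add: divide_le_eq add_pos_nonneg)
    moreover have "1 \<le> 3 * (1 + a\<^sup>2 + b\<^sup>2)" for a b :: real
      using zero_le_power2[of a] zero_le_power2[of b] by simp
    then have "1 \<le> C" unfolding C_def .
    ultimately show ?thesis by linarith
  qed
  moreover have "let p = (\<lambda>x. sigma_map \<phi> (weak_grad \<Omega> u x)) in
          p \<in> Hdiv \<Omega> \<and>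
          (\<forall>v\<^sub>C \<in> S10 \<Omega> \<T>. \<forall>q \<in> RT0 \<Omega> \<T>.
            (let R = residual_sq \<Omega> \<T> \<phi> f v\<^sub>C q;
                 E = (Hdiv_norm \<Omega> (\<lambda>x. p x - q x))\<^sup>2
                   + (L2norm \<Omega> (weak_grad \<Omega> (\<lambda>x. u x - v\<^sub>C x)))\<^sup>2
             in c * R \<le> E \<and> E \<le> C * R))"
    if \<phi>: "admissible_nonlinearity \<gamma>\<^sub>1 \<gamma>\<^sub>2 \<phi>" and \<T>: "\<T> \<in> admissible_triangulations \<Omega> \<T>\<^sub>0 \<rho>"
      and f: "f \<in> L2 \<Omega>" and u: "weak_solution \<Omega> \<phi> f u" for \<phi> \<T> f u
  proof -
    interpret exact_solution \<Omega> \<T> \<gamma>\<^sub>1 \<gamma>\<^sub>2 \<phi> f u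
      using op bdd negligible_frontier_polyhedral[OF assms(2)] interior_closure_lipschitz_domain[OF assms(1)] \<T> \<phi> assms(4) f u
      by unfold_locales (auto simp: admissible_triangulations_def)
    have "c * residual_sq \<Omega> \<T> \<phi> f v\<^sub>C q \<le> (Hdiv_norm \<Omega> (\<lambda>x. sigma_map \<phi> (weak_grad \<Omega> u x) - q x))\<^sup>2 + (L2norm \<Omega> (weak_grad \<Omega> (\<lambda>x. u x - v\<^sub>C x)))\<^sup>2"
      "(Hdiv_norm \<Omega> (\<lambda>x. sigma_map \<phi> (weak_grad \<Omega> u x) - q x))\<^sup>2 + (L2norm \<Omega> (weak_grad \<Omega> (\<lambda>x. u x - v\<^sub>C x)))\<^sup>2 \<le> C * residual_sq \<Omega> \<T> \<phi> f v\<^sub>C q"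
      if "v\<^sub>C \<in> S10 \<Omega> \<T>" "q \<in> RT0 \<Omega> \<T>" for v\<^sub>C q
    proof -
      interpret residual_setting \<Omega> \<T> \<gamma>\<^sub>1 \<gamma>\<^sub>2 \<phi> f u v\<^sub>C q M
        using that M by unfold_locales
      show "c * residual_sq \<Omega> \<T> \<phi> f v\<^sub>C q \<le> (Hdiv_norm \<Omega> (\<lambda>x. sigma_map \<phi> (weak_grad \<Omega> u x) - q x))\<^sup>2 + (L2norm \<Omega> (weak_grad \<Omega> (\<lambda>x. u x - v\<^sub>C x)))\<^sup>2"
        using efficiency unfolding c_def p_def w_def[abs_def] .
      show "(Hdiv_norm \<Omega> (\<lambda>x. sigma_map \<phi> (weak_grad \<Omega> u x) - q x))\<^sup>2 + (L2norm \<Omega> (weak_grad \<Omega> (\<lambda>x. u x - v\<^sub>C x)))\<^sup>2 \<le> C * residual_sq \<Omega> \<T> \<phi> f v\<^sub>C q"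
        using reliability unfolding C_def K_def p_def w_def[abs_def] .
    qed
    then show ?thesis
      using p_Hdiv unfolding p_def[abs_def] Let_def by blast
  qed
  ultimately show ?thesis by blast
qed

end
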